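(* Let $(\mathbf u,p,\mathbf B,\phi,\omega)$ be a (sufficiently smooth) solution on $\Omega\times(0,T)$ of the diffuse interface CH-MHD system with variable density $$\rho(\phi)\mathbf u_t+\big((\rho(\phi)\mathbf u-\rho'(\phi)M(\phi)\nabla\omega)\cdot\nabla\big)\mathbf u-\nabla\cdot(2\eta(\phi)D(\mathbf u))+\nabla p-\tfrac1\mu(\nabla\times\mathbf B)\times\mathbf B+\phi\nabla\omega=\mathbf 0,$$ $$\nabla\cdot\mathbf u=0,\qquad \mathbf B_t+\tfrac1\mu\nabla\times\Big(\tfrac1{\sigma(\phi)}\nabla\times\mathbf B\Big)-\nabla\times(\mathbf u\times\mathbf B)=\mathbf 0,\qquad \nabla\cdot\mathbf B=0,$$ $$\phi_t+\nabla\cdot(\phi\mathbf u)-\nabla\cdot(M(\phi)\nabla\omega)=0,\qquad \omega=-\gamma\varepsilon\Delta\phi+\tfrac\gamma\varepsilon f(\phi),$$ with boundary conditions $\mathbf u=\mathbf 0$, $\mathbf B\times\mathbf n=\mathbf 0$, $\partial_n\phi=0$, $M(\phi)\partial_n\omega=0$ on $\partial\Omega$ and initial conditions $\mathbf u(0)=\mathbf u^0$, $\mathbf B(0)=\mathbf B^0$, $\phi(0)=\phi^0$. Define $$E=\gamma\int_\Omega\Big(\tfrac\varepsilon2|\nabla\phi|^2+\tfrac1\varepsilon F(\phi)\Big)d\mathbf x+\tfrac12\int_\Omega\rho(\phi)|\mathbf u|^2d\mathbf x+\tfrac12\int_\Omega\frac{|\mathbf B|^2}{\mu}d\mathbf x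 .$$ Then the system is thermodynamically consistent in the sense that $$\frac{dE}{dt}=-\Big(\|\sqrt{M(\phi)}\,\nabla\omega\|^2+2\|\sqrt{\eta(\phi)}\,D(\mathbf u)\|^2+\frac1{\mu^2}\Big\|\frac1{\sqrt{\sigma(\phi)}}\nabla\times\mathbf B\Big\|^2\Big)\le 0 .$$
   Context: $\Omega\subset\mathbb R^d$, $d\in\{2,3\}$, is a bounded convex domain with unit outer normal $\mathbf n$; $\|\cdot\|$ is the $L^2(\Omega)$ norm. $D(\mathbf u)=\frac12(\nabla\mathbf u+(\nabla\mathbf u)^T)$. $F(\phi)=\frac14(\phi^2-1)^2$ and $f=F'$. The constants $\gamma,\varepsilon,\mu$ are positive. With positive constants $\rho_j,\sigma_j,M_j,\eta_j$ ($j=1,2$), $$\rho(\phi)=\tfrac{\rho_2-\rho_1}2\phi+\tfrac{\rho_1+\rho_2}2,$$ and $\sigma(\phi),M(\phi),\eta(\phi)$ are given by the same affine formula with $\rho_j$ replaced by $\sigma_j$, $M_j$, $\eta_j$ respectively; $\rho'(\phi)=\frac{\rho_2-\rho_1}{2}$. The values of $\rho(\phi),\sigma(\phi),M(\phi),\eta(\phi)$ along the solution are assumed to be positive, lying between the two corresponding constants. *)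

theory Defs
  imports "HOL-Analysis.Analysis"
begin

section \<open>Smoothness up to the boundary\<close>

text \<open>
  C^k regularity on a set S, which is used for S = (closure \<Omega>) times (0,T) with \<Omega> open and convex.
  Derivatives are taken within S, so at points of the lateral boundary they are the one-sided ones;
  they are unique because S is convex with nonempty interior.  The recursion goes through
  directional derivatives in order to stay within one type.
\<close>

primrec C_on :: "nat \<Rightarrow> 'a::real_normed_vector set \<Rightarrow> ('a \<Rightarrow> 'b::real_normed_vector) \<Rightarrow> bool" where
  "C_on 0 S f \<longleftrightarrow> continuous_on S f"
| "C_on (Suc k) S f \<longleftrightarrow>
     (\<exists>f'. (\<forall>z\<in>S. (f has_derivative f' z) (at z within S)) \<and> (\<forall>v. C_on k S (\<lambda>z. f' z v)))"


section \<open>Differential operators in the space variable\<close>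

definition partial :: "'d::finite \<Rightarrow> (real^'d \<Rightarrow> 'b::real_normed_vector) \<Rightarrow> real^'d \<Rightarrow> 'b" where
  "partial i f x = frechet_derivative f (at x) (axis i 1)"

definition grad :: "(real^'d::finite \<Rightarrow> real) \<Rightarrow> real^'d \<Rightarrow> real^'d" where
  "grad f x = (\<chi> i. partial i f x)"

definition divergence :: "(real^'d::finite \<Rightarrow> real^'d) \<Rightarrow> real^'d \<Rightarrow> real" where
  "divergence v x = (\<Sum>i\<in>UNIV. partial i (\<lambda>y. v y $ i) x)"

definition tensor_divergence :: "(real^'d::finite \<Rightarrow> real^'d^'d) \<Rightarrow> real^'d \<Rightarrow> real^'d" where
  "tensor_divergence A x = (\<chi> i. divergence (\<lambda>y. A y $ i) x)"

definition laplacian :: "(real^'d::finite \<Rightarrow> real) \<Rightarrow> real^'d \<Rightarrow> real" where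
  "laplacian f x = divergence (grad f) x"

definition sym_grad :: "(real^'d::finite \<Rightarrow> real^'d) \<Rightarrow> real^'d \<Rightarrow> real^'d^'d" where
  "sym_grad u x = (1/2) *\<^sub>R (jacobian u (at x) + transpose (jacobian u (at x)))"

text \<open>The convective derivative (w \<sqdot> \<nabla>) u.\<close>

definition convect :: "real^'d::finite \<Rightarrow> (real^'d \<Rightarrow> real^'d) \<Rightarrow> real^'d \<Rightarrow> real^'d" where
  "convect w u x = (\<Sum>i\<in>UNIV. (w $ i) *\<^sub>R partial i u x)"

abbreviation time_deriv :: "(real \<Rightarrow> 'a \<Rightarrow> 'b::real_normed_vector) \<Rightarrow> real \<Rightarrow> 'a \<Rightarrow> 'b" where
  "time_deriv f t x \<equiv> vector_derivative (\<lambda>s. f s x) (at t)"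


section \<open>Curl and cross product in two and three dimensions\<close>

text \<open>
  In dimension 3 all vector quantities are in R^3.  In dimension 2 the usual convention identifies
  (v1, v2) with (v1, v2, 0) and a scalar c with (0, 0, c), all fields being independent of x3:
  the curl of a vector field and the product of two vectors are then scalars, whereas the curl of
  a scalar and the product of a scalar with a vector are vectors.  The type 'c is that of the
  former quantities (real in dimension 2, real^3 in dimension 3).  The fields of the record are
  curl v and v \<times> w for vectors v, w, and curl c and c \<times> w for c of type 'c and a vector w.
\<close>

record ('v, 'c) cross_ops =
  curl :: "('v \<Rightarrow> 'v) \<Rightarrow> 'v \<Rightarrow> 'c"
  cross :: "'v \<Rightarrow> 'v \<Rightarrow> 'c"
  curl' :: "('v \<Rightarrow> 'c) \<Rightarrow> 'v \<Rightarrow> 'v"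
  cross' :: "'c \<Rightarrow> 'v \<Rightarrow> 'v"

definition curl_3D :: "(real^3 \<Rightarrow> real^3) \<Rightarrow> real^3 \<Rightarrow> real^3" where
  "curl_3D v x = vector
     [partial 2 (\<lambda>y. v y $ 3) x - partial 3 (\<lambda>y. v y $ 2) x,
      partial 3 (\<lambda>y. v y $ 1) x - partial 1 (\<lambda>y. v y $ 3) x,
      partial 1 (\<lambda>y. v y $ 2) x - partial 2 (\<lambda>y. v y $ 1) x]"

definition ops_3D :: "(real^3, real^3) cross_ops" where
  "ops_3D = \<lparr>curl = curl_3D, cross = cross3, curl' = curl_3D, cross' = cross3\<rparr>"

definition ops_2D :: "(real^2, real) cross_ops" where
  "ops_2D =
    \<lparr>curl = (\<lambda>v x. partial 1 (\<lambda>y. v y $ 2) x - partial 2 (\<lambda>y. v y $ 1) x),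
     cross = (\<lambda>v w. v $ 1 * w $ 2 - v $ 2 * w $ 1),
     curl' = (\<lambda>c x. vector [partial 2 c x, - partial 1 c x]),
     cross' = (\<lambda>c w. vector [- c * w $ 2, c * w $ 1])\<rparr>"


section \<open>Domain and boundary\<close>

definition bounded_convex_domain :: "(real^'d::finite) set \<Rightarrow> bool" where
  "bounded_convex_domain \<Omega> \<longleftrightarrow> open \<Omega> \<and> \<Omega> \<noteq> {} \<and> bounded \<Omega> \<and> convex \<Omega>"

text \<open>
  A boundary point of a convex domain has a unit outer normal n iff there is exactly one supporting
  half-space at that point.  This is the case at almost every boundary point (everywhere if the
  boundary is C^1, and off the edges and corners of a polytope); the boundary conditions that
  involve n are imposed at those points only.
\<close>

definition unit_outer_normal :: "(real^'d::finite) set \<Rightarrow> real^'d \<Rightarrow> real^'d \<Rightarrow> bool" where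
  "unit_outer_normal \<Omega> x n \<longleftrightarrow>
     x \<in> frontier \<Omega> \<and> {m. norm m = 1 \<and> (\<forall>y\<in>\<Omega>. m \<bullet> (y - x) \<le> 0)} = {n}"

text \<open>The derivative in direction n at a boundary point, taken from inside the domain.\<close>

definition normal_deriv :: "(real^'d::finite) set \<Rightarrow> real^'d \<Rightarrow> (real^'d \<Rightarrow> real) \<Rightarrow> real^'d \<Rightarrow> real" where
  "normal_deriv \<Omega> n f x = frechet_derivative f (at x within closure \<Omega>) n"

text \<open>The norm of L^2(\<Omega>).  On matrices, the pointwise norm is the Frobenius norm.\<close>

definition L2_norm :: "(real^'d::finite) set \<Rightarrow> (real^'d \<Rightarrow> 'b::real_normed_vector) \<Rightarrow> real" where
  "L2_norm \<Omega> g = sqrt (LINT x:\<Omega>|lborel. (norm (g x))\<^sup>2)"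


section \<open>The diffuse interface CH-MHD system\<close>

record params =
  gam :: real
  eps :: real
  mu :: real
  rho1 :: real
  rho2 :: real
  sigma1 :: real
  sigma2 :: real
  M1 :: real
  M2 :: real
  eta1 :: real
  eta2 :: real

definition positive_params :: "params \<Rightarrow> bool" where
  "positive_params P \<longleftrightarrow>
     gam P > 0 \<and> eps P > 0 \<and> mu P > 0 \<and> rho1 P > 0 \<and> rho2 P > 0 \<and> sigma1 P > 0 \<and> sigma2 P > 0 \<and>
     M1 P > 0 \<and> M2 P > 0 \<and> eta1 P > 0 \<and> eta2 P > 0"

definition affine_mix :: "real \<Rightarrow> real \<Rightarrow> real \<Rightarrow> real" where
  "affine_mix a b s = (b - a) / 2 * s + (a + b) / 2"

definition rho :: "params \<Rightarrow> real \<Rightarrow> real" where "rho P = affine_mix (rho1 P) (rho2 P)"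
definition sigma :: "params \<Rightarrow> real \<Rightarrow> real" where "sigma P = affine_mix (sigma1 P) (sigma2 P)"
definition Mob :: "params \<Rightarrow> real \<Rightarrow> real" where "Mob P = affine_mix (M1 P) (M2 P)"
definition eta :: "params \<Rightarrow> real \<Rightarrow> real" where "eta P = affine_mix (eta1 P) (eta2 P)"

definition rho' :: "params \<Rightarrow> real" where "rho' P = (rho2 P - rho1 P) / 2"

definition F_pot :: "real \<Rightarrow> real" where "F_pot s = (1/4) * (s\<^sup>2 - 1)\<^sup>2"
definition f_pot :: "real \<Rightarrow> real" where "f_pot = deriv F_pot"

text \<open>The unknowns, with the time variable first.\<close>

record 'v state =
  vel :: "real \<Rightarrow> 'v \<Rightarrow> 'v"
  pres :: "real \<Rightarrow> 'v \<Rightarrow> real"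
  mag :: "real \<Rightarrow> 'v \<Rightarrow> 'v"
  phase :: "real \<Rightarrow> 'v \<Rightarrow> real"
  chem :: "real \<Rightarrow> 'v \<Rightarrow> real"

definition smooth_state :: "(real^'d::finite) set \<Rightarrow> real \<Rightarrow> (real^'d) state \<Rightarrow> bool" where
  "smooth_state \<Omega> T U \<longleftrightarrow>
     (let S = Sigma (closure \<Omega>) (\<lambda>_. {0<..<T}) in
        C_on 2 S (\<lambda>(x, t). vel U t x) \<and> C_on 1 S (\<lambda>(x, t). pres U t x) \<and>
        C_on 2 S (\<lambda>(x, t). mag U t x) \<and> C_on 2 S (\<lambda>(x, t). phase U t x) \<and>
        C_on 2 S (\<lambda>(x, t). chem U t x))"

definition between_constants :: "params \<Rightarrow> (real^'d::finite) set \<Rightarrow> real \<Rightarrow> (real^'d) state \<Rightarrow> bool" where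
  "between_constants P \<Omega> T U \<longleftrightarrow>
     (\<forall>t\<in>{0<..<T}. \<forall>x\<in>\<Omega>. let s = phase U t x in
        rho P s \<in> closed_segment (rho1 P) (rho2 P) \<and>
        sigma P s \<in> closed_segment (sigma1 P) (sigma2 P) \<and>
        Mob P s \<in> closed_segment (M1 P) (M2 P) \<and>
        eta P s \<in> closed_segment (eta1 P) (eta2 P))"

definition CH_MHD_equations ::
  "(real^'d::finite, 'c::real_normed_vector) cross_ops \<Rightarrow> params \<Rightarrow> real^'d \<Rightarrow> real \<Rightarrow> (real^'d) state \<Rightarrow> bool" where
  "CH_MHD_equations ops P x t U \<longleftrightarrow>
     (let u = vel U; p = pres U; B = mag U; \<phi> = phase U; \<omega> = chem U in
        rho P (\<phi> t x) *\<^sub>R time_deriv u t x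
          + convect (rho P (\<phi> t x) *\<^sub>R u t x - (rho' P * Mob P (\<phi> t x)) *\<^sub>R grad (\<omega> t) x) (u t) x
          - tensor_divergence (\<lambda>y. (2 * eta P (\<phi> t y)) *\<^sub>R sym_grad (u t) y) x
          + grad (p t) x
          - (1 / mu P) *\<^sub>R cross' ops (curl ops (B t) x) (B t x)
          + \<phi> t x *\<^sub>R grad (\<omega> t) x = 0
      \<and> divergence (u t) x = 0
      \<and> time_deriv B t x
          + (1 / mu P) *\<^sub>R curl' ops (\<lambda>y. (1 / sigma P (\<phi> t y)) *\<^sub>R curl ops (B t) y) x
          - curl' ops (\<lambda>y. cross ops (u t y) (B t y)) x = 0
      \<and> divergence (B t) x = 0
      \<and> time_deriv \<phi> t x + divergence (\<lambda>y. \<phi> t y *\<^sub>R u t y) x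
          - divergence (\<lambda>y. Mob P (\<phi> t y) *\<^sub>R grad (\<omega> t) y) x = 0
      \<and> \<omega> t x = - gam P * eps P * laplacian (\<phi> t) x + gam P / eps P * f_pot (\<phi> t x))"

definition CH_MHD_boundary ::
  "(real^'d::finite, 'c::real_normed_vector) cross_ops \<Rightarrow> params \<Rightarrow> (real^'d) set \<Rightarrow> real \<Rightarrow> (real^'d) state \<Rightarrow> bool" where
  "CH_MHD_boundary ops P \<Omega> t U \<longleftrightarrow>
     (\<forall>x\<in>frontier \<Omega>. vel U t x = 0) \<and>
     (\<forall>x n. unit_outer_normal \<Omega> x n \<longrightarrow>
        cross ops (mag U t x) n = 0 \<and>
        normal_deriv \<Omega> n (phase U t) x = 0 \<and>
        Mob P (phase U t x) * normal_deriv \<Omega> n (chem U t) x = 0)"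

text \<open>The initial values are attained continuously in the interior.\<close>

definition CH_MHD_initial ::
  "(real^'d::finite) set \<Rightarrow> real \<Rightarrow> (real^'d \<Rightarrow> real^'d) \<Rightarrow> (real^'d \<Rightarrow> real^'d) \<Rightarrow> (real^'d \<Rightarrow> real)
     \<Rightarrow> (real^'d) state \<Rightarrow> bool" where
  "CH_MHD_initial \<Omega> T u0 B0 \<phi>0 U \<longleftrightarrow>
     (let S = Sigma \<Omega> (\<lambda>_. {0..<T}) in
        continuous_on S (\<lambda>(x, t). vel U t x) \<and> continuous_on S (\<lambda>(x, t). mag U t x) \<and>
        continuous_on S (\<lambda>(x, t). phase U t x)) \<and>
     (\<forall>x\<in>\<Omega>. vel U 0 x = u0 x \<and> mag U 0 x = B0 x \<and> phase U 0 x = \<phi>0 x)"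

definition CH_MHD_solution ::
  "(real^'d::finite, 'c::real_normed_vector) cross_ops \<Rightarrow> params \<Rightarrow> (real^'d) set \<Rightarrow> real
     \<Rightarrow> (real^'d \<Rightarrow> real^'d) \<Rightarrow> (real^'d \<Rightarrow> real^'d) \<Rightarrow> (real^'d \<Rightarrow> real) \<Rightarrow> (real^'d) state \<Rightarrow> bool" where
  "CH_MHD_solution ops P \<Omega> T u0 B0 \<phi>0 U \<longleftrightarrow>
     smooth_state \<Omega> T U \<and> between_constants P \<Omega> T U \<and>
     (\<forall>t\<in>{0<..<T}. (\<forall>x\<in>\<Omega>. CH_MHD_equations ops P x t U) \<and> CH_MHD_boundary ops P \<Omega> t U) \<and>
     CH_MHD_initial \<Omega> T u0 B0 \<phi>0 U"

definition energy :: "params \<Rightarrow> (real^'d::finite) set \<Rightarrow> (real^'d) state \<Rightarrow> real \<Rightarrow> real" where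
  "energy P \<Omega> U t =
     gam P * (LINT x:\<Omega>|lborel. eps P / 2 * (norm (grad (phase U t) x))\<^sup>2 + 1 / eps P * F_pot (phase U t x))
     + 1/2 * (LINT x:\<Omega>|lborel. rho P (phase U t x) * (norm (vel U t x))\<^sup>2)
     + 1/2 * (LINT x:\<Omega>|lborel. (norm (mag U t x))\<^sup>2 / mu P)"

definition dissipation ::
  "(real^'d::finite, 'c::real_normed_vector) cross_ops \<Rightarrow> params \<Rightarrow> (real^'d) set \<Rightarrow> (real^'d) state \<Rightarrow> real \<Rightarrow> real" where
  "dissipation ops P \<Omega> U t =
     (L2_norm \<Omega> (\<lambda>x. sqrt (Mob P (phase U t x)) *\<^sub>R grad (chem U t) x))\<^sup>2
     + 2 * (L2_norm \<Omega> (\<lambda>x. sqrt (eta P (phase U t x)) *\<^sub>R sym_grad (vel U t) x))\<^sup>2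
     + 1 / (mu P)\<^sup>2 * (L2_norm \<Omega> (\<lambda>x. (1 / sqrt (sigma P (phase U t x))) *\<^sub>R curl ops (mag U t) x))\<^sup>2"

end

theory Submission
  imports Defs
begin

text \<open>
  Multiply the momentum equation by \<open>u\<close>, the induction equation by \<open>B / mu\<close> and the phase equation
  by \<open>\<omega>\<close>. The sum says that the time derivative of the energy density is the divergence of a flux
  minus the density of the dissipation: the term \<open>rho' \<phi>\<^sub>t |u|\<^sup>2 / 2\<close> is cancelled by the divergence of
  the convecting field \<open>rho u - rho' M grad \<omega>\<close>, and the Lorentz force by the term
  \<open>curl (u \<times> B)\<close>. The boundary conditions make the normal component of the flux vanish wherever the
  boundary has a unique normal.

  The divergence theorem for such a flux \<open>G\<close> on a convex domain needs no surface measure. Test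
  \<open>div G\<close> with \<open>min e d / e\<close>, where \<open>d\<close> is the distance to the complement. In the layer \<open>d < e\<close>, whose
  volume is \<open>O(e)\<close>, the gradient of \<open>d\<close> at \<open>x\<close> is minus the outer normal at the nearest boundary
  point \<open>y\<close>. That normal is unique, so \<open>G y\<close> is orthogonal to it, and \<open>G x\<close> is nearly so by uniform
  continuity.
\<close>

section \<open>A divergence theorem on convex domains\<close>

text \<open>The domain is merely convex: edges and corners are allowed, and the boundary conditions
  with a normal say nothing there. The argument survives because such points are never nearest to an
  interior point. In the cut-off integral the factor 1/e from the gradient meets a layer of volume
  O(e), so only the oscillation of \<open>G\<close> at scale e remains. Integration by parts is done
  with difference quotients: the distance may have kinks, but being concave in \<Omega> it has a
  supergradient at every point.

  The second obstacle is regularity. The fields are C^2 up to the lateral boundary and the flux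
  contains their first derivatives, so it is C^1, as the divergence theorem requires, once all
  derivatives are read as derivatives within the closure of \<Omega> times (0,T). The equations hold
  in the open domain only, so the balance is pointwise there, and the boundary enters through the
  continuous extension of the flux. The interface energy needs one more fact: the time derivative
  and the gradient of the phase commute.\<close>

lemma integral_lborel_shift:
  fixes f :: "'a::euclidean_space \<Rightarrow> real"
  assumes [measurable]: "f \<in> borel_measurable borel"
  shows "(LINT x|lborel. f (x + c)) = (LINT x|lborel. f x)"
proof -
  have "(LINT x|lborel. f x) = (LINT x|distr lborel borel ((+) c). f x)"
    by (simp add: lborel_distr_plus)
  also have "\<dots> = (LINT x|lborel. f (c + x))"
    by (rule integral_distr) auto
  finally show ?thesis by (simp add: add.commute)
qed

lemma integrable_lborel_bounded_support:
  fixes f :: "'a::euclidean_space \<Rightarrow> real"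
  assumes "f \<in> borel_measurable borel" "bounded S" "\<And>x. \<bar>f x\<bar> \<le> K" "\<And>x. x \<notin> S \<Longrightarrow> f x = 0"
  shows "integrable lborel f"
proof -
  obtain a r where "S \<subseteq> cball a r" using assms(2) bounded_subset_cball by blast
  show ?thesis
    by (rule integrableI_bounded_set[where A="cball a r" and B=K])
       (use assms \<open>S \<subseteq> cball a r\<close> emeasure_lborel_cball_finite[of a r] in \<open>auto intro!: AE_I2 simp: subset_iff\<close>)
qed

text \<open>A point on the boundary nearest to an interior point has a unique outer normal, because a
  ball inside the domain touches the boundary there.\<close>

lemma nearest_frontier_point:
  fixes \<Omega> :: "'a::euclidean_space set"
  assumes "open \<Omega>" "bounded \<Omega>" "convex \<Omega>" "x \<in> \<Omega>"
  obtains y n where "y \<in> frontier \<Omega>" "dist x y = infdist x (- \<Omega>)" "norm n = 1"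
    "infdist x (- \<Omega>) = n \<bullet> (y - x)"
    "{m. norm m = 1 \<and> (\<forall>z\<in>\<Omega>. m \<bullet> (z - y) \<le> 0)} = {n}"
    "\<And>z. z \<in> \<Omega> \<Longrightarrow> infdist z (- \<Omega>) \<le> n \<bullet> (y - z)"
proof -
  have ne: "- \<Omega> \<noteq> {}"
    using assms(2) not_bounded_UNIV by (metis Compl_eq_Diff_UNIV Diff_eq_empty_iff bounded_subset)
  have cl: "closed (- \<Omega>)" using assms(1) by (simp add: open_closed)
  obtain y where y: "y \<in> - \<Omega>" "\<And>z. z \<in> - \<Omega> \<Longrightarrow> dist x y \<le> dist x z"
    using distance_attains_inf[OF cl ne, of x] by blast
  define d where "d = infdist x (- \<Omega>)"
  have d: "d = dist x y"
    unfolding d_def using y ne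
    by (intro antisym infdist_le) (auto simp: infdist_notempty intro!: cINF_greatest)
  have dpos: "d > 0"
    using y(1) assms(4) d by (metis ComplD dist_pos_lt)
  have ball: "ball x d \<subseteq> \<Omega>"
    using y(2) d by (fastforce simp: not_less[symmetric])
  have "y \<in> closure (ball x d)" using d dpos by simp
  then have ycl: "y \<in> closure \<Omega>" using closure_mono[OF ball] by blast
  then have yf: "y \<in> frontier \<Omega>"
    using y(1) assms(1) by (simp add: frontier_def interior_open)
  \<comment> \<open>The ball of radius d about x lies on the inner side of every supporting
    hyperplane at y, hence \<open>m \<bullet> (y - x)\<close> is at least d. As the norm of y - x is
    d, this is equality in Cauchy-Schwarz, which makes m parallel to y - x.\<close>
  have uniq: "m = (1/d) *\<^sub>R (y - x)" if m: "norm m = 1" "\<forall>z\<in>\<Omega>. m \<bullet> (z - y) \<le> 0" for m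
  proof -
    have "(x + e *\<^sub>R m) \<in> \<Omega>" if "0 < e" "e < d" for e
      using ball that m(1) by (auto simp: subset_iff dist_norm)
    then have upper: "m \<bullet> (x + e *\<^sub>R m - y) \<le> 0" if "0 < e" "e < d" for e
      using m(2) that by blast
    have le: "e \<le> m \<bullet> (y - x)" if "0 < e" "e < d" for e
    proof -
      have "m \<bullet> (x + e *\<^sub>R m - y) = e - m \<bullet> (y - x)"
        using m(1) by (simp add: inner_diff_right inner_add_right norm_eq_1)
      then show ?thesis using upper[OF that] by simp
    qed
    have "d \<le> m \<bullet> (y - x)"
      by (rule dense_le_bounded[OF dpos]) (rule le)
    moreover have "m \<bullet> (y - x) \<le> norm m * norm (y - x)" by (rule norm_cauchy_schwarz)
    ultimately have eq: "m \<bullet> (y - x) = norm m * norm (y - x)"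
      using m(1) d by (simp add: dist_norm norm_minus_commute)
    have "norm m *\<^sub>R (y - x) = norm (y - x) *\<^sub>R m"
      using eq by (simp add: norm_cauchy_schwarz_eq)
    then have "y - x = d *\<^sub>R m" using m(1) d by (simp add: dist_norm norm_minus_commute)
    then show ?thesis using dpos by simp
  qed
  \<comment> \<open>Existence of a supporting normal still has to be shown. The relative interior
    version of the hyperplane theorem gives strict inequality on the open set \<Omega>, which is
    needed for \<open>conc\<close>.\<close>
  have "y \<notin> rel_interior \<Omega>"
    using assms(1) y(1) by (simp add: rel_interior_open)
  then obtain a where a: "a \<noteq> 0" "\<And>z. z \<in> closure \<Omega> \<Longrightarrow> a \<bullet> y \<le> a \<bullet> z"
     "\<And>z. z \<in> rel_interior \<Omega> \<Longrightarrow> a \<bullet> y < a \<bullet> z"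
    using supporting_hyperplane_relative_frontier[OF assms(3) ycl] by metis
  define n where "n = - (1 / norm a) *\<^sub>R a"
  have n1: "norm n = 1" using a(1) by (simp add: n_def)
  have strict: "n \<bullet> (z - y) < 0" if "z \<in> \<Omega>" for z
    using a(3)[of z] a(1) that assms(1) by (simp add: n_def rel_interior_open inner_diff_right field_simps)
  have neq: "n = (1/d) *\<^sub>R (y - x)" using uniq[OF n1] strict by fastforce
  have dn: "d = n \<bullet> (y - x)"
  proof -
    have "y - x = d *\<^sub>R n" using neq dpos by simp
    then show ?thesis using n1 by (simp add: norm_eq_1)
  qed
  have set: "{m. norm m = 1 \<and> (\<forall>z\<in>\<Omega>. m \<bullet> (z - y) \<le> 0)} = {n}"
    using uniq neq n1 strict by (auto intro: less_imp_le)
  have conc: "infdist z (- \<Omega>) \<le> n \<bullet> (y - z)" if "z \<in> \<Omega>" for z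
  proof -
    \<comment> \<open>The orthogonal projection of z to the supporting hyperplane at y; by
      strictness it lies outside \<Omega>, so it competes in the distance from z to the
      complement.\<close>
    define w where "w = z + (n \<bullet> (y - z)) *\<^sub>R n"
    have "n \<bullet> (w - y) = 0"
      using n1 by (simp add: w_def inner_diff_right inner_add_right norm_eq_1)
    then have "w \<in> - \<Omega>" using strict by force
    then have "infdist z (- \<Omega>) \<le> dist z w" by (rule infdist_le)
    also have "\<dots> = \<bar>n \<bullet> (y - z)\<bar>" using n1 by (simp add: w_def dist_norm)
    also have "\<dots> = n \<bullet> (y - z)" using strict[OF that] by (simp add: inner_diff_right)
    finally show ?thesis .
  qed
  show ?thesis
    using that[of y n] yf d dn n1 set conc by (simp add: d_def)
qed

text \<open>Let \<Omega> contain a ball of radius r about a. Contracting \<Omega> towards a by the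
  factor 1 - s, with s = e / r, moves every point to distance at least e from the complement. The
  layer therefore misses a set of volume (1 - s)^n V, where n is the dimension and V the volume of
  \<Omega>, and Bernoulli's inequality bounds the rest by n s V.\<close>

lemma measure_boundary_layer_le:
  fixes \<Omega> :: "'a::euclidean_space set"
  assumes "open \<Omega>" "bounded \<Omega>" "convex \<Omega>" "\<Omega> \<noteq> {}"
  obtains C where "C \<ge> 0" "\<And>e. e > 0 \<Longrightarrow> measure lborel {x \<in> \<Omega>. infdist x (- \<Omega>) < e} \<le> C * e"
proof -
  obtain a r where r: "r > 0" "ball a r \<subseteq> \<Omega>"
    using assms by (metis ex_in_conv openE)
  have ne: "- \<Omega> \<noteq> {}"
    using assms(2) not_bounded_UNIV by (metis Compl_eq_Diff_UNIV Diff_eq_empty_iff bounded_subset)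
  define V where "V = measure lborel \<Omega>"
  have V0: "V \<ge> 0" by (simp add: V_def)
  have fin: "\<Omega> \<in> fmeasurable lborel"
    using assms emeasure_bounded_finite[OF assms(2)] by (intro fmeasurableI) auto
  have Vl: "V = measure lebesgue \<Omega>" using assms(1) by (simp add: V_def measure_completion)
  have "measure lborel {x \<in> \<Omega>. infdist x (- \<Omega>) < e} \<le> (V * DIM('a) / r) * e" if e: "e > 0" for e
  proof -
    let ?L = "{x \<in> \<Omega>. infdist x (- \<Omega>) < e}"
    have L: "?L \<in> sets borel"
    proof -
      have "?L = \<Omega> \<inter> {x. infdist x (- \<Omega>) < e}" by auto
      moreover have "open {x. infdist x (- \<Omega>) < e}"
        by (intro open_Collect_less continuous_intros)
      ultimately show ?thesis using assms(1) by (simp add: open_Int)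
    qed
    show ?thesis
    proof (cases "e < r")
      \<comment> \<open>For e at least r the claimed bound exceeds the volume of the whole
        domain.\<close>
      case False
      have "measure lborel ?L \<le> V"
        unfolding V_def by (rule measure_mono_fmeasurable) (use fin L in auto)
      also have "\<dots> \<le> V * (DIM('a) * (e / r))"
      proof -
        have "1 * 1 \<le> DIM('a) * (e / r)" using False r(1) DIM_positive[where 'a='a]
          by (intro mult_mono) (auto simp del: DIM_positive simp: Suc_le_eq)
        then show ?thesis using mult_left_mono[of 1 "DIM('a) * (e / r)" V] V0 by simp
      qed
      finally show ?thesis by simp
    next
      case True
      define s where "s = e / r"
      have s: "0 < s" "s < 1" using e r True by (auto simp: s_def)
      let ?T = "\<lambda>x. (1 - s) *\<^sub>R x + s *\<^sub>R a"
      have sub: "?T ` \<Omega> \<subseteq> \<Omega> - ?L"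
      proof clarify
        fix x assume x: "x \<in> \<Omega>"
        have bl: "ball (?T x) e \<subseteq> \<Omega>"
        proof
          fix z assume z: "z \<in> ball (?T x) e"
          \<comment> \<open>The solution of z = (1 - s) x + s b. It has distance less than e / s = r
            from a, so it lies in the inner ball and convexity puts z into \<Omega>.\<close>
          define b where "b = a + (1/s) *\<^sub>R (z - ?T x)"
          have "dist a b = dist (?T x) z / s" using s by (simp add: b_def dist_norm norm_minus_commute)
          also have "\<dots> < r" using z s e r by (simp add: s_def field_simps)
          finally have "dist a b < r" .
          then have "b \<in> \<Omega>" using r by auto
          have "z = (1 - s) *\<^sub>R x + s *\<^sub>R b" using s by (simp add: b_def algebra_simps)
          then show "z \<in> \<Omega>"
            using convexD[OF assms(3) x \<open>b \<in> \<Omega>\<close>, of "1-s" s] s by simp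
        qed
        have "e \<le> infdist (?T x) (- \<Omega>)"
        proof -
          obtain w where "w \<in> - \<Omega>" "infdist (?T x) (- \<Omega>) = dist (?T x) w"
            using infdist_attains_inf[of "- \<Omega>" "?T x"] assms(1) ne by (metis closed_Compl)
          then show ?thesis using bl by (auto simp: subset_iff not_less[symmetric])
        qed
        moreover have "?T x \<in> \<Omega>" using bl e by auto
        ultimately show "?T x \<in> \<Omega> - ?L" by auto
      qed
      have "(1 - s) ^ DIM('a) * V = measure lebesgue (?T ` \<Omega>)"
        using s by (subst measure_lebesgue_affine) (simp add: Vl)
      also have "\<dots> \<le> measure lebesgue (\<Omega> - ?L)"
      proof (rule measure_mono_fmeasurable[OF sub])
        have "open (?T ` \<Omega>)"
          using open_affinity[OF assms(1), of "1 - s" "s *\<^sub>R a"] s by (simp add: image_image add.commute)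
        then show "?T ` \<Omega> \<in> sets lebesgue" by (simp add: borel_open)
        show "\<Omega> - ?L \<in> fmeasurable lebesgue"
          using L assms by (intro fmeasurable_Diff lmeasurable_open) auto
      qed
      also have "\<dots> = measure lborel (\<Omega> - ?L)"
        using L assms(1) by (simp add: measure_completion)
      also have "\<dots> = V - measure lborel ?L"
        unfolding V_def using L fin by (intro measure_Diff) (auto simp: fmeasurable_def top.not_eq_extremum)
      finally have "measure lborel ?L \<le> V * (1 - (1 - s) ^ DIM('a))" by (simp add: algebra_simps)
      also have "\<dots> \<le> V * (DIM('a) * s)"
        using Bernoulli_inequality[of "- s" "DIM('a)"] s V0 by (intro mult_left_mono) auto
      finally show ?thesis by (simp add: s_def)
    qed
  qed
  moreover have "V * DIM('a) / r \<ge> 0" using V0 r by simp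
  ultimately show ?thesis using that by blast
qed

text \<open>Inside \<open>\<Omega>\<close> the distance to the complement is at most the distance to the supporting
  hyperplane at any boundary point, with equality at \<open>x\<close> for the hyperplane at the point nearest
  to \<open>x\<close>; hence \<open>- n\<close> is a supergradient.\<close>

lemma min_infdist_superdifferential:
  fixes \<Omega> :: "'a::euclidean_space set" and e :: real
  assumes "open \<Omega>" "bounded \<Omega>" "convex \<Omega>" "x \<in> \<Omega>"
    and bc: "\<And>y n. y \<in> frontier \<Omega> \<Longrightarrow>
      {m. norm m = 1 \<and> (\<forall>z\<in>\<Omega>. m \<bullet> (z - y) \<le> 0)} = {n} \<Longrightarrow> G y \<bullet> n = 0"
    and osc: "\<And>y. y \<in> frontier \<Omega> \<Longrightarrow> dist x y < e \<Longrightarrow> norm (G x - G y) \<le> w"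
  obtains N where "\<bar>G x \<bullet> N\<bar> \<le> (if infdist x (- \<Omega>) < e then w else 0)"
    "\<And>v. x + v \<in> \<Omega> \<Longrightarrow> min e (infdist (x + v) (- \<Omega>)) \<le> min e (infdist x (- \<Omega>)) - N \<bullet> v"
proof (cases "infdist x (- \<Omega>) < e")
  case False
  \<comment> \<open>Beyond the layer the truncated distance has its maximal value e, so 0 is a
    supergradient.\<close>
  show ?thesis by (rule that[of 0]) (use False in simp_all)
next
  case True
  obtain y n where yn: "y \<in> frontier \<Omega>" "dist x y = infdist x (- \<Omega>)" "norm n = 1"
    "infdist x (- \<Omega>) = n \<bullet> (y - x)"
    "{m. norm m = 1 \<and> (\<forall>z\<in>\<Omega>. m \<bullet> (z - y) \<le> 0)} = {n}"
    "\<And>z. z \<in> \<Omega> \<Longrightarrow> infdist z (- \<Omega>) \<le> n \<bullet> (y - z)"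
    by (rule nearest_frontier_point[OF assms(1-4)]) (rule that)
  have "\<bar>G x \<bullet> n\<bar> = \<bar>(G x - G y) \<bullet> n\<bar>" using bc[OF yn(1) yn(5)] by (simp add: inner_diff_left)
  also have "\<dots> \<le> norm (G x - G y) * norm n" by (rule Cauchy_Schwarz_ineq2)
  also have "\<dots> \<le> w" using osc[OF yn(1)] yn(2,3) True by simp
  finally have 1: "\<bar>G x \<bullet> n\<bar> \<le> w" .
  have 2: "min e (infdist (x + v) (- \<Omega>)) \<le> min e (infdist x (- \<Omega>)) - n \<bullet> v" if "x + v \<in> \<Omega>" for v
  proof -
    have "infdist (x + v) (- \<Omega>) \<le> n \<bullet> (y - x) - n \<bullet> v"
      using yn(6)[OF that] by (simp add: inner_diff_right inner_add_right)
    then show ?thesis using yn(4) True by simp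
  qed
  show ?thesis by (rule that[of n]) (use 1 2 True in simp_all)
qed

text \<open>A ball is connected, so it cannot meet both \<Omega> and the complement without meeting
  the frontier. This controls the points \<open>x + c *\<^sub>R b\<close> in difference quotients
  away from the boundary.\<close>

lemma frontier_nbhd_cases:
  fixes \<Omega> :: "'a::euclidean_space set"
  assumes "infdist x (frontier \<Omega>) > h"
  shows "cball x h \<subseteq> \<Omega> \<or> cball x h \<inter> \<Omega> = {}"
proof (rule ccontr)
  assume "\<not> ?thesis"
  then obtain y where "y \<in> cball x h \<inter> frontier \<Omega>"
    using connected_Int_frontier[of "cball x h" \<Omega>] convex_connected[OF convex_cball] by blast
  then have "infdist x (frontier \<Omega>) \<le> h" by (auto intro: infdist_le2)
  then show False using assms by simp
qed

text \<open>The neighbourhoods are compact and decrease to the frontier, which is a null set since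
  \<Omega> is convex; continuity of the measure from above gives the limit.\<close>

lemma measure_frontier_nbhd_tendsto:
  fixes \<Omega> :: "'a::euclidean_space set"
  assumes "bounded \<Omega>" "convex \<Omega>" "frontier \<Omega> \<noteq> {}"
  shows "(\<lambda>k. measure lborel {x. infdist x (frontier \<Omega>) \<le> inverse (real (Suc k))}) \<longlonglongrightarrow> 0"
    (is "(\<lambda>k. measure lborel (?Z k)) \<longlonglongrightarrow> 0")
proof -
  have cp: "compact (?Z k)" for k
    using compact_infdist_le[OF assms(3) compact_frontier_bounded[OF assms(1)]] by simp
  have Int: "(\<Inter>k. ?Z k) = frontier \<Omega>"
  proof (intro equalityI subsetI)
    fix x assume "x \<in> (\<Inter>k. ?Z k)"
    then have "infdist x (frontier \<Omega>) \<le> 0"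
      by (intro LIMSEQ_le_const[OF LIMSEQ_inverse_real_of_nat]) auto
    then show "x \<in> frontier \<Omega>"
      using assms(3) infdist_nonneg[of x "frontier \<Omega>"]
      by (metis antisym frontier_closed in_closed_iff_infdist_zero)
  qed auto
  have "(\<lambda>k. measure lborel (?Z k)) \<longlonglongrightarrow> measure lborel (\<Inter>k. ?Z k)"
  proof (rule Lim_measure_decseq)
    show "range ?Z \<subseteq> sets lborel" using cp by (auto intro!: borel_compact)
    show "decseq ?Z"
      unfolding decseq_def by (auto intro!: le_imp_inverse_le elim!: order_trans)
    show "emeasure lborel (?Z k) \<noteq> \<infinity>" for k
      using emeasure_compact_finite[OF cp[of k]] by (auto simp: top.not_eq_extremum)
  qed
  moreover have "measure lborel (frontier \<Omega>) = 0"
  proof -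
    have "measure lebesgue (frontier \<Omega>) = 0"
      by (rule negligible_imp_measure0[OF negligible_convex_frontier[OF assms(2)]])
    then show ?thesis by (simp add: measure_completion frontier_closed borel_closed)
  qed
  ultimately show ?thesis using Int by simp
qed

lemma has_real_derivative_along:
  fixes f :: "'a::real_normed_vector \<Rightarrow> real"
  assumes "(f has_derivative f') (at (x + s *\<^sub>R v))"
  shows "((\<lambda>r. f (x + r *\<^sub>R v)) has_real_derivative f' v) (at s within A)"
proof -
  have "((\<lambda>r. x + r *\<^sub>R v) has_derivative (\<lambda>r. r *\<^sub>R v)) (at s within A)"
    by (auto intro!: derivative_eq_intros)
  from has_derivative_compose[OF this assms]
  have "((\<lambda>r. f (x + r *\<^sub>R v)) has_derivative (\<lambda>r. f' (r *\<^sub>R v))) (at s within A)" .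
  moreover have "f' (r *\<^sub>R v) = f' v * r" for r
    using linear_scale[OF has_derivative_linear[OF assms], of r v] by (simp add: mult.commute)
  ultimately show ?thesis by (simp add: has_field_derivative_def)
qed

section \<open>The divergence theorem for fluxes without normal component\<close>

text \<open>The assumption \<open>bc\<close> is the condition on \<open>unit_outer_normal\<close>
  spelled out, so that the locale lives on an arbitrary Euclidean space; for the same reason the
  divergence appears as the trace of \<open>G' x\<close> over \<open>Basis\<close>.\<close>

locale convex_divergence =
  fixes \<Omega> :: "'a::euclidean_space set" and G :: "'a \<Rightarrow> 'a" and G' :: "'a \<Rightarrow> 'a \<Rightarrow> 'a"
  assumes open_dom: "open \<Omega>" and bounded_dom: "bounded \<Omega>" and convex_dom: "convex \<Omega>"
    and nonempty_dom: "\<Omega> \<noteq> {}"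
    and cont: "continuous_on (closure \<Omega>) G"
    and deriv: "\<And>x. x \<in> \<Omega> \<Longrightarrow> (G has_derivative G' x) (at x)"
    and cont_deriv: "\<And>v. continuous_on \<Omega> (\<lambda>x. G' x v)"
    and bounded_deriv: "\<And>v. bounded ((\<lambda>x. G' x v) ` \<Omega>)"
    and bc: "\<And>y n. y \<in> frontier \<Omega> \<Longrightarrow>
      {m. norm m = 1 \<and> (\<forall>z\<in>\<Omega>. m \<bullet> (z - y) \<le> 0)} = {n} \<Longrightarrow> G y \<bullet> n = 0"
begin

definition ddist :: "'a \<Rightarrow> real" where "ddist x = infdist x (- \<Omega>)"

text \<open>Extension by zero, so that translations act on integrals over the whole space. It may
  jump at the boundary; the factor that vanishes there makes up for this.\<close>

definition G0 :: "'a \<Rightarrow> 'a" where "G0 x = indicator \<Omega> x *\<^sub>R G x"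

lemma ddist_nonneg: "ddist x \<ge> 0" by (simp add: ddist_def infdist_nonneg)

lemma ddist_outside: "x \<notin> \<Omega> \<Longrightarrow> ddist x = 0" by (simp add: ddist_def)

lemma compl_nonempty: "- \<Omega> \<noteq> {}"
  using bounded_dom not_bounded_UNIV by (metis Compl_eq_Diff_UNIV Diff_eq_empty_iff bounded_subset)

lemma frontier_nonempty: "frontier \<Omega> \<noteq> {}"
  using bounded_dom nonempty_dom not_bounded_UNIV by (metis frontier_not_empty)

lemma ddist_pos: "x \<in> \<Omega> \<Longrightarrow> ddist x > 0"
  using open_dom compl_nonempty infdist_pos_not_in_closed[of "- \<Omega>" x]
  by (auto simp: ddist_def closed_Compl)

lemma ddist_lipschitz: "\<bar>ddist x - ddist y\<bar> \<le> dist x y"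
  by (simp add: ddist_def infdist_triangle_abs)

lemma ball_ddist: "dist x y < ddist x \<Longrightarrow> y \<in> \<Omega>"
  using infdist_le[of y "- \<Omega>" x] by (force simp: ddist_def)

lemma ddist_measurable [measurable]: "ddist \<in> borel_measurable borel"
  unfolding ddist_def by (intro borel_measurable_continuous_onI continuous_intros)

lemma dom_measurable [measurable]: "\<Omega> \<in> sets borel"
  using open_dom by simp

lemma G0_measurable [measurable]: "G0 \<in> borel_measurable borel"
  unfolding G0_def
  by (rule borel_measurable_continuous_on_indicator)
     (use open_dom continuous_on_subset[OF cont closure_subset] in auto)

lemma G_bounded: obtains K where "K \<ge> 0" "\<And>x. norm (G0 x) \<le> K"
proof -
  have "compact (G ` closure \<Omega>)" using cont bounded_dom by (intro compact_continuous_image) auto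
  then obtain K where K: "\<And>x. x \<in> closure \<Omega> \<Longrightarrow> norm (G x) \<le> K"
    using compact_imp_bounded bounded_iff by (metis imageI)
  have "norm (G0 x) \<le> max 0 K" for x
    using K[of x] closure_subset[of \<Omega>] by (auto simp: G0_def indicator_def)
  then show ?thesis using that[of "max 0 K"] by simp
qed

lemma deriv_measurable: "(\<lambda>x. indicator \<Omega> x * (G' x b \<bullet> b)) \<in> borel_measurable borel"
proof -
  have "continuous_on \<Omega> (\<lambda>x. G' x b \<bullet> b)" by (intro continuous_intros cont_deriv)
  then show ?thesis
    using borel_measurable_continuous_on_indicator[of \<Omega> "\<lambda>x. G' x b \<bullet> b"] open_dom by simp
qed

text \<open>Dominated convergence. If x has distance at most h from the complement, the jump of
  \<open>G0\<close> can make the quotient as large as 2 K / h, but there m is at most h. Farther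
  inside the whole segment lies in \<Omega>, and the mean value theorem bounds the quotient by the
  bound on the derivative, while m is at most e. The dominating constant \<open>?W\<close> adds the
  two bounds.\<close>

lemma difference_quotient_tendsto:
  assumes "e > 0" and b: "b \<in> Basis"
  defines "m \<equiv> \<lambda>x. min e (ddist x)" and "h \<equiv> \<lambda>k::nat. inverse (real (Suc k))"
  shows "(\<lambda>k. LINT x|lborel. (G0 (x + h k *\<^sub>R b) \<bullet> b - G0 x \<bullet> b) / h k * m x)
    \<longlonglongrightarrow> (LINT x:\<Omega>|lborel. G' x b \<bullet> b * m x)"
proof -
  obtain K where K: "K \<ge> 0" "\<And>x. norm (G0 x) \<le> K" using G_bounded by blast
  obtain L where L: "\<And>x. x \<in> \<Omega> \<Longrightarrow> norm (G' x b) \<le> L"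
    using bounded_deriv[of b] unfolding bounded_iff by auto
  have h: "h k > 0" for k by (simp add: h_def)
  have h0: "h \<longlonglongrightarrow> 0" unfolding h_def by (rule LIMSEQ_inverse_real_of_nat)
  have b1: "norm b = 1" using b by simp
  let ?s = "\<lambda>k x. (G0 (x + h k *\<^sub>R b) \<bullet> b - G0 x \<bullet> b) / h k * m x"
  let ?W = "2 * K + \<bar>L\<bar> * e"
  have m: "0 \<le> m x" "m x \<le> e" "m x \<le> ddist x" for x
    using assms(1) ddist_nonneg by (auto simp: m_def)
  have [measurable]: "m \<in> borel_measurable borel" unfolding m_def by measurable
  have deriv_inner: "((\<lambda>x. G x \<bullet> b) has_derivative (\<lambda>v. G' x v \<bullet> b)) (at x)" if "x \<in> \<Omega>" for x
    using deriv[OF that] by (auto intro!: derivative_eq_intros)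
  have lim: "(\<lambda>k. ?s k x) \<longlonglongrightarrow> indicator \<Omega> x *\<^sub>R (G' x b \<bullet> b * m x)" for x
  proof (cases "x \<in> \<Omega>")
    case True
    have "((\<lambda>s. G (x + s *\<^sub>R b) \<bullet> b) has_real_derivative G' x b \<bullet> b) (at 0)"
      using deriv_inner[OF True] by (intro has_real_derivative_along) simp
    then have "((\<lambda>s. (G (x + s *\<^sub>R b) \<bullet> b - G x \<bullet> b) / s) \<longlongrightarrow> G' x b \<bullet> b) (at 0)"
      by (simp add: DERIV_def)
    then have "(\<lambda>k. (G (x + h k *\<^sub>R b) \<bullet> b - G x \<bullet> b) / h k) \<longlonglongrightarrow> G' x b \<bullet> b"
      by (rule filterlim_compose) (use h h0 in \<open>auto simp: filterlim_at intro!: always_eventually dest: less_imp_neq[THEN not_sym]\<close>)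
    moreover have "\<forall>\<^sub>F k in sequentially. (G (x + h k *\<^sub>R b) \<bullet> b - G x \<bullet> b) / h k =
       (G0 (x + h k *\<^sub>R b) \<bullet> b - G0 x \<bullet> b) / h k"
      using order_tendstoD(2)[OF h0 ddist_pos[OF True]]
    proof eventually_elim
      case (elim k)
      have "x + h k *\<^sub>R b \<in> \<Omega>"
        by (rule ball_ddist[of x]) (use elim b1 h[of k] in \<open>simp add: dist_norm\<close>)
      then show ?case using True by (simp add: G0_def)
    qed
    ultimately have "(\<lambda>k. (G0 (x + h k *\<^sub>R b) \<bullet> b - G0 x \<bullet> b) / h k) \<longlonglongrightarrow> G' x b \<bullet> b"
      by (rule Lim_transform_eventually)
    then have "(\<lambda>k. ?s k x) \<longlonglongrightarrow> G' x b \<bullet> b * m x" by (intro tendsto_mult tendsto_const)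
    then show ?thesis using True by simp
  next
    case False
    then show ?thesis using assms(1) by (simp add: m_def ddist_outside)
  qed
  have bd: "norm (?s k x) \<le> indicator \<Omega> x * ?W" for k x
  proof (cases "x \<in> \<Omega>")
    case False
    then show ?thesis using assms(1) by (simp add: m_def ddist_outside)
  next
    case True
    have "\<bar>G0 (x + h k *\<^sub>R b) \<bullet> b - G0 x \<bullet> b\<bar> / h k * m x \<le> ?W"
    proof (cases "ddist x \<le> h k")
      case True
      have "\<bar>G0 (x + h k *\<^sub>R b) \<bullet> b - G0 x \<bullet> b\<bar> \<le> 2 * K"
        using K(2)[of "x + h k *\<^sub>R b"] K(2)[of x] Basis_le_norm[OF b, of "G0 x"]
          Basis_le_norm[OF b, of "G0 (x + h k *\<^sub>R b)"] by linarith
      then have "\<bar>G0 (x + h k *\<^sub>R b) \<bullet> b - G0 x \<bullet> b\<bar> / h k * m x \<le> 2 * K / h k * h k"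
        using m[of x] True h[of k] K(1) by (intro mult_mono divide_right_mono) auto
      then have "\<bar>G0 (x + h k *\<^sub>R b) \<bullet> b - G0 x \<bullet> b\<bar> / h k * m x \<le> 2 * K"
        using h[of k] by simp
      then show ?thesis using assms(1) by (smt (verit) mult_nonneg_nonneg)
    next
      case False
      have seg: "x + s *\<^sub>R b \<in> \<Omega>" if "0 \<le> s" "s \<le> h k" for s
        by (rule ball_ddist[of x]) (use False that b1 in \<open>simp add: dist_norm\<close>)
      obtain s where s: "0 < s" "s < h k"
        "G (x + h k *\<^sub>R b) \<bullet> b - G (x + 0 *\<^sub>R b) \<bullet> b = (h k - 0) * (G' (x + s *\<^sub>R b) b \<bullet> b)"
        using MVT2[OF h[of k], of "\<lambda>s. G (x + s *\<^sub>R b) \<bullet> b" "\<lambda>s. G' (x + s *\<^sub>R b) b \<bullet> b"]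
          has_real_derivative_along[OF deriv_inner[OF seg]] by auto
      then have "G0 (x + h k *\<^sub>R b) \<bullet> b - G0 x \<bullet> b = h k * (G' (x + s *\<^sub>R b) b \<bullet> b)"
        using seg[of "h k"] h[of k] True by (simp add: G0_def less_imp_le)
      then have "\<bar>G0 (x + h k *\<^sub>R b) \<bullet> b - G0 x \<bullet> b\<bar> / h k = \<bar>G' (x + s *\<^sub>R b) b \<bullet> b\<bar>"
        using h[of k] by (simp add: abs_mult)
      also have "\<dots> \<le> \<bar>L\<bar>"
        using Basis_le_norm[OF b, of "G' (x + s *\<^sub>R b) b"] L[OF seg[of s]] s(1,2) by auto
      finally have "\<bar>G0 (x + h k *\<^sub>R b) \<bullet> b - G0 x \<bullet> b\<bar> / h k * m x \<le> \<bar>L\<bar> * e"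
        using m[of x] by (intro mult_mono) auto
      then show ?thesis using K(1) by simp
    qed
    then show ?thesis using True h[of k] m(1)[of x] by (simp add: abs_mult)
  qed
  have meas: "(\<lambda>x. indicator \<Omega> x *\<^sub>R (G' x b \<bullet> b * m x)) \<in> borel_measurable lborel"
  proof -
    have "(\<lambda>x. (indicator \<Omega> x * (G' x b \<bullet> b)) * m x) \<in> borel_measurable borel"
      by (intro borel_measurable_times deriv_measurable) auto
    then show ?thesis by (simp add: mult.assoc)
  qed
  have "(\<lambda>k. LINT x|lborel. ?s k x) \<longlonglongrightarrow> (LINT x|lborel. indicator \<Omega> x *\<^sub>R (G' x b \<bullet> b * m x))"
  proof (rule integral_dominated_convergence[where w="\<lambda>x. indicator \<Omega> x * ?W"])
    show "integrable lborel (\<lambda>x. indicator \<Omega> x * ?W)"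
      using emeasure_bounded_finite[OF bounded_dom] by (intro integrable_mult_left integrable_real_indicator) auto
  qed (use lim bd meas in auto)
  then show ?thesis by (simp add: set_lebesgue_integral_def)
qed

text \<open>With \<open>m\<close> the truncated distance, the forward difference quotients of \<open>m\<close> lie below those
  in the backward direction, with \<open>- N\<close> in between. The integral over the whole space of
  backward minus forward quotient is 0, so both converge to \<open>- N\<close> in mean, and no almost everywhere
  differentiability of \<open>m\<close> is needed. The set \<open>Z k\<close> collects the points where the segment
  of length \<open>h k\<close> may cross the boundary.\<close>

lemma layer_integral_bound:
  assumes e: "e > 0" and w: "w \<ge> 0"
    and osc: "\<And>x y. x \<in> \<Omega> \<Longrightarrow> y \<in> frontier \<Omega> \<Longrightarrow> dist x y < e \<Longrightarrow> norm (G x - G y) \<le> w"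
  shows "\<bar>LINT x:\<Omega>|lborel. (\<Sum>b\<in>Basis. G' x b \<bullet> b) * min e (ddist x)\<bar>
    \<le> w * measure lborel {x \<in> \<Omega>. ddist x < e}"
proof -
  define m where "m = (\<lambda>x. min e (ddist x))"
  define h where "h = (\<lambda>k::nat. inverse (real (Suc k)))"
  define Z where "Z = (\<lambda>k. {x. infdist x (frontier \<Omega>) \<le> h k})"
  obtain K where K: "K \<ge> 0" "\<And>x. norm (G0 x) \<le> K" using G_bounded by blast
  have h: "h k > 0" for k by (simp add: h_def)
  have h1: "h k \<le> 1" for k by (simp add: h_def field_simps)
  have m: "0 \<le> m x" "m x \<le> e" "m x \<le> ddist x" for x
    using e ddist_nonneg by (auto simp: m_def)
  have m_out: "m x = 0" if "x \<notin> \<Omega>" for x using that e by (simp add: m_def ddist_outside)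
  have m_lip: "\<bar>m x - m y\<bar> \<le> dist x y" for x y
    using ddist_lipschitz[of x y] by (simp add: m_def min_def) linarith
  have [measurable]: "m \<in> borel_measurable borel" unfolding m_def by measurable
  have [measurable]: "Z k \<in> sets borel" for k
    unfolding Z_def by (intro borel_closed closed_Collect_le continuous_intros)
  have Zcompact: "compact (Z k)" for k
    unfolding Z_def using compact_infdist_le[OF frontier_nonempty compact_frontier_bounded[OF bounded_dom] h] .
  have Zfin: "emeasure lborel (Z k) < \<infinity>" for k
    by (rule emeasure_compact_finite[OF Zcompact])
  have Z0: "(\<lambda>k. measure lborel (Z k)) \<longlonglongrightarrow> 0"
    unfolding Z_def h_def by (rule measure_frontier_nbhd_tendsto[OF bounded_dom convex_dom frontier_nonempty])
  obtain a r where ar: "\<Omega> \<subseteq> cball a r" using bounded_dom bounded_subset_cball by blast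
  have int_m: "integrable lborel (\<lambda>x. m (x + c))" if "norm c \<le> 1" for c
  proof (rule integrable_lborel_bounded_support[where S="cball a (r + 1)" and K=e])
    fix x assume x: "x \<notin> cball a (r + 1)"
    have "dist a x \<le> dist a (x + c) + dist (x + c) x" by (rule dist_triangle)
    then have "dist a (x + c) > r" using x that by (simp add: dist_norm)
    then have "x + c \<notin> \<Omega>" using ar by auto
    then show "m (x + c) = 0" by (rule m_out)
  qed (use m in auto)
  let ?L = "{x \<in> \<Omega>. ddist x < e}"
  have L: "?L \<in> sets borel" by measurable
  have Lfin: "emeasure lborel ?L < \<infinity>"
    using emeasure_bounded_finite[of ?L] bounded_subset[OF bounded_dom, of ?L] by auto
  define I where "I = (\<lambda>k b. LINT x|lborel. (G0 (x + h k *\<^sub>R b) \<bullet> b - G0 x \<bullet> b) / h k * m x)"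
  have I_lim: "(\<lambda>k. \<Sum>b\<in>Basis. I k b) \<longlonglongrightarrow> (\<Sum>b\<in>Basis. LINT x:\<Omega>|lborel. G' x b \<bullet> b * m x)"
    unfolding I_def m_def h_def by (intro tendsto_sum difference_quotient_tendsto e)
  have int_Gm: "integrable lborel (\<lambda>x. G0 (x + c) \<bullet> b * m (x + c'))" if "b \<in> Basis" "norm c' \<le> 1" for b c c'
  proof (rule Bochner_Integration.integrable_bound[OF integrable_mult_right[OF int_m[OF that(2)], of K]])
    show "AE x in lborel. norm (G0 (x + c) \<bullet> b * m (x + c')) \<le> norm (K * m (x + c'))"
      using K m(1) Basis_le_norm[OF that(1)]
      by (intro AE_I2) (auto simp: abs_mult intro!: mult_right_mono intro: order_trans)
  qed auto
  \<comment> \<open>Discrete integration by parts: translating by \<open>h k *\<^sub>R b\<close>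
    moves the difference quotient from \<open>G0\<close> to m and turns a forward step into a
    backward one.\<close>
  have I_shift: "I k b = (LINT x|lborel. G0 x \<bullet> b * ((m (x - h k *\<^sub>R b) - m x) / h k))" if b: "b \<in> Basis" for k b
  proof -
    have hb: "norm (h k *\<^sub>R b) \<le> 1" using h[of k] h1[of k] b by simp
    have 1: "integrable lborel (\<lambda>x. G0 (x + h k *\<^sub>R b) \<bullet> b * m x)" using int_Gm[OF b, of 0 "h k *\<^sub>R b"] by simp
    have 2: "integrable lborel (\<lambda>x. G0 x \<bullet> b * m x)" using int_Gm[OF b, of 0 0] by simp
    have 3: "integrable lborel (\<lambda>x. G0 x \<bullet> b * m (x - h k *\<^sub>R b))"
      using int_Gm[OF b, of "- h k *\<^sub>R b" 0] hb by simp
    have "I k b = (LINT x|lborel. (G0 (x + h k *\<^sub>R b) \<bullet> b * m x - G0 x \<bullet> b * m x) / h k)"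
      unfolding I_def by (simp add: field_simps)
    also have "\<dots> = ((LINT x|lborel. G0 (x + h k *\<^sub>R b) \<bullet> b * m x) - (LINT x|lborel. G0 x \<bullet> b * m x)) / h k"
      using 1 2 by simp
    also have "(LINT x|lborel. G0 (x + h k *\<^sub>R b) \<bullet> b * m x) = (LINT x|lborel. G0 x \<bullet> b * m (x - h k *\<^sub>R b))"
      using integral_lborel_shift[of "\<lambda>x. G0 x \<bullet> b * m (x - h k *\<^sub>R b)" "h k *\<^sub>R b"] by simp
    also have "(\<dots> - (LINT x|lborel. G0 x \<bullet> b * m x)) / h k
        = (LINT x|lborel. (G0 x \<bullet> b * m (x - h k *\<^sub>R b) - G0 x \<bullet> b * m x) / h k)"
      using 2 3 by simp
    finally show ?thesis by (simp add: field_simps)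
  qed
  have int_I: "integrable lborel (\<lambda>x. G0 x \<bullet> b * ((m (x - h k *\<^sub>R b) - m x) / h k))" if b: "b \<in> Basis" for k b
  proof -
    have hb: "norm (h k *\<^sub>R b) \<le> 1" using h[of k] h1[of k] b by simp
    have "integrable lborel (\<lambda>x. (G0 x \<bullet> b * m (x - h k *\<^sub>R b) - G0 x \<bullet> b * m x) / h k)"
      using int_Gm[OF b, of "- h k *\<^sub>R b" 0] int_Gm[OF b, of 0 0] hb by simp
    then show ?thesis by (simp add: field_simps)
  qed
  \<comment> \<open>The second differences of m, divided once by h: backward minus forward quotient.
    Translation invariance makes the integral vanish, so an error bounded by
    \<open>K * S k x\<close> costs nothing after integration.\<close>
  define S where "S = (\<lambda>k x. \<Sum>b\<in>Basis. (2 * m x - m (x - h k *\<^sub>R b) - m (x + h k *\<^sub>R b)) / h k)"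
  have S_int: "integrable lborel (S k)" "(LINT x|lborel. S k x) = 0" for k
  proof -
    have i: "integrable lborel (\<lambda>x. m (x - h k *\<^sub>R b))" "integrable lborel (\<lambda>x. m (x + h k *\<^sub>R b))"
       "integrable lborel m" if "b \<in> Basis" for b
      using int_m[of "- h k *\<^sub>R b"] int_m[of "h k *\<^sub>R b"] int_m[of 0] h[of k] h1[of k] that by auto
    show "integrable lborel (S k)" unfolding S_def using i by (intro Bochner_Integration.integrable_sum) auto
    have z: "(LINT x|lborel. (2 * m x - m (x - h k *\<^sub>R b) - m (x + h k *\<^sub>R b)) / h k) = 0" if "b \<in> Basis" for b
      using i[OF that] integral_lborel_shift[of m "- h k *\<^sub>R b"] integral_lborel_shift[of m "h k *\<^sub>R b"] by simp
    have "(LINT x|lborel. S k x)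
        = (\<Sum>b\<in>Basis. LINT x|lborel. (2 * m x - m (x - h k *\<^sub>R b) - m (x + h k *\<^sub>R b)) / h k)"
      unfolding S_def using i by (intro Bochner_Integration.integral_sum) auto
    also have "\<dots> = 0" by (intro sum.neutral ballI z)
    finally show "(LINT x|lborel. S k x) = 0" .
  qed
  define D where "D = real (DIM('a))"
  \<comment> \<open>The constant 3 on \<open>Z k\<close>: as m is 1-Lipschitz, the sum to be bounded
    is at most D K there, while \<open>K * S k x\<close> can be as low as -2 D K and has to be
    compensated.\<close>
  define R where "R = (\<lambda>k x. w * indicator ?L x + K * S k x + 3 * D * K * indicator (Z k) x)"
  have pointwise: "\<bar>\<Sum>b\<in>Basis. G0 x \<bullet> b * ((m (x - h k *\<^sub>R b) - m x) / h k)\<bar> \<le> R k x" for k x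
  proof -
    have step: "\<bar>m (x + c *\<^sub>R b) - m x\<bar> \<le> h k" if "b \<in> Basis" "\<bar>c\<bar> = h k" for b c
      using m_lip[of "x + c *\<^sub>R b" x] that by (simp add: dist_norm)
    consider "x \<in> Z k" | "x \<notin> Z k" "x \<notin> \<Omega>" | "x \<notin> Z k" "x \<in> \<Omega>" by blast
    then show ?thesis
    proof cases
      case 1
      have "\<bar>\<Sum>b\<in>Basis. G0 x \<bullet> b * ((m (x - h k *\<^sub>R b) - m x) / h k)\<bar> \<le> (\<Sum>b\<in>(Basis::'a set). K * 1)"
      proof (intro order_trans[OF sum_abs] sum_mono)
        fix b :: 'a assume b: "b \<in> Basis"
        have "\<bar>G0 x \<bullet> b\<bar> \<le> K" using Basis_le_norm[OF b] K(2) order_trans by blast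
        moreover have "\<bar>(m (x - h k *\<^sub>R b) - m x) / h k\<bar> \<le> 1"
          using step[OF b, of "- h k"] h[of k] by (simp add: field_simps)
        ultimately show "\<bar>G0 x \<bullet> b * ((m (x - h k *\<^sub>R b) - m x) / h k)\<bar> \<le> K * 1"
          unfolding abs_mult using K(1) by (intro mult_mono) auto
      qed
      moreover have "S k x \<ge> (\<Sum>b\<in>(Basis::'a set). - 2)"
        unfolding S_def
      proof (rule sum_mono)
        fix b :: 'a assume b: "b \<in> Basis"
        show "- 2 \<le> (2 * m x - m (x - h k *\<^sub>R b) - m (x + h k *\<^sub>R b)) / h k"
          using step[OF b, of "- h k"] step[OF b, of "h k"] h[of k] by (simp add: field_simps)
      qed
      then have "K * S k x \<ge> K * (- 2 * D)" using K(1) by (intro mult_left_mono) (auto simp: D_def)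
      moreover have "w * indicator ?L x \<ge> 0" using w by simp
      ultimately show ?thesis using 1 by (simp add: R_def D_def algebra_simps)
    next
      case 2
      have out: "x + c *\<^sub>R b \<notin> \<Omega>" if "b \<in> Basis" "\<bar>c\<bar> = h k" for b c
      proof -
        have "x \<in> cball x (h k)" "x + c *\<^sub>R b \<in> cball x (h k)"
          using h[of k] that by (simp_all add: dist_norm)
        then show ?thesis
          using frontier_nbhd_cases[of "h k" x \<Omega>] 2 unfolding Z_def by fastforce
      qed
      have "m (x - h k *\<^sub>R b) = 0" "m (x + h k *\<^sub>R b) = 0" if "b \<in> Basis" for b
        using out[OF that, of "- h k"] out[OF that, of "h k"] h[of k] by (auto intro: m_out)
      then show ?thesis using 2 m_out[of x] by (simp add: R_def S_def G0_def)
    next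
      case 3
      have cb: "cball x (h k) \<subseteq> \<Omega>"
      proof -
        have "x \<in> cball x (h k)" using h[of k] by simp
        then show ?thesis
          using frontier_nbhd_cases[of "h k" x \<Omega>] 3 unfolding Z_def by fastforce
      qed
      have inn: "x + c *\<^sub>R b \<in> \<Omega>" if "b \<in> Basis" "\<bar>c\<bar> = h k" for b c
        using cb that by (auto simp: dist_norm)
      obtain N where N0: "\<bar>G x \<bullet> N\<bar> \<le> (if infdist x (- \<Omega>) < e then w else 0)"
        "\<And>v. x + v \<in> \<Omega> \<Longrightarrow> min e (infdist (x + v) (- \<Omega>)) \<le> min e (infdist x (- \<Omega>)) - N \<bullet> v"
        by (rule min_infdist_superdifferential[where G=G and e=e and w=w,
              OF open_dom bounded_dom convex_dom 3(2) bc osc[OF 3(2)]]) (assumption+, rule that)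
      have N: "\<bar>G x \<bullet> N\<bar> \<le> (if ddist x < e then w else 0)"
        "\<And>v. x + v \<in> \<Omega> \<Longrightarrow> m (x + v) \<le> m x - N \<bullet> v"
        using N0 by (simp_all only: m_def ddist_def)
      let ?q = "\<lambda>b. (m (x - h k *\<^sub>R b) - m x) / h k"
      \<comment> \<open>The supergradient inequality for the step \<open>- h k *\<^sub>R b\<close>
        gives \<open>?q b \<le> N \<bullet> b\<close>, and the one for the step
        \<open>h k *\<^sub>R b\<close> bounds \<open>N \<bullet> b\<close> above by (m x - m (x + h
        b)) / h. The gap between these two bounds is the second difference.\<close>
      have q: "\<bar>?q b - N \<bullet> b\<bar> \<le> (2 * m x - m (x - h k *\<^sub>R b) - m (x + h k *\<^sub>R b)) / h k" if b: "b \<in> Basis" for b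
      proof -
        have "m (x + (- h k) *\<^sub>R b) \<le> m x - N \<bullet> ((- h k) *\<^sub>R b)" "m (x + h k *\<^sub>R b) \<le> m x - N \<bullet> (h k *\<^sub>R b)"
          using N(2)[OF inn[OF b, of "- h k"]] N(2)[OF inn[OF b, of "h k"]] h[of k] by simp_all
        then have "\<bar>m (x - h k *\<^sub>R b) - m x - h k * (N \<bullet> b)\<bar> \<le> 2 * m x - m (x - h k *\<^sub>R b) - m (x + h k *\<^sub>R b)"
          by (simp add: abs_le_iff)
        moreover have "?q b - N \<bullet> b = (m (x - h k *\<^sub>R b) - m x - h k * (N \<bullet> b)) / h k"
          using h[of k] by (simp add: field_simps)
        ultimately show ?thesis using h[of k] by (simp add: abs_divide divide_right_mono)
      qed
      \<comment> \<open>Replacing each quotient by \<open>N \<bullet> b\<close> leaves the product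
        of \<open>G x\<close> with N, which is at most w in the layer and 0 beyond it.\<close>
      have "(\<Sum>b\<in>Basis. G0 x \<bullet> b * ?q b) = (\<Sum>b\<in>Basis. G0 x \<bullet> b * (?q b - N \<bullet> b)) + G x \<bullet> N"
        using 3 by (subst euclidean_inner[of "G x" N]) (simp add: G0_def sum.distrib[symmetric] algebra_simps)
      also have "\<bar>\<dots>\<bar> \<le> \<bar>\<Sum>b\<in>Basis. G0 x \<bullet> b * (?q b - N \<bullet> b)\<bar> + \<bar>G x \<bullet> N\<bar>" by (rule abs_triangle_ineq)
      also have "\<bar>\<Sum>b\<in>Basis. G0 x \<bullet> b * (?q b - N \<bullet> b)\<bar> \<le> K * S k x"
        unfolding S_def sum_distrib_left
      proof (intro order_trans[OF sum_abs] sum_mono)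
        fix b :: 'a assume b: "b \<in> Basis"
        have "\<bar>G0 x \<bullet> b\<bar> \<le> K" using Basis_le_norm[OF b] K(2) order_trans by blast
        then show "\<bar>G0 x \<bullet> b * (?q b - N \<bullet> b)\<bar> \<le> K * ((2 * m x - m (x - h k *\<^sub>R b) - m (x + h k *\<^sub>R b)) / h k)"
          unfolding abs_mult using q[OF b] K(1) by (intro mult_mono) auto
      qed
      also have "\<bar>G x \<bullet> N\<bar> \<le> w * indicator ?L x" using N(1) 3 by (auto split: if_splits)
      finally show ?thesis using 3 by (simp add: R_def)
    qed
  qed
  have bound: "\<bar>\<Sum>b\<in>Basis. I k b\<bar> \<le> w * measure lborel ?L + 3 * D * K * measure lborel (Z k)" for k
  proof -
    have "(\<Sum>b\<in>Basis. I k b) = (LINT x|lborel. (\<Sum>b\<in>Basis. G0 x \<bullet> b * ((m (x - h k *\<^sub>R b) - m x) / h k)))"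
      using I_shift int_I by (subst Bochner_Integration.integral_sum) auto
    also have "\<bar>\<dots>\<bar> \<le> (LINT x|lborel. \<bar>\<Sum>b\<in>Basis. G0 x \<bullet> b * ((m (x - h k *\<^sub>R b) - m x) / h k)\<bar>)"
      by (rule Bochner_Integration.integral_abs_bound)
    also have "\<dots> \<le> (LINT x|lborel. R k x)"
    proof (rule Bochner_Integration.integral_mono)
      show "integrable lborel (\<lambda>x. \<bar>\<Sum>b\<in>Basis. G0 x \<bullet> b * ((m (x - h k *\<^sub>R b) - m x) / h k)\<bar>)"
        using int_I by (intro Bochner_Integration.integrable_abs Bochner_Integration.integrable_sum) auto
      show "integrable lborel (R k)"
        unfolding R_def using L Lfin Zfin[of k] S_int(1)[of k] by auto
    qed (rule pointwise)
    also have "\<dots> = w * measure lborel ?L + 3 * D * K * measure lborel (Z k)"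
      unfolding R_def using L Lfin Zfin[of k] S_int[of k] by simp
    finally show ?thesis .
  qed
  have "\<bar>\<Sum>b\<in>Basis. LINT x:\<Omega>|lborel. G' x b \<bullet> b * m x\<bar> \<le> w * measure lborel ?L + 3 * D * K * 0"
    by (rule LIMSEQ_le[OF tendsto_rabs[OF I_lim] tendsto_add[OF tendsto_const tendsto_mult[OF tendsto_const Z0]]])
       (use bound in auto)
  moreover have "(\<Sum>b\<in>Basis. LINT x:\<Omega>|lborel. G' x b \<bullet> b * m x) = (LINT x:\<Omega>|lborel. (\<Sum>b\<in>Basis. G' x b \<bullet> b) * m x)"
  proof -
    have "integrable lborel (\<lambda>x. indicator \<Omega> x *\<^sub>R (G' x b \<bullet> b * m x))" if b: "b \<in> Basis" for b
    proof -
      obtain L where L: "\<And>x. x \<in> \<Omega> \<Longrightarrow> norm (G' x b) \<le> L"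
        using bounded_deriv[of b] unfolding bounded_iff by auto
      show ?thesis
      proof (rule integrable_lborel_bounded_support[where S=\<Omega> and K="\<bar>L\<bar> * e"])
        have "(\<lambda>x. (indicator \<Omega> x * (G' x b \<bullet> b)) * m x) \<in> borel_measurable borel"
          by (intro borel_measurable_times deriv_measurable) auto
        then show "(\<lambda>x. indicator \<Omega> x *\<^sub>R (G' x b \<bullet> b * m x)) \<in> borel_measurable borel" by (simp add: mult.assoc)
        show "\<bar>indicator \<Omega> x *\<^sub>R (G' x b \<bullet> b * m x)\<bar> \<le> \<bar>L\<bar> * e" for x
        proof (cases "x \<in> \<Omega>")
          case True
          have "\<bar>G' x b \<bullet> b\<bar> \<le> \<bar>L\<bar>" using Basis_le_norm[OF b, of "G' x b"] L[OF True] by linarith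
          then show ?thesis using True m[of x] by (auto simp: abs_mult intro!: mult_mono)
        qed (use e in auto)
      qed (use bounded_dom in auto)
    qed
    then show ?thesis
      unfolding set_lebesgue_integral_def
      by (subst Bochner_Integration.integral_sum[symmetric]) (auto simp: sum_distrib_right sum_distrib_left intro!: Bochner_Integration.integral_cong)
  qed
  ultimately show ?thesis by (simp add: m_def)
qed

text \<open>Once \<open>G\<close> oscillates by at most w at scale e, the cut-off integral is at
  most w (C e) / e = w C, uniformly in e. The cut-off integrals tend to the full one, and w is
  arbitrary.\<close>

theorem integral_divergence_eq_0: "(LINT x:\<Omega>|lborel. (\<Sum>b\<in>Basis. G' x b \<bullet> b)) = 0"
proof -
  obtain C where C: "C \<ge> 0" "\<And>e. e > 0 \<Longrightarrow> measure lborel {x \<in> \<Omega>. ddist x < e} \<le> C * e"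
    by (rule measure_boundary_layer_le[OF open_dom bounded_dom convex_dom nonempty_dom, folded ddist_def]) (rule that)
  define g where "g = (\<lambda>x. \<Sum>b\<in>Basis. G' x b \<bullet> b)"
  \<comment> \<open>The weight is min e d / e for e = 1 / (k + 1), written without a
    quotient.\<close>
  define J where "J = (\<lambda>k. LINT x:\<Omega>|lborel. g x * min 1 (ddist x * real (Suc k)))"
  have gm: "(\<lambda>x. indicator \<Omega> x * g x) \<in> borel_measurable borel"
    unfolding g_def sum_distrib_left by (intro borel_measurable_sum deriv_measurable)
  have "bounded ((\<lambda>x. G' x b \<bullet> b) ` \<Omega>)" for b
  proof -
    obtain L where L: "\<And>x. x \<in> \<Omega> \<Longrightarrow> norm (G' x b) \<le> L"
      using bounded_deriv[of b] unfolding bounded_iff by auto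
    have "norm (G' x b \<bullet> b) \<le> L * norm b" if "x \<in> \<Omega>" for x
      using Cauchy_Schwarz_ineq2[of "G' x b" b] mult_right_mono[OF L[OF that], of "norm b"] by simp
    then show ?thesis unfolding bounded_iff by blast
  qed
  then obtain L where "\<And>b x. x \<in> \<Omega> \<Longrightarrow> \<bar>G' x b \<bullet> b\<bar> \<le> L b"
    unfolding bounded_iff by (simp add: ball_simps) metis
  then have gb: "\<bar>g x\<bar> \<le> (\<Sum>b\<in>Basis. L b)" if "x \<in> \<Omega>" for x
    unfolding g_def using that by (intro order_trans[OF sum_abs] sum_mono) auto
  have J_lim: "J \<longlonglongrightarrow> (LINT x:\<Omega>|lborel. g x)"
    unfolding J_def set_lebesgue_integral_def
  proof (rule integral_dominated_convergence[where w="\<lambda>x. indicator \<Omega> x * (\<Sum>b\<in>Basis. L b)"])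
    show "integrable lborel (\<lambda>x. indicator \<Omega> x * (\<Sum>b\<in>Basis. L b))"
      using emeasure_bounded_finite[OF bounded_dom] by (intro integrable_mult_left integrable_real_indicator) auto
    show "(\<lambda>x. indicator \<Omega> x *\<^sub>R g x) \<in> borel_measurable lborel" using gm by simp
    show "(\<lambda>x. indicator \<Omega> x *\<^sub>R (g x * min 1 (ddist x * real (Suc k)))) \<in> borel_measurable lborel" for k
    proof -
      have "(\<lambda>x. (indicator \<Omega> x * g x) * min 1 (ddist x * real (Suc k))) \<in> borel_measurable borel"
        by (intro borel_measurable_times gm) measurable
      then show ?thesis by (simp add: mult.assoc)
    qed
    show "AE x in lborel. (\<lambda>k. indicator \<Omega> x *\<^sub>R (g x * min 1 (ddist x * real (Suc k)))) \<longlonglongrightarrow> indicator \<Omega> x *\<^sub>R g x"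
    proof (intro AE_I2)
      fix x
      show "(\<lambda>k. indicator \<Omega> x *\<^sub>R (g x * min 1 (ddist x * real (Suc k)))) \<longlonglongrightarrow> indicator \<Omega> x *\<^sub>R g x"
      proof (cases "x \<in> \<Omega>")
        case True
        obtain k0 where k0: "1 / ddist x < real k0" using reals_Archimedean2 by blast
        have "min 1 (ddist x * real (Suc k)) = 1" if "k \<ge> k0" for k
        proof -
          have "1 / ddist x \<le> real (Suc k)" using k0 that by simp
          then show ?thesis using ddist_pos[OF True] by (simp add: field_simps)
        qed
        then have "\<forall>\<^sub>F k in sequentially. indicator \<Omega> x *\<^sub>R (g x * min 1 (ddist x * real (Suc k))) = indicator \<Omega> x *\<^sub>R g x"
          by (intro eventually_sequentiallyI[of k0]) simp
        then show ?thesis by (rule tendsto_eventually)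
      qed simp
    qed
    show "AE x in lborel. norm (indicator \<Omega> x *\<^sub>R (g x * min 1 (ddist x * real (Suc k)))) \<le> indicator \<Omega> x * (\<Sum>b\<in>Basis. L b)" for k
    proof (intro AE_I2)
      fix x
      have "\<bar>g x\<bar> * min 1 (ddist x * real (Suc k)) \<le> \<bar>g x\<bar>"
        by (intro mult_left_le) auto
      then show "norm (indicator \<Omega> x *\<^sub>R (g x * min 1 (ddist x * real (Suc k)))) \<le> indicator \<Omega> x * (\<Sum>b\<in>Basis. L b)"
        using gb[of x] ddist_nonneg[of x] by (auto simp: abs_mult indicator_def)
    qed
  qed
  have small: "\<bar>LINT x:\<Omega>|lborel. g x\<bar> \<le> w * C" if w: "w > 0" for w
  proof -
    have "uniformly_continuous_on (closure \<Omega>) G"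
      using cont bounded_dom by (intro compact_uniformly_continuous) auto
    then obtain d where d: "d > 0" "\<And>x y. x \<in> closure \<Omega> \<Longrightarrow> y \<in> closure \<Omega> \<Longrightarrow> dist y x < d \<Longrightarrow> dist (G y) (G x) < w"
      unfolding uniformly_continuous_on_def using w by metis
    have "\<forall>\<^sub>F k in sequentially. inverse (real (Suc k)) < d"
      using order_tendstoD(2)[OF LIMSEQ_inverse_real_of_nat d(1)] .
    then have "\<forall>\<^sub>F k in sequentially. \<bar>J k\<bar> \<le> w * C"
    proof eventually_elim
      case (elim k)
      define e where "e = inverse (real (Suc k))"
      have e: "e > 0" "e < d" using elim by (auto simp: e_def)
      have osc: "norm (G x - G y) \<le> w" if "x \<in> \<Omega>" "y \<in> frontier \<Omega>" "dist x y < e" for x y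
        using d(2)[of y x] that e closure_subset[of \<Omega>] by (auto simp: frontier_def dist_norm)
      have "J k = (LINT x:\<Omega>|lborel. g x * min e (ddist x)) * real (Suc k)"
      proof -
        have "min 1 (ddist x * real (Suc k)) = min e (ddist x) * real (Suc k)" for x
          by (simp add: e_def min_mult_distrib_right del: of_nat_Suc)
        then show ?thesis unfolding J_def by (simp add: mult.assoc[symmetric] del: of_nat_Suc)
      qed
      also have "\<bar>\<dots>\<bar> \<le> (w * measure lborel {x \<in> \<Omega>. ddist x < e}) * real (Suc k)"
        using layer_integral_bound[OF e(1) less_imp_le[OF w] osc]
        by (simp add: abs_mult g_def mult_right_mono del: of_nat_Suc)
      also have "\<dots> \<le> (w * (C * e)) * real (Suc k)"
        using C(2)[OF e(1)] w by (intro mult_right_mono mult_left_mono) auto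
      also have "\<dots> = w * C" by (simp add: e_def del: of_nat_Suc)
      finally show ?case .
    qed
    then show ?thesis by (intro tendsto_upperbound[OF tendsto_rabs[OF J_lim]]) auto
  qed
  have "\<bar>LINT x:\<Omega>|lborel. g x\<bar> \<le> 0"
  proof (rule field_le_epsilon)
    fix d :: real assume "d > 0"
    \<comment> \<open>The constant C may be 0, hence the divisor C + 1.\<close>
    have "d / (C + 1) * C \<le> d" using C(1) \<open>d > 0\<close> by (simp add: field_simps)
    then show "\<bar>LINT x:\<Omega>|lborel. g x\<bar> \<le> 0 + d"
      using small[of "d / (C + 1)"] C(1) \<open>d > 0\<close> by (simp add: add_nonneg_pos)
  qed
  then show ?thesis by (simp add: g_def)
qed

end

section \<open>Continuously differentiable functions up to the boundary\<close>

text \<open>The sets on which a derivative within the set is unique, boundary points included. Both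
  the closure of \<Omega> and its product with the time interval are of this kind.\<close>

definition fat_convex :: "'a::euclidean_space set \<Rightarrow> bool" where
  "fat_convex S \<longleftrightarrow> convex S \<and> interior S \<noteq> {}"

text \<open>The segment from x to any y in S stays in S, so both derivatives agree on y - x. As S
  contains a ball, the differences of such vectors include a small multiple of every vector, and
  linearity does the rest.\<close>

lemma fat_convex_derivative_unique:
  fixes f :: "'a::euclidean_space \<Rightarrow> 'b::real_normed_vector"
  assumes "fat_convex S" "x \<in> S"
    and "(f has_derivative f1) (at x within S)" "(f has_derivative f2) (at x within S)"
  shows "f1 = f2"
proof -
  have conv: "convex S" and int: "interior S \<noteq> {}" using assms(1) by (auto simp: fat_convex_def)
  interpret f1: bounded_linear f1 using assms(3) by (rule has_derivative_bounded_linear)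
  interpret f2: bounded_linear f2 using assms(4) by (rule has_derivative_bounded_linear)
  have eq: "f1 (y - x) = f2 (y - x)" if y: "y \<in> S" for y
  proof -
    let ?g = "\<lambda>s. x + s *\<^sub>R (y - x)"
    have sub: "?g ` {0..1} \<subseteq> S"
    proof clarify
      fix s :: real assume "s \<in> {0..1}"
      then have "(1 - s) *\<^sub>R x + s *\<^sub>R y \<in> S" using convexD_alt[OF conv assms(2) y] by simp
      then show "?g s \<in> S" by (simp add: algebra_simps)
    qed
    have g: "(?g has_derivative (\<lambda>s. s *\<^sub>R (y - x))) (at 0 within {0..1})"
      by (auto intro!: derivative_eq_intros)
    have "((f \<circ> ?g) has_derivative (f' \<circ> (\<lambda>s. s *\<^sub>R (y - x)))) (at 0 within {0..1})"
      if "(f has_derivative f') (at x within S)" for f'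
      by (rule diff_chain_within[OF g]) (use that sub in \<open>auto intro: has_derivative_subset\<close>)
    from this[OF assms(3)] this[OF assms(4)]
    have "(f1 \<circ> (\<lambda>s. s *\<^sub>R (y - x))) = (f2 \<circ> (\<lambda>s. s *\<^sub>R (y - x)))"
      using frechet_derivative_unique_within_closed_interval[of 0 "1::real" 0 "f \<circ> ?g"] by (auto simp: cbox_interval)
    then show ?thesis by (metis (no_types, lifting) comp_apply scaleR_one)
  qed
  obtain z where "z \<in> interior S" using int by blast
  then obtain r where r: "r > 0" "cball z r \<subseteq> S"
    using mem_interior_cball by blast
  show ?thesis
  proof
    fix v
    show "f1 v = f2 v"
    proof (cases "v = 0")
      case False
      define c where "c = r / norm v"
      have c: "c > 0" using r False by (simp add: c_def)
      have "z + c *\<^sub>R v \<in> S" "z \<in> S"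
        using r False by (auto simp: subset_iff dist_norm c_def)
      have "f1 (c *\<^sub>R v) = f2 (c *\<^sub>R v)"
      proof -
        have "f1 (z + c *\<^sub>R v - x) - f1 (z - x) = f2 (z + c *\<^sub>R v - x) - f2 (z - x)"
          using eq[OF \<open>z + c *\<^sub>R v \<in> S\<close>] eq[OF \<open>z \<in> S\<close>] by simp
        then show ?thesis by (simp add: f1.diff[symmetric] f2.diff[symmetric])
      qed
      then show ?thesis using c by (simp add: f1.scaleR f2.scaleR)
    qed (simp add: f1.zero f2.zero)
  qed
qed

lemma fat_convex_frechet:
  fixes f :: "'a::euclidean_space \<Rightarrow> 'b::real_normed_vector"
  assumes "fat_convex S" "x \<in> S" "(f has_derivative f') (at x within S)"
  shows "frechet_derivative f (at x within S) = f'"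
  using fat_convex_derivative_unique[OF assms(1,2)] assms(3) frechet_derivative_works
  by (metis differentiableI)

lemma fat_convex_closure:
  fixes \<Omega> :: "'a::euclidean_space set"
  assumes "open \<Omega>" "convex \<Omega>" "\<Omega> \<noteq> {}"
  shows "fat_convex (closure \<Omega>)"
  using assms interior_mono[OF closure_subset[of \<Omega>]]
  by (auto simp: fat_convex_def convex_closure interior_open)

text \<open>The derivatives in \<open>C_on\<close> are existential witnesses. By uniqueness they
  coincide on S with \<open>frechet_derivative\<close>, so derivatives of fields become functions
  that can be named and differentiated again.\<close>

lemma C_on_Suc_frechet:
  fixes f :: "'a::euclidean_space \<Rightarrow> 'b::real_normed_vector"
  assumes "fat_convex S" "C_on (Suc k) S f"
  shows "\<And>z. z \<in> S \<Longrightarrow> (f has_derivative frechet_derivative f (at z within S)) (at z within S)"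
    and "\<And>v. C_on k S (\<lambda>z. frechet_derivative f (at z within S) v)"
proof -
  obtain f' where f': "\<And>z. z \<in> S \<Longrightarrow> (f has_derivative f' z) (at z within S)"
     "\<And>v. C_on k S (\<lambda>z. f' z v)"
    using assms(2) by auto
  show 1: "(f has_derivative frechet_derivative f (at z within S)) (at z within S)" if "z \<in> S" for z
    using f'(1)[OF that] frechet_derivative_works differentiableI by blast
  have "frechet_derivative f (at z within S) v = f' z v" if "z \<in> S" for z v
    using fat_convex_frechet[OF assms(1) that f'(1)[OF that]] by simp
  moreover have cong: "C_on k S g" if "C_on k S h" "\<And>z. z \<in> S \<Longrightarrow> g z = h z" for g h :: "'a \<Rightarrow> 'b"
  proof (cases k)
    case 0
    then show ?thesis using that by (simp cong: continuous_on_cong)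
  next
    case (Suc j)
    then show ?thesis using that by (auto intro: has_derivative_transform)
  qed
  ultimately show "C_on k S (\<lambda>z. frechet_derivative f (at z within S) v)" for v
    by (intro cong[OF f'(2)[of v]])
qed

lemma C_on_1_I:
  assumes "\<And>z. z \<in> S \<Longrightarrow> (f has_derivative f' z) (at z within S)" "\<And>v. continuous_on S (\<lambda>z. f' z v)"
  shows "C_on 1 S f"
  using assms by auto

lemma C_on_1_E:
  assumes "C_on 1 S f"
  obtains f' where "\<And>z. z \<in> S \<Longrightarrow> (f has_derivative f' z) (at z within S)" "\<And>v. continuous_on S (\<lambda>z. f' z v)"
  using assms by auto

lemma C_on_continuous_on: "C_on k S f \<Longrightarrow> continuous_on S f"
  by (cases k) (auto intro: has_derivative_continuous_on)

lemma C_on_2_imp_1: 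
  assumes "C_on 2 S f" shows "C_on 1 S f"
proof -
  obtain f' where f': "\<And>z. z \<in> S \<Longrightarrow> (f has_derivative f' z) (at z within S)" "\<And>v. C_on 1 S (\<lambda>z. f' z v)"
    using assms by (auto simp: numeral_2_eq_2)
  show ?thesis
    by (rule C_on_1_I[OF f'(1) C_on_continuous_on[OF f'(2)]])
qed

section \<open>Closure rules for C^1 functions\<close>

named_theorems C1_intros

lemma C_on_1_const [C1_intros]: "C_on 1 S (\<lambda>z. c)"
  by (rule C_on_1_I[where f'="\<lambda>z v. 0"]) auto

lemma C_on_1_bilinear:
  assumes "bounded_bilinear b" "C_on 1 S f" "C_on 1 S g"
  shows "C_on 1 S (\<lambda>z. b (f z) (g z))"
proof -
  obtain f' where f': "\<And>z. z \<in> S \<Longrightarrow> (f has_derivative f' z) (at z within S)" "\<And>v. continuous_on S (\<lambda>z. f' z v)"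
    by (rule C_on_1_E[OF assms(2)]) (rule that)
  obtain g' where g': "\<And>z. z \<in> S \<Longrightarrow> (g has_derivative g' z) (at z within S)" "\<And>v. continuous_on S (\<lambda>z. g' z v)"
    by (rule C_on_1_E[OF assms(3)]) (rule that)
  show ?thesis
  proof (rule C_on_1_I)
    show "((\<lambda>z. b (f z) (g z)) has_derivative (\<lambda>v. b (f z) (g' z v) + b (f' z v) (g z))) (at z within S)" if "z \<in> S" for z
      by (rule bounded_bilinear.FDERIV[OF assms(1) f'(1)[OF that] g'(1)[OF that]])
    show "continuous_on S (\<lambda>z. b (f z) (g' z v) + b (f' z v) (g z))" for v
      using assms(2,3) by (intro continuous_on_add bounded_bilinear.continuous_on[OF assms(1)] f'(2) g'(2) C_on_continuous_on)
  qed
qed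

lemma C_on_1_linear:
  assumes "bounded_linear L" "C_on 1 S f"
  shows "C_on 1 S (\<lambda>z. L (f z))"
proof -
  obtain f' where f': "\<And>z. z \<in> S \<Longrightarrow> (f has_derivative f' z) (at z within S)" "\<And>v. continuous_on S (\<lambda>z. f' z v)"
    by (rule C_on_1_E[OF assms(2)]) (rule that)
  show ?thesis
    by (rule C_on_1_I[OF bounded_linear.has_derivative[OF assms(1) f'(1)]])
       (auto intro: bounded_linear.continuous_on[OF assms(1) f'(2)])
qed

lemma C_on_1_add [C1_intros]:
  assumes "C_on 1 S f" "C_on 1 S g"
  shows "C_on 1 S (\<lambda>z. f z + g z)"
proof -
  obtain f' where f': "\<And>z. z \<in> S \<Longrightarrow> (f has_derivative f' z) (at z within S)" "\<And>v. continuous_on S (\<lambda>z. f' z v)"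
    by (rule C_on_1_E[OF assms(1)]) (rule that)
  obtain g' where g': "\<And>z. z \<in> S \<Longrightarrow> (g has_derivative g' z) (at z within S)" "\<And>v. continuous_on S (\<lambda>z. g' z v)"
    by (rule C_on_1_E[OF assms(2)]) (rule that)
  show ?thesis
    by (rule C_on_1_I[OF has_derivative_add[OF f'(1) g'(1)]]) (auto intro: continuous_on_add f' g')
qed

lemmas C_on_1_mult [C1_intros] = C_on_1_bilinear[OF bounded_bilinear_mult]
lemmas C_on_1_scaleR [C1_intros] = C_on_1_bilinear[OF bounded_bilinear_scaleR]
lemmas C_on_1_inner [C1_intros] = C_on_1_bilinear[OF bounded_bilinear_inner]
lemmas C_on_1_minus [C1_intros] = C_on_1_linear[OF bounded_linear_minus[OF bounded_linear_ident]]
lemmas C_on_1_nth [C1_intros] = C_on_1_linear[OF bounded_linear_vec_nth]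

lemma C_on_1_diff [C1_intros]: "C_on 1 S f \<Longrightarrow> C_on 1 S g \<Longrightarrow> C_on 1 S (\<lambda>z. f z - g z)"
  using C_on_1_add[OF _ C_on_1_minus, of S f g] by simp

lemma C_on_1_sum [C1_intros]:
  "(\<And>i. i \<in> A \<Longrightarrow> C_on 1 S (f i)) \<Longrightarrow> C_on 1 S (\<lambda>z. \<Sum>i\<in>A. f i z)"
  by (induction A rule: infinite_finite_induct) (auto intro: C_on_1_add C_on_1_const simp del: One_nat_def)

lemma C_on_1_vec [C1_intros]:
  fixes f :: "'a::euclidean_space \<Rightarrow> 'i::finite \<Rightarrow> 'b::real_normed_vector"
  assumes "\<And>i. C_on 1 S (\<lambda>z. f z i)"
  shows "C_on 1 S (\<lambda>z. \<chi> i. f z i)"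
proof -
  have "\<exists>f'. (\<forall>z\<in>S. ((\<lambda>z. f z i) has_derivative f' z) (at z within S)) \<and> (\<forall>v. continuous_on S (\<lambda>z. f' z v))" for i
    using assms[of i] by simp
  then obtain f' where f': "\<And>i z. z \<in> S \<Longrightarrow> ((\<lambda>z. f z i) has_derivative f' i z) (at z within S)"
     "\<And>i v. continuous_on S (\<lambda>z. f' i z v)"
    by metis
  show ?thesis
  proof (rule C_on_1_I)
    show "((\<lambda>z. \<chi> i. f z i) has_derivative (\<lambda>v. \<chi> i. f' i z v)) (at z within S)" if "z \<in> S" for z
      unfolding has_derivative_within
    proof
      show "bounded_linear (\<lambda>v. \<chi> i. f' i z v)"
        unfolding linear_conv_bounded_linear[symmetric]
        using has_derivative_linear[OF f'(1)[OF that]]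
        by (intro linearI) (auto simp: vec_eq_iff linear_add linear_scale)
      have "((\<lambda>y. \<chi> i. (1 / norm (y - z)) *\<^sub>R (f y i - (f z i + f' i z (y - z)))) \<longlongrightarrow> (\<chi> i. 0)) (at z within S)"
        by (intro tendsto_vec_lambda) (use f'(1)[OF that] in \<open>simp add: has_derivative_within\<close>)
      then show "((\<lambda>y. (1 / norm (y - z)) *\<^sub>R ((\<chi> i. f y i) - ((\<chi> i. f z i) + (\<chi> i. f' i z (y - z))))) \<longlongrightarrow> 0) (at z within S)"
        by (simp add: vec_eq_iff zero_vec_def plus_vec_def minus_vec_def scaleR_vec_def)
    qed
    show "continuous_on S (\<lambda>z. \<chi> i. f' i z v)" for v by (intro continuous_on_vec_lambda f'(2))
  qed
qed

lemma C_on_1_inverse [C1_intros]: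
  fixes f :: "'a::real_normed_vector \<Rightarrow> real"
  assumes "C_on 1 S f" "\<And>z. z \<in> S \<Longrightarrow> f z \<noteq> 0"
  shows "C_on 1 S (\<lambda>z. inverse (f z))"
proof -
  obtain f' where f': "\<And>z. z \<in> S \<Longrightarrow> (f has_derivative f' z) (at z within S)" "\<And>v. continuous_on S (\<lambda>z. f' z v)"
    by (rule C_on_1_E[OF assms(1)]) (rule that)
  show ?thesis
    by (rule C_on_1_I[OF Deriv.has_derivative_inverse[OF assms(2) f'(1)]])
       (use assms C_on_continuous_on[OF assms(1)] f'(2) in \<open>auto intro!: continuous_intros\<close>)
qed

lemma C_on_1_slice:
  assumes "C_on 1 (A \<times> I) f" "t \<in> I"
  shows "C_on 1 A (\<lambda>x. f (x, t))"
proof -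
  obtain f' where f': "\<And>z. z \<in> A \<times> I \<Longrightarrow> (f has_derivative f' z) (at z within A \<times> I)" "\<And>v. continuous_on (A \<times> I) (\<lambda>z. f' z v)"
    by (rule C_on_1_E[OF assms(1)]) (rule that)
  have p: "((\<lambda>x. (x, t)) has_derivative (\<lambda>v. (v, 0))) (at x within A)" for x
    by (auto intro!: derivative_eq_intros)
  show ?thesis
  proof (rule C_on_1_I)
    show "((\<lambda>x. f (x, t)) has_derivative (\<lambda>v. f' (x, t) (v, 0))) (at x within A)" if "x \<in> A" for x
      using has_derivative_in_compose[OF p has_derivative_subset[OF f'(1)]] that assms(2) by auto
    show "continuous_on A (\<lambda>x. f' (x, t) (v, 0))" for v
      by (rule continuous_on_compose2[OF f'(2)]) (use assms(2) in \<open>auto intro!: continuous_intros\<close>)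
  qed
qed

section \<open>Symmetry of second derivatives and differentiation under the integral\<close>

lemma mixed_partials_symmetric:
  fixes f :: "'a::euclidean_space \<Rightarrow> real"
  assumes "open W" "z \<in> W"
    and f: "\<And>y. y \<in> W \<Longrightarrow> (f has_derivative f' y) (at y)"
    and fv: "\<And>y v. y \<in> W \<Longrightarrow> ((\<lambda>y. f' y v) has_derivative f'' v y) (at y)"
    and cont: "\<And>v w. continuous_on W (\<lambda>y. f'' v y w)"
  shows "f'' v z w = f'' w z v"
proof -
  text \<open>Two applications of the mean value theorem to the second difference of \<open>f\<close>.\<close>
  have key: "\<exists>a b. 0 < a \<and> a < s \<and> 0 < b \<and> b < s \<and>
     f (z + s *\<^sub>R v + s *\<^sub>R w) - f (z + s *\<^sub>R v) - f (z + s *\<^sub>R w) + f z = s * s * f'' v (z + a *\<^sub>R v + b *\<^sub>R w) w"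
    if s: "s > 0" "\<And>a b. 0 \<le> a \<Longrightarrow> a \<le> s \<Longrightarrow> 0 \<le> b \<Longrightarrow> b \<le> s \<Longrightarrow> z + a *\<^sub>R v + b *\<^sub>R w \<in> W" for v w s
  proof -
    let ?g = "\<lambda>a. f (z + s *\<^sub>R w + a *\<^sub>R v) - f (z + a *\<^sub>R v)"
    have "(?g has_real_derivative (f' (z + s *\<^sub>R w + a *\<^sub>R v) v - f' (z + a *\<^sub>R v) v)) (at a)" if "0 \<le> a" "a \<le> s" for a
      using s(2)[of a s] s(2)[of a 0] s(1) that
      by (intro DERIV_diff has_real_derivative_along f) (auto simp: algebra_simps)
    from MVT2[OF s(1) this] obtain a where a: "0 < a" "a < s"
      "?g s - ?g 0 = s * (f' (z + s *\<^sub>R w + a *\<^sub>R v) v - f' (z + a *\<^sub>R v) v)" by auto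
    have "((\<lambda>b. f' (z + a *\<^sub>R v + b *\<^sub>R w) v) has_real_derivative f'' v (z + a *\<^sub>R v + b *\<^sub>R w) w) (at b)" if "0 \<le> b" "b \<le> s" for b
      using s(2)[of a b] a that by (intro has_real_derivative_along fv) auto
    from MVT2[OF s(1) this] obtain b where b: "0 < b" "b < s"
      "f' (z + a *\<^sub>R v + s *\<^sub>R w) v - f' (z + a *\<^sub>R v) v = s * f'' v (z + a *\<^sub>R v + b *\<^sub>R w) w" by auto
    have "f (z + s *\<^sub>R v + s *\<^sub>R w) - f (z + s *\<^sub>R v) - f (z + s *\<^sub>R w) + f z = ?g s - ?g 0"
      by (simp add: algebra_simps)
    also have "\<dots> = s * (f' (z + a *\<^sub>R v + s *\<^sub>R w) v - f' (z + a *\<^sub>R v) v)"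
      using a(3) by (simp add: add.assoc add.commute add.left_commute)
    finally show ?thesis using a b by (intro exI[of _ a] exI[of _ b]) simp
  qed
  obtain r where r: "r > 0" "ball z r \<subseteq> W" using assms(1,2) openE by blast
  have inW: "z + a *\<^sub>R v + b *\<^sub>R w \<in> ball z e" "z + b *\<^sub>R w + a *\<^sub>R v \<in> ball z e"
    if "0 \<le> a" "a \<le> s" "0 \<le> b" "b \<le> s" "s * (norm v + norm w) < e" for a b s e
  proof -
    have "norm (a *\<^sub>R v + b *\<^sub>R w) \<le> a * norm v + b * norm w"
      using norm_triangle_ineq[of "a *\<^sub>R v" "b *\<^sub>R w"] that by simp
    also have "\<dots> \<le> s * norm v + s * norm w" using that by (intro add_mono mult_right_mono) auto
    finally have "norm (a *\<^sub>R v + b *\<^sub>R w) < e" using that by (simp add: algebra_simps)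
    moreover have "z - (z + a *\<^sub>R v + b *\<^sub>R w) = - (a *\<^sub>R v + b *\<^sub>R w)" "z - (z + b *\<^sub>R w + a *\<^sub>R v) = - (a *\<^sub>R v + b *\<^sub>R w)"
      by simp_all
    ultimately show "z + a *\<^sub>R v + b *\<^sub>R w \<in> ball z e" "z + b *\<^sub>R w + a *\<^sub>R v \<in> ball z e"
      by (simp_all only: mem_ball dist_norm norm_minus_cancel)
  qed
  have close: "\<bar>f'' v z w - f'' w z v\<bar> \<le> e" if e: "e > 0" for e
  proof -
    have c1: "isCont (\<lambda>y. f'' v y w) z" and c2: "isCont (\<lambda>y. f'' w y v) z"
      using cont assms(1,2) by (auto simp: continuous_on_eq_continuous_at)
    obtain d1 where d1: "d1 > 0" "\<And>y. dist y z < d1 \<Longrightarrow> \<bar>f'' v y w - f'' v z w\<bar> < e / 2"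
      using c1 e unfolding continuous_at_eps_delta by (metis dist_real_def half_gt_zero)
    obtain d2 where d2: "d2 > 0" "\<And>y. dist y z < d2 \<Longrightarrow> \<bar>f'' w y v - f'' w z v\<bar> < e / 2"
      using c2 e unfolding continuous_at_eps_delta by (metis dist_real_def half_gt_zero)
    define m where "m = min r (min d1 d2)"
    have m: "m > 0" "m \<le> r" "m \<le> d1" "m \<le> d2" using r d1 d2 by (auto simp: m_def)
    \<comment> \<open>Small enough for the parallelogram spanned by s v and s w at z to stay in the
      ball of radius m; the summand 1 keeps the divisor positive when v and w are 0.\<close>
    define s where "s = m / (2 * (norm v + norm w + 1))"
    have np: "norm v + norm w + 1 > 0" by (simp add: add_nonneg_pos)
    have s: "s > 0" using m np by (simp add: s_def)
    have sm: "s * (norm v + norm w) < m"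
    proof -
      have "s * (norm v + norm w) \<le> s * (norm v + norm w + 1)" using s by simp
      also have "\<dots> = m / 2" using np by (simp add: s_def field_simps)
      finally show ?thesis using m by simp
    qed
    have W: "z + a *\<^sub>R v + b *\<^sub>R w \<in> W" "z + b *\<^sub>R w + a *\<^sub>R v \<in> W"
      if "0 \<le> a" "a \<le> s" "0 \<le> b" "b \<le> s" for a b
      using inW[OF that sm] r(2) m(2) by auto
    obtain a b where 1: "0 < a" "a < s" "0 < b" "b < s"
      "f (z + s *\<^sub>R v + s *\<^sub>R w) - f (z + s *\<^sub>R v) - f (z + s *\<^sub>R w) + f z = s * s * f'' v (z + a *\<^sub>R v + b *\<^sub>R w) w"
      using key[OF s, of v w] W by blast
    obtain b' a' where 2: "0 < b'" "b' < s" "0 < a'" "a' < s"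
      "f (z + s *\<^sub>R w + s *\<^sub>R v) - f (z + s *\<^sub>R w) - f (z + s *\<^sub>R v) + f z = s * s * f'' w (z + b' *\<^sub>R w + a' *\<^sub>R v) v"
      using key[OF s, of w v] W by blast
    \<comment> \<open>The second difference does not change when v and w are exchanged, so the two
      mean values, taken at different points near z, are equal.\<close>
    have "s * s * f'' v (z + a *\<^sub>R v + b *\<^sub>R w) w = s * s * f'' w (z + b' *\<^sub>R w + a' *\<^sub>R v) v"
      using 1(5) 2(5) by (simp add: algebra_simps)
    then have "f'' v (z + a *\<^sub>R v + b *\<^sub>R w) w = f'' w (z + b' *\<^sub>R w + a' *\<^sub>R v) v" using s by simp
    moreover have "dist (z + a *\<^sub>R v + b *\<^sub>R w) z < m" "dist (z + b' *\<^sub>R w + a' *\<^sub>R v) z < m"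
      using inW[of a s b m] inW[of a' s b' m] 1 2 sm by (auto simp: dist_commute)
    ultimately show ?thesis
      using d1(2)[of "z + a *\<^sub>R v + b *\<^sub>R w"] d2(2)[of "z + b' *\<^sub>R w + a' *\<^sub>R v"] m by (auto simp: abs_if split: if_splits)
  qed
  have "\<bar>f'' v z w - f'' w z v\<bar> \<le> 0" by (rule field_le_epsilon) (use close in simp)
  then show ?thesis by simp
qed

lemma continuous_on_closure_set_integrable:
  fixes f :: "'a::euclidean_space \<Rightarrow> real"
  assumes "open \<Omega>" "bounded \<Omega>" "continuous_on (closure \<Omega>) f"
  shows "set_integrable lborel \<Omega> f"
proof (rule set_integrable_subset[OF _ _ closure_subset])
  show "set_integrable lborel (closure \<Omega>) f"
    unfolding set_integrable_def using assms by (intro borel_integrable_compact) auto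
qed (use assms in auto)

text \<open>The derivative \<open>e'\<close> is bounded on the compact product of the closure of
  \<Omega> with a small time interval. The mean value theorem transfers the bound to the difference
  quotients, and dominated convergence applies along every sequence of increments.\<close>

lemma has_real_derivative_integral:
  fixes e :: "'a::euclidean_space \<times> real \<Rightarrow> real"
  assumes dom: "open \<Omega>" "bounded \<Omega>" "open I" "t \<in> I"
    and cont: "continuous_on (closure \<Omega> \<times> I) e"
    and der: "\<And>x s. x \<in> \<Omega> \<Longrightarrow> s \<in> I \<Longrightarrow> ((\<lambda>s. e (x, s)) has_real_derivative e' (x, s)) (at s)"
    and cont': "continuous_on (closure \<Omega> \<times> I) e'"
  shows "((\<lambda>s. LINT x:\<Omega>|lborel. e (x, s)) has_real_derivative (LINT x:\<Omega>|lborel. e' (x, t))) (at t)"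
proof -
  have ie: "set_integrable lborel \<Omega> (\<lambda>x. e (x, s))" if "s \<in> I" for s
    by (rule continuous_on_closure_set_integrable[OF dom(1,2) continuous_on_compose2[OF cont]])
       (use that in \<open>auto intro!: continuous_intros\<close>)
  have ie': "set_integrable lborel \<Omega> (\<lambda>x. e' (x, s))" if "s \<in> I" for s
    by (rule continuous_on_closure_set_integrable[OF dom(1,2) continuous_on_compose2[OF cont']])
       (use that in \<open>auto intro!: continuous_intros\<close>)
  obtain r where r: "r > 0" "cball t r \<subseteq> I" using dom(3,4) open_contains_cball by blast
  have "compact (e' ` (closure \<Omega> \<times> cball t r))"
    using dom(2) r(2) by (intro compact_continuous_image continuous_on_subset[OF cont'] compact_Times) auto
  then obtain K where K0: "\<forall>y\<in>e' ` (closure \<Omega> \<times> cball t r). norm y \<le> K"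
    using compact_imp_bounded[of "e' ` (closure \<Omega> \<times> cball t r)"] unfolding bounded_iff by auto
  have K: "\<bar>e' (x, s)\<bar> \<le> K" if "x \<in> closure \<Omega>" "s \<in> cball t r" for x s
    using bspec[OF K0 imageI[OF SigmaI[OF that]]] by simp
  have quot: "\<bar>(e (x, t + h) - e (x, t)) / h\<bar> \<le> K" if "x \<in> \<Omega>" "\<bar>h\<bar> \<le> r" "h \<noteq> 0" for x h
  proof -
    have b: "norm (e (x, t + h) - e (x, t)) \<le> K * norm (t + h - t)"
    proof (rule field_differentiable_bound[of "cball t r"])
      show "((\<lambda>s. e (x, s)) has_field_derivative e' (x, s)) (at s within cball t r)" if "s \<in> cball t r" for s
        by (rule has_field_derivative_at_within[OF der[OF \<open>x \<in> \<Omega>\<close>]]) (use r(2) that in blast)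
      show "norm (e' (x, s)) \<le> K" if "s \<in> cball t r" for s
        using K[of x s] that \<open>x \<in> \<Omega>\<close> closure_subset by auto
    qed (use that r in \<open>auto simp: dist_norm\<close>)
    then show ?thesis using that(3) by (simp add: abs_divide divide_le_eq)
  qed
  have "((\<lambda>h. ((LINT x:\<Omega>|lborel. e (x, t + h)) - (LINT x:\<Omega>|lborel. e (x, t))) / h) \<longlongrightarrow> (LINT x:\<Omega>|lborel. e' (x, t))) (at 0)"
    unfolding tendsto_at_iff_sequentially comp_def
  proof (intro allI impI)
    fix h :: "nat \<Rightarrow> real" assume h: "\<forall>i. h i \<in> UNIV - {0}" and h0: "h \<longlonglongrightarrow> 0"
    obtain N where N: "\<And>n. n \<ge> N \<Longrightarrow> \<bar>h n\<bar> \<le> r"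
    proof -
      have "\<forall>\<^sub>F n in sequentially. \<bar>h n\<bar> < r"
        using tendstoD[OF h0 r(1)] by (simp add: dist_norm)
      then obtain N where "\<forall>n\<ge>N. \<bar>h n\<bar> < r" unfolding eventually_sequentially by blast
      then show ?thesis by (intro that[of N]) (simp add: less_imp_le)
    qed
    \<comment> \<open>Dropping the first N increments keeps all the times t + k n in I, where the
      integrals are known to exist.\<close>
    define k where "k = (\<lambda>n. h (n + N))"
    have k: "\<bar>k n\<bar> \<le> r" "k n \<noteq> 0" "t + k n \<in> I" for n
      using N[of "n + N"] h r(2) by (auto simp: k_def subset_iff dist_norm)
    have k0: "k \<longlonglongrightarrow> 0" unfolding k_def using h0 by (rule LIMSEQ_ignore_initial_segment)
    have lim: "(\<lambda>n. LINT x|lborel. indicator \<Omega> x *\<^sub>R ((e (x, t + k n) - e (x, t)) / k n)) \<longlonglongrightarrow> (LINT x|lborel. indicator \<Omega> x *\<^sub>R e' (x, t))"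
    proof (rule integral_dominated_convergence[where w="\<lambda>x. indicator \<Omega> x * K"])
      show "integrable lborel (\<lambda>x. indicator \<Omega> x * K)"
        using emeasure_bounded_finite[OF dom(2)] dom(1) by (intro integrable_mult_left integrable_real_indicator) auto
      show "(\<lambda>x. indicator \<Omega> x *\<^sub>R e' (x, t)) \<in> borel_measurable lborel"
        using ie'[OF dom(4)] by (simp add: set_integrable_def borel_measurable_integrable)
      show "(\<lambda>x. indicator \<Omega> x *\<^sub>R ((e (x, t + k n) - e (x, t)) / k n)) \<in> borel_measurable lborel" for n
        using set_integrable_divide[OF set_integral_diff(1)[OF ie[OF k(3)] ie[OF dom(4)]], of n "k n"]
        by (simp add: set_integrable_def borel_measurable_integrable)
      show "AE x in lborel. (\<lambda>n. indicator \<Omega> x *\<^sub>R ((e (x, t + k n) - e (x, t)) / k n)) \<longlonglongrightarrow> indicator \<Omega> x *\<^sub>R e' (x, t)"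
      proof (rule AE_I2)
        fix x
        show "(\<lambda>n. indicator \<Omega> x *\<^sub>R ((e (x, t + k n) - e (x, t)) / k n)) \<longlonglongrightarrow> indicator \<Omega> x *\<^sub>R e' (x, t)"
        proof (cases "x \<in> \<Omega>")
          case True
          have "((\<lambda>h. (e (x, t + h) - e (x, t)) / h) \<longlongrightarrow> e' (x, t)) (at 0)"
            using der[OF True dom(4)] by (simp add: DERIV_def)
          then have "(\<lambda>n. (e (x, t + k n) - e (x, t)) / k n) \<longlonglongrightarrow> e' (x, t)"
            using k0 k(2) unfolding tendsto_at_iff_sequentially comp_def by auto
          then show ?thesis using True by simp
        qed simp
      qed
      show "AE x in lborel. norm (indicator \<Omega> x *\<^sub>R ((e (x, t + k n) - e (x, t)) / k n)) \<le> indicator \<Omega> x * K" for n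
        using quot[OF _ k(1) k(2)] by (auto simp: indicator_def)
    qed
    have eq: "(LINT x|lborel. indicator \<Omega> x *\<^sub>R ((e (x, t + k n) - e (x, t)) / k n))
      = ((LINT x:\<Omega>|lborel. e (x, t + k n)) - (LINT x:\<Omega>|lborel. e (x, t))) / k n" for n
      using set_integral_diff(2)[OF ie[OF k(3)] ie[OF dom(4)], of n]
      by (simp add: set_lebesgue_integral_def[symmetric] del: real_scaleR_def)
    have "(\<lambda>n. ((LINT x:\<Omega>|lborel. e (x, t + k n)) - (LINT x:\<Omega>|lborel. e (x, t))) / k n)
       \<longlonglongrightarrow> (LINT x:\<Omega>|lborel. e' (x, t))"
      by (rule lim[unfolded eq, folded set_lebesgue_integral_def])
    then show "(\<lambda>n. ((LINT x:\<Omega>|lborel. e (x, t + h n)) - (LINT x:\<Omega>|lborel. e (x, t))) / h n)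
       \<longlonglongrightarrow> (LINT x:\<Omega>|lborel. e' (x, t))"
      unfolding k_def by (rule LIMSEQ_offset)
  qed
  then show ?thesis by (simp add: DERIV_def)
qed

section \<open>The local energy balance\<close>

lemma bounded_bilinear_differentiable:
  assumes "bounded_bilinear b" "f differentiable (at x within S)" "g differentiable (at x within S)"
  shows "(\<lambda>x. b (f x) (g x)) differentiable (at x within S)"
  using assms(2,3) bounded_bilinear.FDERIV[OF assms(1)] unfolding differentiable_def by blast

lemma partial_eq: "(f has_derivative f') (at x) \<Longrightarrow> partial i f x = f' (axis i 1)"
  by (simp add: partial_def frechet_derivative_at[symmetric])

lemma has_derivative_partial:
  fixes f :: "real^'d::finite \<Rightarrow> 'b::real_normed_vector"
  assumes "f differentiable (at x)"
  shows "(f has_derivative (\<lambda>v. \<Sum>i\<in>UNIV. (v $ i) *\<^sub>R partial i f x)) (at x)"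
proof -
  have d: "(f has_derivative frechet_derivative f (at x)) (at x)"
    using assms by (simp add: frechet_derivative_works)
  interpret bounded_linear "frechet_derivative f (at x)" using d by (rule has_derivative_bounded_linear)
  have "frechet_derivative f (at x) v = (\<Sum>i\<in>UNIV. (v $ i) *\<^sub>R partial i f x)" for v
  proof -
    have "frechet_derivative f (at x) v = frechet_derivative f (at x) (\<Sum>i\<in>UNIV. (v $ i) *\<^sub>R axis i 1)"
      by (simp add: basis_expansion scalar_mult_eq_scaleR[symmetric])
    then show ?thesis by (simp add: sum scaleR partial_def)
  qed
  then have "frechet_derivative f (at x) = (\<lambda>v. \<Sum>i\<in>UNIV. (v $ i) *\<^sub>R partial i f x)" by (rule ext)
  with d show ?thesis by simp
qed

lemma has_derivative_grad:
  fixes f :: "real^'d::finite \<Rightarrow> real"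
  assumes "f differentiable (at x)"
  shows "(f has_derivative (\<lambda>v. grad f x \<bullet> v)) (at x)"
  using has_derivative_partial[OF assms] by (simp add: grad_def inner_vec_def mult.commute)

lemma grad_eqI:
  assumes "(f has_derivative (\<lambda>v. g \<bullet> v)) (at x)"
  shows "grad f x = g"
  using partial_eq[OF assms] by (simp add: grad_def vec_eq_iff inner_axis)

lemma partial_nth:
  fixes v :: "real^'d::finite \<Rightarrow> real^'n::finite"
  assumes "v differentiable (at x)"
  shows "partial i (\<lambda>y. v y $ j) x = partial i v x $ j"
  by (subst partial_eq[OF bounded_linear.has_derivative[OF bounded_linear_vec_nth has_derivative_partial[OF assms]]])
     (simp add: axis_def if_distrib[of "\<lambda>c. c *\<^sub>R _"] cong: if_cong)

lemma divergence_partial: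
  assumes "v differentiable (at x)"
  shows "divergence v x = (\<Sum>i\<in>UNIV. partial i v x $ i)"
  by (simp add: divergence_def partial_nth[OF assms])

lemma divergence_eq: "(v has_derivative v') (at x) \<Longrightarrow> divergence v x = (\<Sum>i\<in>UNIV. v' (axis i 1) $ i)"
  by (subst divergence_partial) (auto simp: differentiable_def partial_eq)

lemma differentiable_nth:
  fixes v :: "real^'d::finite \<Rightarrow> 'b::real_normed_vector^'n::finite"
  shows "v differentiable F \<Longrightarrow> (\<lambda>y. v y $ i) differentiable F"
  unfolding differentiable_def using bounded_linear.has_derivative[OF bounded_linear_vec_nth] by blast

lemma divergence_add:
  "v differentiable (at x) \<Longrightarrow> w differentiable (at x) \<Longrightarrow> divergence (\<lambda>y. v y + w y) x = divergence v x + divergence w x"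
  using divergence_eq[OF has_derivative_add[OF has_derivative_partial has_derivative_partial], of v x w]
    divergence_eq[OF has_derivative_partial, of v x] divergence_eq[OF has_derivative_partial, of w x]
  by (simp add: sum.distrib)

lemma divergence_diff:
  "v differentiable (at x) \<Longrightarrow> w differentiable (at x) \<Longrightarrow> divergence (\<lambda>y. v y - w y) x = divergence v x - divergence w x"
  using divergence_eq[OF has_derivative_diff[OF has_derivative_partial has_derivative_partial], of v x w]
    divergence_eq[OF has_derivative_partial, of v x] divergence_eq[OF has_derivative_partial, of w x]
  by (simp add: sum_subtractf)

lemma divergence_scaleR:
  assumes "f differentiable (at x)" "v differentiable (at x)"
  shows "divergence (\<lambda>y. f y *\<^sub>R v y) x = f x * divergence v x + grad f x \<bullet> v x"
proof -
  have v: "(v has_derivative frechet_derivative v (at x)) (at x)" using assms(2) by (simp add: frechet_derivative_works)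
  show ?thesis
    using divergence_eq[OF has_derivative_scaleR[OF has_derivative_grad[OF assms(1)] v]] divergence_eq[OF v]
    by (simp add: sum.distrib sum_distrib_left inner_axis) (simp add: inner_vec_def)
qed

lemma divergence_const_scaleR:
  assumes "v differentiable (at x)"
  shows "divergence (\<lambda>y. c *\<^sub>R v y) x = c * divergence v x"
proof -
  have "grad (\<lambda>y. c) x = 0" by (rule grad_eqI) simp
  then show ?thesis using divergence_scaleR[of "\<lambda>_. c" x v] assms by simp
qed

lemma divergence_sum:
  fixes v :: "'i \<Rightarrow> real^'d::finite \<Rightarrow> real^'d"
  assumes "finite I" "\<And>i. i \<in> I \<Longrightarrow> v i differentiable (at x)"
  shows "divergence (\<lambda>y. \<Sum>i\<in>I. v i y) x = (\<Sum>i\<in>I. divergence (v i) x)"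
  using assms
proof (induction rule: finite_induct)
  case empty
  have "((\<lambda>y::real^'d. 0::real^'d) has_derivative (\<lambda>v. 0)) (at x)" by simp
  from divergence_eq[OF this] show ?case by simp
next
  case (insert i I)
  then show ?case by (simp add: divergence_add differentiable_sum)
qed

text \<open>Through this the convective term, multiplied by u, becomes part of the divergence of
  |u|^2 w / 2.\<close>

lemma grad_half_inner_self:
  assumes "u differentiable (at x)"
  shows "grad (\<lambda>y. (u y \<bullet> u y) / 2) x \<bullet> w = convect w u x \<bullet> u x"
proof -
  have u: "(u has_derivative (\<lambda>v. convect v u x)) (at x)"
    using has_derivative_partial[OF assms] by (simp add: convect_def)
  have d1: "((\<lambda>y. (u y \<bullet> u y) / 2) has_derivative (\<lambda>v. convect v u x \<bullet> u x)) (at x)"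
    by (auto intro!: derivative_eq_intros u simp: inner_commute)
  have d2: "((\<lambda>y. (u y \<bullet> u y) / 2) has_derivative (\<lambda>v. grad (\<lambda>y. (u y \<bullet> u y) / 2) x \<bullet> v)) (at x)"
    by (rule has_derivative_grad) (use d1 in \<open>auto simp: differentiable_def\<close>)
  show ?thesis by (rule fun_cong[OF has_derivative_unique[OF d2 d1]])
qed

text \<open>The product rule that moves the viscous term into the flux; the field on the left is the
  transpose of A applied to u.\<close>

lemma divergence_tensor_vector:
  assumes u: "u differentiable (at x)" and A: "A differentiable (at x)"
  shows "divergence (\<lambda>y. \<Sum>i\<in>UNIV. (u y $ i) *\<^sub>R A y $ i) x
    = tensor_divergence A x \<bullet> u x + (\<Sum>i\<in>UNIV. grad (\<lambda>y. u y $ i) x \<bullet> A x $ i)"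
proof -
  have "divergence (\<lambda>y. \<Sum>i\<in>UNIV. (u y $ i) *\<^sub>R A y $ i) x = (\<Sum>i\<in>UNIV. divergence (\<lambda>y. (u y $ i) *\<^sub>R A y $ i) x)"
    by (intro divergence_sum) (auto intro!: bounded_bilinear_differentiable[OF bounded_bilinear_scaleR] differentiable_nth u A)
  also have "\<dots> = (\<Sum>i\<in>UNIV. u x $ i * divergence (\<lambda>y. A y $ i) x + grad (\<lambda>y. u y $ i) x \<bullet> A x $ i)"
    by (intro sum.cong refl divergence_scaleR differentiable_nth u A)
  finally show ?thesis by (simp add: sum.distrib tensor_divergence_def inner_vec_def mult.commute)
qed

text \<open>In the Frobenius product with a symmetric matrix only the symmetric part of the velocity
  gradient counts.\<close>

lemma sum_grad_inner_sym_grad: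
  assumes "u differentiable (at x)"
  shows "(\<Sum>i\<in>UNIV. grad (\<lambda>y. u y $ i) x \<bullet> sym_grad u x $ i) = (norm (sym_grad u x))\<^sup>2"
proof -
  define J where "J i j = partial j u x $ i" for i j
  have g: "grad (\<lambda>y. u y $ i) x $ j = J i j" for i j
    by (simp add: grad_def partial_nth[OF assms] J_def)
  have D: "sym_grad u x $ i $ j = (J i j + J j i) / 2" for i j
    by (simp add: sym_grad_def jacobian_def matrix_def transpose_def J_def partial_def)
  have swap: "(\<Sum>i\<in>UNIV. \<Sum>j\<in>UNIV. J i j * (J i j + J j i)) = (\<Sum>i\<in>UNIV. \<Sum>j\<in>UNIV. J j i * (J j i + J i j))"
    by (rule sum.swap)
  have "(\<Sum>i\<in>UNIV. \<Sum>j\<in>UNIV. (J i j + J j i) * (J i j + J j i)) = 2 * (\<Sum>i\<in>UNIV. \<Sum>j\<in>UNIV. J i j * (J i j + J j i))"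
  proof -
    have "(\<Sum>i\<in>UNIV. \<Sum>j\<in>UNIV. (J i j + J j i) * (J i j + J j i))
      = (\<Sum>i\<in>UNIV. \<Sum>j\<in>UNIV. J i j * (J i j + J j i)) + (\<Sum>i\<in>UNIV. \<Sum>j\<in>UNIV. J j i * (J j i + J i j))"
      by (simp only: sum.distrib[symmetric]) (simp add: algebra_simps)
    then show ?thesis using swap by simp
  qed
  then show ?thesis
    by (simp add: power2_norm_eq_inner inner_vec_def g D sum_distrib_left[symmetric] sum_divide_distrib[symmetric] algebra_simps)
qed

text \<open>What the two- and the three-dimensional operations have in common: the scalar triple
  product is cyclic, and both curls are \<open>\<nabla> \<times> v\<close>. The sign in the second curl comes from the
  operands of \<open>cross'\<close>, which have the scalar-like factor first.\<close>

locale vector_ops =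
  fixes ops :: "(real^'d::finite, 'c::euclidean_space) cross_ops"
  assumes cross_bilinear: "bounded_bilinear (cross ops)"
    and cross'_bilinear: "bounded_bilinear (cross' ops)"
    and cross'_inner: "cross' ops c v \<bullet> w = c \<bullet> cross ops v w"
    and cross_skew: "cross ops v w = - cross ops w v"
    and curl_cross: "f differentiable (at x) \<Longrightarrow> curl ops f x = (\<Sum>i\<in>UNIV. cross ops (axis i 1) (partial i f x))"
    and curl'_cross': "g differentiable (at x) \<Longrightarrow> curl' ops g x = - (\<Sum>i\<in>UNIV. cross' ops (partial i g x) (axis i 1))"
begin

text \<open>After the product rule, cyclicity and skewness of the triple product gather each basis
  vector with its partial derivative, and the two sums that arise are the curls.\<close>

lemma divergence_cross':
  assumes a: "a differentiable (at x)" and B: "B differentiable (at x)"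
  shows "divergence (\<lambda>y. cross' ops (a y) (B y)) x = B x \<bullet> curl' ops a x - a x \<bullet> curl ops B x"
proof -
  interpret b: bounded_bilinear "cross ops" by (rule cross_bilinear)
  have der: "(a has_derivative frechet_derivative a (at x)) (at x)" "(B has_derivative frechet_derivative B (at x)) (at x)"
    using a B by (simp_all add: frechet_derivative_works)
  have nth: "y $ i = y \<bullet> axis i 1" for y :: "real^'d" and i by (simp add: inner_axis)
  have "divergence (\<lambda>y. cross' ops (a y) (B y)) x
    = (\<Sum>i\<in>UNIV. a x \<bullet> cross ops (partial i B x) (axis i 1) + partial i a x \<bullet> cross ops (B x) (axis i 1))"
    unfolding divergence_eq[OF bounded_bilinear.FDERIV[OF cross'_bilinear der]] nth
    by (simp add: inner_add_left cross'_inner partial_def)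
  also have "\<dots> = (\<Sum>i\<in>UNIV. - (a x \<bullet> cross ops (axis i 1) (partial i B x)) - cross' ops (partial i a x) (axis i 1) \<bullet> B x)"
    by (intro sum.cong refl) (simp add: cross'_inner cross_skew[of "partial _ B x"] cross_skew[of "B x"])
  finally show ?thesis
    by (simp add: curl_cross[OF B] curl'_cross'[OF a] sum_subtractf sum_negf inner_sum_left inner_sum_right inner_commute[of "B x"])
qed

lemma differentiable_cross: "v differentiable (at x within S) \<Longrightarrow> w differentiable (at x within S) \<Longrightarrow> (\<lambda>x. cross ops (v x) (w x)) differentiable (at x within S)"
  by (rule bounded_bilinear_differentiable[OF cross_bilinear])

lemma differentiable_cross': "v differentiable (at x within S) \<Longrightarrow> w differentiable (at x within S) \<Longrightarrow> (\<lambda>x. cross' ops (v x) (w x)) differentiable (at x within S)"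
  by (rule bounded_bilinear_differentiable[OF cross'_bilinear])

end

lemma vector_ops_3D: "vector_ops ops_3D"
proof (rule vector_ops.intro)
  show "bounded_bilinear (cross ops_3D)" "bounded_bilinear (cross' ops_3D)"
    unfolding ops_3D_def by (simp_all add: bilinear_conv_bounded_bilinear[symmetric] bilinear_cross)
  show "cross' ops_3D c v \<bullet> w = c \<bullet> cross ops_3D v w" for c v w
    by (simp add: ops_3D_def cross3_simps)
  show "cross ops_3D v w = - cross ops_3D w v" for v w
    unfolding ops_3D_def cross_ops.simps by (rule Cross3.cross_skew)
  show "curl ops_3D v x = (\<Sum>i\<in>UNIV. cross ops_3D (axis i 1) (partial i v x))" if "v differentiable (at x)" for v x
    by (simp add: ops_3D_def curl_3D_def partial_nth[OF that] sum_3 vec_eq_iff forall_3 cross3_def axis_def)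
  show "curl' ops_3D c x = - (\<Sum>i\<in>UNIV. cross' ops_3D (partial i c x) (axis i 1))" if "c differentiable (at x)" for c x
    by (simp add: ops_3D_def curl_3D_def partial_nth[OF that] sum_3 vec_eq_iff forall_3 cross3_def axis_def)
qed

lemma vector_ops_2D: "vector_ops ops_2D"
proof (rule vector_ops.intro)
  show "bounded_bilinear (cross ops_2D)"
    by (rule bilinear_conv_bounded_bilinear[THEN iffD1])
       (auto simp: ops_2D_def bilinear_def algebra_simps intro!: linearI)
  show "bounded_bilinear (cross' ops_2D)"
    by (rule bilinear_conv_bounded_bilinear[THEN iffD1])
       (auto simp: ops_2D_def bilinear_def vec_eq_iff forall_2 algebra_simps intro!: linearI)
  show "cross' ops_2D c v \<bullet> w = c \<bullet> cross ops_2D v w" for c v w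
    by (simp add: ops_2D_def inner_vec_def sum_2 algebra_simps)
  show "cross ops_2D v w = - cross ops_2D w v" for v w
    by (simp add: ops_2D_def algebra_simps)
  show "curl ops_2D v x = (\<Sum>i\<in>UNIV. cross ops_2D (axis i 1) (partial i v x))" if "v differentiable (at x)" for v x
    by (simp add: ops_2D_def partial_nth[OF that] sum_2 axis_def)
  show "curl' ops_2D c x = - (\<Sum>i\<in>UNIV. cross' ops_2D (partial i c x) (axis i 1))" for c x
    by (simp add: ops_2D_def sum_2 vec_eq_iff forall_2 axis_def)
qed

section \<open>Energy flux and pointwise balance\<close>

lemma F_pot_deriv: "(F_pot has_real_derivative f_pot s) (at s)"
proof -
  have "(F_pot has_real_derivative s * (s\<^sup>2 - 1)) (at s)"
    unfolding F_pot_def[abs_def] by (auto intro!: derivative_eq_intros simp: power2_eq_square algebra_simps)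
  then show ?thesis unfolding f_pot_def by (simp add: DERIV_imp_deriv)
qed

text \<open>In order: interface energy, convection of kinetic energy, viscous stress, pressure,
  transport and diffusion of the phase weighted by \<omega>, and the electromagnetic (Poynting)
  flux. The sign is such that the energy density grows by plus the divergence.\<close>

definition energy_flux ::
  "(real^'d::finite, 'c::real_normed_vector) cross_ops \<Rightarrow> params \<Rightarrow> (real^'d) state \<Rightarrow> real \<Rightarrow> real^'d \<Rightarrow> real^'d" where
  "energy_flux ops P U t y =
     (let u = vel U t; p = pres U t; B = mag U t; \<phi> = phase U t; \<omega> = chem U t in
       (gam P * eps P * time_deriv (phase U) t y) *\<^sub>R grad \<phi> y
       - ((u y \<bullet> u y) / 2) *\<^sub>R (rho P (\<phi> y) *\<^sub>R u y - (rho' P * Mob P (\<phi> y)) *\<^sub>R grad \<omega> y)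
       + (\<Sum>i\<in>UNIV. (u y $ i) *\<^sub>R ((2 * eta P (\<phi> y)) *\<^sub>R sym_grad u y) $ i)
       - p y *\<^sub>R u y - \<omega> y *\<^sub>R \<phi> y *\<^sub>R u y + \<omega> y *\<^sub>R Mob P (\<phi> y) *\<^sub>R grad \<omega> y
       + (1 / mu P) *\<^sub>R cross' ops (cross ops (u y) (B y) - (1 / mu P) *\<^sub>R (1 / sigma P (\<phi> y)) *\<^sub>R curl ops B y) (B y))"

definition dissipation_density ::
  "(real^'d::finite, 'c::real_normed_vector) cross_ops \<Rightarrow> params \<Rightarrow> (real^'d) state \<Rightarrow> real \<Rightarrow> real^'d \<Rightarrow> real" where
  "dissipation_density ops P U t y =
     Mob P (phase U t y) * (norm (grad (chem U t) y))\<^sup>2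
     + 2 * (eta P (phase U t y) * (norm (sym_grad (vel U t) y))\<^sup>2)
     + 1 / (mu P)\<^sup>2 * (1 / sigma P (phase U t y) * (norm (curl ops (mag U t) y))\<^sup>2)"

text \<open>The left side is the time derivative of the energy density after the chain rule, with
  the gradient of the time derivative of \<phi> in place of the time derivative of its gradient.
  Expanding the divergence of the flux term by term leaves the equations tested with u, B / mu and
  \<omega>.\<close>

lemma (in vector_ops) local_energy_balance:
  fixes U :: "(real^'d) state"
  assumes eqs: "CH_MHD_equations ops P x t U"
    and [simp]: "mu P \<noteq> 0" "sigma P (phase U t x) \<noteq> 0" "eps P \<noteq> 0"
    and u: "vel U t differentiable (at x)" and p: "pres U t differentiable (at x)"
    and B: "mag U t differentiable (at x)" and \<phi>: "phase U t differentiable (at x)"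
    and \<omega>: "chem U t differentiable (at x)"
    and \<phi>t: "(\<lambda>y. time_deriv (phase U) t y) differentiable (at x)"
    and g\<phi>: "grad (phase U t) differentiable (at x)"
    and g\<omega>: "grad (chem U t) differentiable (at x)"
    and Du: "sym_grad (vel U t) differentiable (at x)"
    and cB: "curl ops (mag U t) differentiable (at x)"
  shows "gam P * eps P * (grad (phase U t) x \<bullet> grad (\<lambda>y. time_deriv (phase U) t y) x)
      + gam P / eps P * f_pot (phase U t x) * time_deriv (phase U) t x
      + 1/2 * rho' P * time_deriv (phase U) t x * (norm (vel U t x))\<^sup>2
      + rho P (phase U t x) * (vel U t x \<bullet> time_deriv (vel U) t x)
      + 1 / mu P * (mag U t x \<bullet> time_deriv (mag U) t x)
    = divergence (energy_flux ops P U t) x - dissipation_density ops P U t x"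
proof -
  let ?u = "vel U t" and ?p = "pres U t" and ?B = "mag U t" and ?\<phi> = "phase U t" and ?\<omega> = "chem U t"
  define \<phi>t where "\<phi>t = (\<lambda>y. time_deriv (phase U) t y)"
  define ut where "ut = time_deriv (vel U) t x"
  define Bt where "Bt = time_deriv (mag U) t x"
  define m where "m = mu P"
  define M where "M = (\<lambda>y. Mob P (?\<phi> y))"
  define et where "et = (\<lambda>y. eta P (?\<phi> y))"
  define r where "r = (\<lambda>y. rho P (?\<phi> y))"
  define sg where "sg = (\<lambda>y. 1 / sigma P (?\<phi> y))"
  define w where "w = (\<lambda>y. r y *\<^sub>R ?u y - (rho' P * M y) *\<^sub>R grad ?\<omega> y)"
  define A where "A = (\<lambda>y. (2 * et y) *\<^sub>R sym_grad ?u y)"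
  define c where "c = (\<lambda>y. sg y *\<^sub>R curl ops ?B y)"
  define ub where "ub = (\<lambda>y. cross ops (?u y) (?B y))"
  have affine: "(\<lambda>y. affine_mix a b (?\<phi> y)) differentiable (at x)" for a b
    unfolding affine_mix_def using \<phi> by (auto intro!: derivative_intros)
  have dM: "M differentiable (at x)" and det: "et differentiable (at x)" and dr: "r differentiable (at x)"
    using affine by (simp_all add: M_def et_def r_def Mob_def eta_def rho_def)
  have dsg: "sg differentiable (at x)"
    unfolding sg_def sigma_def by (intro differentiable_divide affine) (use assms(3) in \<open>auto simp: sigma_def\<close>)
  note sc = bounded_bilinear_differentiable[OF bounded_bilinear_scaleR]
  have dw: "w differentiable (at x)" unfolding w_def by (intro differentiable_diff sc differentiable_mult differentiable_const dr dM u g\<omega>)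
  have dA: "A differentiable (at x)" unfolding A_def by (intro sc differentiable_mult differentiable_const det Du)
  have dc: "c differentiable (at x)" unfolding c_def by (intro sc dsg cB)
  have dub: "ub differentiable (at x)" unfolding ub_def by (intro differentiable_cross u B)
  have dphit: "\<phi>t differentiable (at x)" using \<phi>t by (simp add: \<phi>t_def)
  have duu: "(\<lambda>y. (?u y \<bullet> ?u y) / 2) differentiable (at x)"
    by (intro differentiable_divide differentiable_const bounded_bilinear_differentiable[OF bounded_bilinear_inner] u) simp
  have dMg: "(\<lambda>y. M y *\<^sub>R grad ?\<omega> y) differentiable (at x)" by (intro sc dM g\<omega>)
  have d\<phi>u: "(\<lambda>y. ?\<phi> y *\<^sub>R ?u y) differentiable (at x)" by (intro sc \<phi> u)
  have E1: "r x *\<^sub>R ut + convect (w x) ?u x - tensor_divergence A x + grad ?p x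
      - (1 / m) *\<^sub>R cross' ops (curl ops ?B x) (?B x) + ?\<phi> x *\<^sub>R grad ?\<omega> x = 0"
    and E2: "divergence ?u x = 0"
    and E3: "Bt + (1 / m) *\<^sub>R curl' ops c x - curl' ops ub x = 0"
    and E5: "\<phi>t x + divergence (\<lambda>y. ?\<phi> y *\<^sub>R ?u y) x - divergence (\<lambda>y. M y *\<^sub>R grad ?\<omega> y) x = 0"
    and E6: "?\<omega> x = - gam P * eps P * laplacian ?\<phi> x + gam P / eps P * f_pot (?\<phi> x)"
    using eqs unfolding CH_MHD_equations_def Let_def
    by (simp_all add: r_def ut_def w_def M_def A_def et_def m_def Bt_def c_def sg_def ub_def \<phi>t_def)
  \<comment> \<open>As \<open>rho P\<close> is affine, rho u is rho' \<phi> u plus a constant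
    multiple of u. The last summand is divergence free, and the rest of w is rho' times the flux in
    the phase equation.\<close>
  have div_w: "divergence w x = - rho' P * \<phi>t x"
  proof -
    have "w = (\<lambda>y. rho' P *\<^sub>R (?\<phi> y *\<^sub>R ?u y) + ((rho1 P + rho2 P) / 2) *\<^sub>R ?u y - rho' P *\<^sub>R (M y *\<^sub>R grad ?\<omega> y))"
      by (simp add: w_def r_def rho_def affine_mix_def rho'_def fun_eq_iff algebra_simps)
    then have "divergence w x = rho' P * divergence (\<lambda>y. ?\<phi> y *\<^sub>R ?u y) x + (rho1 P + rho2 P) / 2 * divergence ?u x
        - rho' P * divergence (\<lambda>y. M y *\<^sub>R grad ?\<omega> y) x"
      by (simp add: divergence_diff divergence_add divergence_const_scaleR u d\<phi>u dMg sc del: scaleR_scaleR)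
    also have "\<dots> = rho' P * (divergence (\<lambda>y. ?\<phi> y *\<^sub>R ?u y) x - divergence (\<lambda>y. M y *\<^sub>R grad ?\<omega> y) x)"
      using E2 by (simp add: algebra_simps)
    also have "\<dots> = rho' P * (- \<phi>t x)" using E5 by (intro arg_cong[of _ _ "\<lambda>s. rho' P * s"]) linarith
    finally show ?thesis by simp
  qed
  have flux: "energy_flux ops P U t = (\<lambda>y. (gam P * eps P) *\<^sub>R (\<phi>t y *\<^sub>R grad ?\<phi> y) - ((?u y \<bullet> ?u y) / 2) *\<^sub>R w y
       + (\<Sum>i\<in>UNIV. (?u y $ i) *\<^sub>R A y $ i) - ?p y *\<^sub>R ?u y - ?\<omega> y *\<^sub>R (?\<phi> y *\<^sub>R ?u y) + ?\<omega> y *\<^sub>R (M y *\<^sub>R grad ?\<omega> y)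
       + (1 / m) *\<^sub>R cross' ops (ub y - (1 / m) *\<^sub>R c y) (?B y))"
    by (simp add: energy_flux_def Let_def fun_eq_iff \<phi>t_def w_def r_def M_def A_def et_def ub_def c_def sg_def m_def)
  have dT: "(\<lambda>y. \<Sum>i\<in>UNIV. (?u y $ i) *\<^sub>R A y $ i) differentiable (at x)"
    by (intro differentiable_sum) (auto intro!: sc differentiable_nth u dA)
  have dC: "(\<lambda>y. cross' ops (ub y - (1 / m) *\<^sub>R c y) (?B y)) differentiable (at x)"
    by (intro differentiable_cross' differentiable_diff sc differentiable_const dub dc B)
  have "divergence (energy_flux ops P U t) x =
      gam P * eps P * divergence (\<lambda>y. \<phi>t y *\<^sub>R grad ?\<phi> y) x
      - divergence (\<lambda>y. ((?u y \<bullet> ?u y) / 2) *\<^sub>R w y) x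
      + divergence (\<lambda>y. \<Sum>i\<in>UNIV. (?u y $ i) *\<^sub>R A y $ i) x
      - divergence (\<lambda>y. ?p y *\<^sub>R ?u y) x - divergence (\<lambda>y. ?\<omega> y *\<^sub>R (?\<phi> y *\<^sub>R ?u y)) x
      + divergence (\<lambda>y. ?\<omega> y *\<^sub>R (M y *\<^sub>R grad ?\<omega> y)) x
      + 1 / m * divergence (\<lambda>y. cross' ops (ub y - (1 / m) *\<^sub>R c y) (?B y)) x"
    unfolding flux
    by (subst divergence_add divergence_diff divergence_const_scaleR;
        (intro differentiable_add differentiable_diff sc differentiable_const duu dw dT p u \<omega> d\<phi>u dMg dC dphit g\<phi>)?)+
       simp
  also have "divergence (\<lambda>y. \<phi>t y *\<^sub>R grad ?\<phi> y) x = \<phi>t x * laplacian ?\<phi> x + grad \<phi>t x \<bullet> grad ?\<phi> x"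
    by (simp add: divergence_scaleR[OF dphit g\<phi>] laplacian_def)
  also have "divergence (\<lambda>y. ((?u y \<bullet> ?u y) / 2) *\<^sub>R w y) x
      = (?u x \<bullet> ?u x) / 2 * (- rho' P * \<phi>t x) + convect (w x) ?u x \<bullet> ?u x"
    by (simp add: divergence_scaleR[OF duu dw] div_w grad_half_inner_self[OF u])
  also have "divergence (\<lambda>y. \<Sum>i\<in>UNIV. (?u y $ i) *\<^sub>R A y $ i) x
      = tensor_divergence A x \<bullet> ?u x + 2 * et x * (norm (sym_grad ?u x))\<^sup>2"
  proof -
    have "(\<Sum>i\<in>UNIV. grad (\<lambda>y. ?u y $ i) x \<bullet> A x $ i) = 2 * et x * (norm (sym_grad ?u x))\<^sup>2"
      by (simp add: A_def sum_distrib_left[symmetric] sum_grad_inner_sym_grad[OF u])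
    then show ?thesis by (simp add: divergence_tensor_vector[OF u dA])
  qed
  also have "divergence (\<lambda>y. ?p y *\<^sub>R ?u y) x = grad ?p x \<bullet> ?u x"
    by (simp add: divergence_scaleR[OF p u] E2)
  also have "divergence (\<lambda>y. ?\<omega> y *\<^sub>R (?\<phi> y *\<^sub>R ?u y)) x
      = ?\<omega> x * divergence (\<lambda>y. ?\<phi> y *\<^sub>R ?u y) x + ?\<phi> x * (grad ?\<omega> x \<bullet> ?u x)"
    by (subst divergence_scaleR[OF \<omega> d\<phi>u]) simp
  also have "divergence (\<lambda>y. ?\<omega> y *\<^sub>R (M y *\<^sub>R grad ?\<omega> y)) x
      = ?\<omega> x * divergence (\<lambda>y. M y *\<^sub>R grad ?\<omega> y) x + M x * (norm (grad ?\<omega> x))\<^sup>2"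
    by (subst divergence_scaleR[OF \<omega> dMg]) (simp add: power2_norm_eq_inner)
  also have "divergence (\<lambda>y. cross' ops (ub y - (1 / m) *\<^sub>R c y) (?B y)) x
      = ?B x \<bullet> Bt - ub x \<bullet> curl ops ?B x + 1 / m * (sg x * (norm (curl ops ?B x))\<^sup>2)"
  proof -
    interpret b': bounded_bilinear "cross' ops" by (rule cross'_bilinear)
    have "divergence (\<lambda>y. cross' ops (ub y - (1 / m) *\<^sub>R c y) (?B y)) x
        = divergence (\<lambda>y. cross' ops (ub y) (?B y)) x - 1 / m * divergence (\<lambda>y. cross' ops (c y) (?B y)) x"
      by (simp add: b'.diff_left b'.scaleR_left divergence_diff divergence_const_scaleR sc differentiable_cross' dub dc B)
    also have "\<dots> = ?B x \<bullet> (curl' ops ub x - (1 / m) *\<^sub>R curl' ops c x) - (ub x - (1 / m) *\<^sub>R c x) \<bullet> curl ops ?B x"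
      by (simp add: divergence_cross'[OF dub B] divergence_cross'[OF dc B] algebra_simps inner_diff_left inner_diff_right)
    also have "curl' ops ub x - (1 / m) *\<^sub>R curl' ops c x = Bt"
      using E3 by (simp add: algebra_simps)
    finally show ?thesis by (simp add: c_def inner_diff_left power2_norm_eq_inner)
  qed
  finally have div: "divergence (energy_flux ops P U t) x =
      gam P * eps P * (\<phi>t x * laplacian ?\<phi> x + grad \<phi>t x \<bullet> grad ?\<phi> x)
      - ((?u x \<bullet> ?u x) / 2 * (- rho' P * \<phi>t x) + convect (w x) ?u x \<bullet> ?u x)
      + (tensor_divergence A x \<bullet> ?u x + 2 * et x * (norm (sym_grad ?u x))\<^sup>2)
      - grad ?p x \<bullet> ?u x
      - (?\<omega> x * divergence (\<lambda>y. ?\<phi> y *\<^sub>R ?u y) x + ?\<phi> x * (grad ?\<omega> x \<bullet> ?u x))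
      + (?\<omega> x * divergence (\<lambda>y. M y *\<^sub>R grad ?\<omega> y) x + M x * (norm (grad ?\<omega> x))\<^sup>2)
      + 1 / m * (?B x \<bullet> Bt - ub x \<bullet> curl ops ?B x + 1 / m * (sg x * (norm (curl ops ?B x))\<^sup>2))" .
  \<comment> \<open>The power of the Lorentz force is the negative of the term that
    \<open>curl' ops ub\<close> leaves in the divergence of the magnetic flux, up to the common
    factor 1 / m.\<close>
  have lorentz: "cross' ops (curl ops ?B x) (?B x) \<bullet> ?u x = - (ub x \<bullet> curl ops ?B x)"
    unfolding cross'_inner cross_skew[of "?B x" "?u x"] ub_def by (simp add: inner_commute)
  have "(r x *\<^sub>R ut + convect (w x) ?u x - tensor_divergence A x + grad ?p x
      - (1 / m) *\<^sub>R cross' ops (curl ops ?B x) (?B x) + ?\<phi> x *\<^sub>R grad ?\<omega> x) \<bullet> ?u x = 0"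
    by (simp only: E1 inner_zero_left)
  then have mom: "r x * (?u x \<bullet> ut) = - (convect (w x) ?u x \<bullet> ?u x) + tensor_divergence A x \<bullet> ?u x - grad ?p x \<bullet> ?u x
      - 1 / m * (ub x \<bullet> curl ops ?B x) - ?\<phi> x * (grad ?\<omega> x \<bullet> ?u x)"
    by (simp add: inner_add_left inner_diff_left lorentz inner_commute[of ut])
  \<comment> \<open>The product of \<omega> and the time derivative of \<phi> is evaluated twice:
    here by the definition of \<omega>, which yields the potential energy rate and the Laplacian
    part of the interface flux, and in \<open>phs\<close> by the phase equation, which yields
    transport and diffusion.\<close>
  have chem: "?\<omega> x * \<phi>t x = - gam P * eps P * laplacian ?\<phi> x * \<phi>t x + gam P / eps P * f_pot (?\<phi> x) * \<phi>t x"
    by (subst E6) (simp add: algebra_simps)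
  have phs: "?\<omega> x * \<phi>t x = ?\<omega> x * divergence (\<lambda>y. M y *\<^sub>R grad ?\<omega> y) x - ?\<omega> x * divergence (\<lambda>y. ?\<phi> y *\<^sub>R ?u y) x"
  proof -
    have "\<phi>t x = divergence (\<lambda>y. M y *\<^sub>R grad ?\<omega> y) x - divergence (\<lambda>y. ?\<phi> y *\<^sub>R ?u y) x" using E5 by linarith
    then show ?thesis by (simp add: right_diff_distrib)
  qed
  have diss: "dissipation_density ops P U t x = M x * (norm (grad ?\<omega> x))\<^sup>2 + 2 * et x * (norm (sym_grad ?u x))\<^sup>2
     + 1 / m * (1 / m * (sg x * (norm (curl ops ?B x))\<^sup>2))"
    by (simp add: dissipation_density_def M_def et_def sg_def m_def power2_eq_square)
  have folds: "time_deriv (phase U) t x = \<phi>t x" "grad (\<lambda>y. time_deriv (phase U) t y) x = grad \<phi>t x"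
    "rho P (?\<phi> x) = r x"
    by (simp_all add: \<phi>t_def r_def)
  show ?thesis
    unfolding div diss folds
    unfolding ut_def[symmetric] Bt_def[symmetric] m_def[symmetric]
    using mom chem phs
    by (simp add: power2_norm_eq_inner algebra_simps inner_commute[of "grad \<phi>t x"])
qed

section \<open>The energy law\<close>

lemma Basis_cart: "(Basis :: (real^'d::finite) set) = range (\<lambda>i. axis i 1)"
  by (auto simp: Basis_vec_def)

lemma integral_divergence_bounded_convex:
  fixes \<Omega> :: "(real^'d::finite) set"
  assumes dom: "bounded_convex_domain \<Omega>" and G: "C_on 1 (closure \<Omega>) G"
    and bc: "\<And>y n. unit_outer_normal \<Omega> y n \<Longrightarrow> G y \<bullet> n = 0"
  shows "(LINT x:\<Omega>|lborel. divergence G x) = 0"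
proof -
  obtain G' where G': "\<And>x. x \<in> closure \<Omega> \<Longrightarrow> (G has_derivative G' x) (at x within closure \<Omega>)"
    "\<And>v. continuous_on (closure \<Omega>) (\<lambda>x. G' x v)"
    by (rule C_on_1_E[OF G]) (rule that)
  have d: "open \<Omega>" "\<Omega> \<noteq> {}" "bounded \<Omega>" "convex \<Omega>" using dom by (auto simp: bounded_convex_domain_def)
  have at: "(G has_derivative G' x) (at x)" if "x \<in> \<Omega>" for x
  proof -
    have int: "x \<in> interior (closure \<Omega>)" using that d(1) interior_maximal[OF closure_subset d(1)] by blast
    have "x \<in> closure \<Omega>" using that closure_subset by blast
    from G'(1)[OF this] show ?thesis by (simp only: at_within_interior[OF int])
  qed
  interpret convex_divergence \<Omega> G G'
  proof
    show "bounded ((\<lambda>x. G' x v) ` \<Omega>)" for v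
    proof (rule bounded_subset)
      show "bounded ((\<lambda>x. G' x v) ` closure \<Omega>)"
        using d(3) by (intro compact_imp_bounded compact_continuous_image G'(2)) auto
    qed (use closure_subset in blast)
    show "continuous_on \<Omega> (\<lambda>x. G' x v)" for v
      by (rule continuous_on_subset[OF G'(2) closure_subset])
    show "G y \<bullet> n = 0" if "y \<in> frontier \<Omega>" "{m. norm m = 1 \<and> (\<forall>z\<in>\<Omega>. m \<bullet> (z - y) \<le> 0)} = {n}" for y n
      using bc[of y n] that by (simp add: unit_outer_normal_def)
  qed (use d at C_on_continuous_on[OF G] in auto)
  have "divergence G x = (\<Sum>b\<in>Basis. G' x b \<bullet> b)" if "x \<in> \<Omega>" for x
  proof -
    have "inj (\<lambda>i::'d. axis i (1::real))" by (auto simp: inj_on_def axis_eq_axis)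
    then show ?thesis
      by (simp add: divergence_eq[OF at[OF that]] Basis_cart sum.reindex inner_axis)
  qed
  then have "(LINT x:\<Omega>|lborel. divergence G x) = (LINT x:\<Omega>|lborel. (\<Sum>b\<in>Basis. G' x b \<bullet> b))"
    using d(1) by (intro set_lebesgue_integral_cong) auto
  then show ?thesis using integral_divergence_eq_0 by simp
qed

lemma L2_norm_power2: "(L2_norm \<Omega> g)\<^sup>2 = (LINT x:\<Omega>|lborel. (norm (g x))\<^sup>2)"
  unfolding L2_norm_def
  by (rule real_sqrt_pow2) (auto simp: set_lebesgue_integral_def intro!: Bochner_Integration.integral_nonneg)

lemma set_integral_combination:
  fixes f g h :: "'a \<Rightarrow> real"
  assumes "set_integrable M A f" "set_integrable M A g" "set_integrable M A h"
  shows "(LINT x:A|M. a * f x + b * g x + c * h x) = a * (LINT x:A|M. f x) + b * (LINT x:A|M. g x) + c * (LINT x:A|M. h x)"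
proof -
  have i: "set_integrable M A (\<lambda>x. a * f x)" "set_integrable M A (\<lambda>x. b * g x)" "set_integrable M A (\<lambda>x. c * h x)"
    using assms by (auto intro: set_integrable_mult_right)
  show ?thesis
    using set_integral_add(2)[OF set_integral_add(1)[OF i(1,2)] i(3)] set_integral_add(2)[OF i(1,2)] by simp
qed

lemma closed_segment_pos:
  fixes a b s :: real
  assumes "s \<in> closed_segment a b" "a > 0" "b > 0"
  shows "s > 0"
  using assms by (auto simp: closed_segment_eq_real_ivl split: if_splits)

lemma affine_mix_C_on_1 [C1_intros]:
  assumes "C_on 1 S f"
  shows "C_on 1 S (\<lambda>z. affine_mix a b (f z))"
  unfolding affine_mix_def by (intro C1_intros assms)

section \<open>The fields of a solution up to the lateral boundary\<close>

locale CH_MHD = vector_ops ops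
  for ops :: "(real^'d::finite, 'c::euclidean_space) cross_ops" +
  fixes P :: params and T :: real and \<Omega> :: "(real^'d) set" and U :: "(real^'d) state"
  assumes pos: "positive_params P"
    and dom: "bounded_convex_domain \<Omega>"
    and smooth: "smooth_state \<Omega> T U"
    and between: "between_constants P \<Omega> T U"
    and equations: "\<And>t x. t \<in> {0<..<T} \<Longrightarrow> x \<in> \<Omega> \<Longrightarrow> CH_MHD_equations ops P x t U"
    and boundary: "\<And>t. t \<in> {0<..<T} \<Longrightarrow> CH_MHD_boundary ops P \<Omega> t U"
begin

definition S where "S = closure \<Omega> \<times> {0<..<T}"

definition der where "der f z = frechet_derivative f (at z within S)"

definition uf where "uf = (\<lambda>(x, t). vel U t x)"
definition pf where "pf = (\<lambda>(x, t). pres U t x)"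
definition Bf where "Bf = (\<lambda>(x, t). mag U t x)"
definition \<phi>f where "\<phi>f = (\<lambda>(x, t). phase U t x)"
definition \<omega>f where "\<omega>f = (\<lambda>(x, t). chem U t x)"

text \<open>The operators \<open>grad\<close>, \<open>sym_grad\<close>, \<open>curl\<close> use the derivative at the point and say nothing at the
  boundary; the following fields, built from derivatives within \<open>S\<close>, extend them continuously.\<close>

definition dx where "dx f i z = der f z (axis i 1, 0)"
definition dt where "dt f z = der f z (0, 1)"
definition \<phi>x where "\<phi>x z = (\<chi> i. dx \<phi>f i z)"
definition \<omega>x where "\<omega>x z = (\<chi> i. dx \<omega>f i z)"
definition Df where "Df z = (\<chi> i j. (1/2) * (dx uf j z $ i + dx uf i z $ j))"
definition cf where "cf z = (\<Sum>i\<in>UNIV. cross ops (axis i 1) (dx Bf i z))"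

lemma domD: "open \<Omega>" "\<Omega> \<noteq> {}" "bounded \<Omega>" "convex \<Omega>"
  using dom by (auto simp: bounded_convex_domain_def)

text \<open>The time t witnesses that the interval (0,T) is nonempty, since positivity of T is not a
  locale assumption.\<close>

lemma fat_S: "t \<in> {0<..<T} \<Longrightarrow> fat_convex S"
proof -
  assume t: "t \<in> {0<..<T}"
  have "\<Omega> \<times> {0<..<T} \<subseteq> interior S"
    using domD closure_subset[of \<Omega>] by (intro interior_maximal open_Times) (auto simp: S_def)
  moreover have "\<Omega> \<times> {0<..<T} \<noteq> {}" using domD(2) t by auto
  ultimately show "fat_convex S"
    unfolding fat_convex_def using domD by (auto simp: S_def intro!: convex_Times convex_closure)
qed

lemma fat_S': "z \<in> S \<Longrightarrow> fat_convex S"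
  using fat_S by (cases z) (auto simp: S_def)

lemma at_S: "x \<in> \<Omega> \<Longrightarrow> t \<in> {0<..<T} \<Longrightarrow> at (x, t) within S = at (x, t)"
proof (rule at_within_interior)
  assume "x \<in> \<Omega>" "t \<in> {0<..<T}"
  moreover have "\<Omega> \<times> {0<..<T} \<subseteq> interior S"
    using domD closure_subset[of \<Omega>] by (intro interior_maximal open_Times) (auto simp: S_def)
  ultimately show "(x, t) \<in> interior S" by blast
qed

lemma inS: "x \<in> \<Omega> \<Longrightarrow> t \<in> {0<..<T} \<Longrightarrow> (x, t) \<in> S"
  using closure_subset by (auto simp: S_def)

lemma der_within:
  fixes f :: "(real^'d) \<times> real \<Rightarrow> 'b::real_normed_vector"
  assumes "C_on 1 S f" "z \<in> S"
  shows "(f has_derivative der f z) (at z within S)"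
  using C_on_Suc_frechet(1)[OF fat_S'[OF assms(2)] assms(1)[unfolded One_nat_def] assms(2)]
  by (simp add: der_def)

lemma der_at:
  fixes f :: "(real^'d) \<times> real \<Rightarrow> 'b::real_normed_vector"
  assumes "C_on 1 S f" "x \<in> \<Omega>" "t \<in> {0<..<T}"
  shows "(f has_derivative der f (x, t)) (at (x, t))"
  using der_within[OF assms(1) inS[OF assms(2,3)]] at_S[OF assms(2,3)] by simp

lemma C_on_der:
  fixes f :: "(real^'d) \<times> real \<Rightarrow> 'b::real_normed_vector"
  shows "C_on (Suc k) S f \<Longrightarrow> C_on k S (\<lambda>z. der f z v)"
proof (cases "S = {}")
  case False
  then obtain z where "z \<in> S" by blast
  assume "C_on (Suc k) S f"
  from C_on_Suc_frechet(2)[OF fat_S'[OF \<open>z \<in> S\<close>] this] show ?thesis by (simp add: der_def)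
next
  case True
  have "C_on k {} g" for g :: "(real^'d) \<times> real \<Rightarrow> 'b"
    by (induction k arbitrary: g) auto
  then show ?thesis using True by simp
qed

lemma space_derivative_within:
  fixes f :: "(real^'d) \<times> real \<Rightarrow> 'b::real_normed_vector"
  assumes "C_on 1 S f" "x \<in> closure \<Omega>" "t \<in> {0<..<T}"
  shows "((\<lambda>y. f (y, t)) has_derivative (\<lambda>v. der f (x, t) (v, 0))) (at x within closure \<Omega>)"
proof -
  have z: "(x, t) \<in> S" using assms by (simp add: S_def)
  have p: "((\<lambda>y. (y, t)) has_derivative (\<lambda>v. (v, 0))) (at x within closure \<Omega>)"
    by (auto intro!: derivative_eq_intros)
  show ?thesis
    by (rule has_derivative_in_compose[OF p has_derivative_subset[OF der_within[OF assms(1) z]]])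
       (use assms(3) in \<open>auto simp: S_def\<close>)
qed

lemma space_derivative:
  fixes f :: "(real^'d) \<times> real \<Rightarrow> 'b::real_normed_vector"
  assumes "C_on 1 S f" "x \<in> \<Omega>" "t \<in> {0<..<T}"
  shows "((\<lambda>y. f (y, t)) has_derivative (\<lambda>v. der f (x, t) (v, 0))) (at x)"
proof -
  have p: "((\<lambda>y. (y, t)) has_derivative (\<lambda>v. (v, 0))) (at x)"
    by (auto intro!: derivative_eq_intros)
  show ?thesis by (rule has_derivative_compose[OF p der_at[OF assms]])
qed

lemma space_partial:
  fixes f :: "(real^'d) \<times> real \<Rightarrow> 'b::real_normed_vector"
  assumes "C_on 1 S f" "x \<in> \<Omega>" "t \<in> {0<..<T}"
  shows "partial i (\<lambda>y. f (y, t)) x = dx f i (x, t)"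
  by (simp add: partial_eq[OF space_derivative[OF assms]] dx_def)

lemma space_differentiable:
  fixes f :: "(real^'d) \<times> real \<Rightarrow> 'b::real_normed_vector"
  assumes "C_on 1 S f" "x \<in> \<Omega>" "t \<in> {0<..<T}" "\<And>y. y \<in> \<Omega> \<Longrightarrow> g y = f (y, t)"
  shows "g differentiable (at x)"
proof -
  have "(g has_derivative (\<lambda>v. der f (x, t) (v, 0))) (at x)"
    by (rule has_derivative_transform_within_open[OF space_derivative[OF assms(1-3)] domD(1) assms(2)])
       (simp add: assms(4))
  then show ?thesis by (auto simp: differentiable_def)
qed

lemma time_derivative:
  fixes f :: "(real^'d) \<times> real \<Rightarrow> 'b::real_normed_vector"
  assumes "C_on 1 S f" "x \<in> \<Omega>" "t \<in> {0<..<T}"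
  shows "((\<lambda>s. f (x, s)) has_vector_derivative dt f (x, t)) (at t)"
proof -
  have p: "((\<lambda>s. (x, s)) has_derivative (\<lambda>r. (0, r))) (at t)"
    by (auto intro!: derivative_eq_intros)
  have d: "((\<lambda>s. f (x, s)) has_derivative (\<lambda>r. der f (x, t) (0, r))) (at t)"
    by (rule has_derivative_compose[OF p der_at[OF assms]])
  have "der f (x, t) (0, r) = r *\<^sub>R dt f (x, t)" for r
    using linear_scale[OF has_derivative_linear[OF der_at[OF assms]], of r "(0, 1)"] by (simp add: dt_def)
  then show ?thesis using d by (simp add: has_vector_derivative_def)
qed

lemma fields_C2: "C_on 2 S uf" "C_on 2 S Bf" "C_on 2 S \<phi>f" "C_on 2 S \<omega>f"
  and pf_C1: "C_on 1 S pf"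
  using smooth by (simp_all add: smooth_state_def Let_def S_def uf_def Bf_def \<phi>f_def \<omega>f_def pf_def)

lemmas fields_C1 = fields_C2[THEN C_on_2_imp_1] pf_C1

lemma dx_C1: "C_on 2 S f \<Longrightarrow> C_on 1 S (dx f i)"
  and dt_C1: "C_on 2 S f \<Longrightarrow> C_on 1 S (dt f)"
  using C_on_der[of 1 f] by (simp_all add: numeral_2_eq_2 dx_def[abs_def] dt_def[abs_def])

lemma derived_C1: "C_on 1 S \<phi>x" "C_on 1 S \<omega>x" "C_on 1 S Df" "C_on 1 S cf"
  unfolding \<phi>x_def[abs_def] \<omega>x_def[abs_def] Df_def[abs_def] cf_def[abs_def]
  by (intro C1_intros C_on_1_bilinear[OF cross_bilinear] dx_C1 fields_C2)+

lemma grad_phase: "x \<in> \<Omega> \<Longrightarrow> t \<in> {0<..<T} \<Longrightarrow> grad (phase U t) x = \<phi>x (x, t)"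
  using space_partial[OF fields_C1(3)] by (simp add: grad_def \<phi>x_def \<phi>f_def)

lemma grad_chem: "x \<in> \<Omega> \<Longrightarrow> t \<in> {0<..<T} \<Longrightarrow> grad (chem U t) x = \<omega>x (x, t)"
  using space_partial[OF fields_C1(4)] by (simp add: grad_def \<omega>x_def \<omega>f_def)

lemma differentiable_fields:
  assumes "x \<in> \<Omega>" "t \<in> {0<..<T}"
  shows "vel U t differentiable (at x)" "mag U t differentiable (at x)" "phase U t differentiable (at x)"
    "chem U t differentiable (at x)" "pres U t differentiable (at x)"
  by (rule space_differentiable[OF fields_C1(1) assms] space_differentiable[OF fields_C1(2) assms]
      space_differentiable[OF fields_C1(3) assms] space_differentiable[OF fields_C1(4) assms]
      space_differentiable[OF fields_C1(5) assms];
      simp add: uf_def Bf_def \<phi>f_def \<omega>f_def pf_def)+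

lemma sym_grad_vel:
  assumes "x \<in> \<Omega>" "t \<in> {0<..<T}" shows "sym_grad (vel U t) x = Df (x, t)"
proof -
  have "frechet_derivative (vel U t) (at x) (axis i 1) = dx uf i (x, t)" for i
    using space_partial[OF fields_C1(1) assms, of i] by (simp add: uf_def partial_def)
  then show ?thesis
    by (simp add: sym_grad_def Df_def jacobian_def matrix_def transpose_def vec_eq_iff)
qed

lemma curl_mag:
  assumes "x \<in> \<Omega>" "t \<in> {0<..<T}" shows "curl ops (mag U t) x = cf (x, t)"
  using space_partial[OF fields_C1(2) assms] curl_cross[OF differentiable_fields(2)[OF assms]]
  by (simp add: Bf_def cf_def)

lemma time_deriv_fields:
  assumes "x \<in> \<Omega>" "t \<in> {0<..<T}"
  shows "time_deriv (vel U) t x = dt uf (x, t)" "time_deriv (mag U) t x = dt Bf (x, t)"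
    "time_deriv (phase U) t x = dt \<phi>f (x, t)"
  using time_derivative[OF fields_C1(1) assms] time_derivative[OF fields_C1(2) assms]
    time_derivative[OF fields_C1(3) assms]
  by (simp_all add: uf_def Bf_def \<phi>f_def vector_derivative_at)

text \<open>The bounds are given in the open domain; a closed segment and continuity extend them to
  the closure, where the flux must divide by the conductivity.\<close>

lemma sigma_pos_closure:
  assumes "x \<in> closure \<Omega>" "t \<in> {0<..<T}"
  shows "sigma P (phase U t x) > 0"
proof -
  have c: "continuous_on (closure \<Omega>) (\<lambda>y. sigma P (\<phi>f (y, t)))"
    unfolding sigma_def
    by (intro C_on_continuous_on[of 1] C_on_1_slice[where I="{0<..<T}" and f="\<lambda>z. affine_mix _ _ (\<phi>f z)"] C1_intros)
       (use fields_C1(3) assms(2) in \<open>auto simp: S_def simp del: C_on.simps One_nat_def\<close>)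
  have "(\<lambda>y. sigma P (\<phi>f (y, t))) ` closure \<Omega> \<subseteq> closed_segment (sigma1 P) (sigma2 P)"
    by (rule image_closure_subset[OF c])
       (use between assms(2) in \<open>auto simp: between_constants_def Let_def \<phi>f_def\<close>)
  then have "sigma P (phase U t x) \<in> closed_segment (sigma1 P) (sigma2 P)"
    using assms(1) by (auto simp: \<phi>f_def)
  then show ?thesis
    using pos by (auto simp: positive_params_def intro: closed_segment_pos)
qed

lemma sigma_neq_0: "z \<in> S \<Longrightarrow> sigma P (\<phi>f z) \<noteq> 0"
  using sigma_pos_closure by (cases z) (force simp: S_def \<phi>f_def)

lemma coefficients_pos:
  assumes "x \<in> \<Omega>" "t \<in> {0<..<T}"
  shows "Mob P (phase U t x) > 0" "eta P (phase U t x) > 0" "sigma P (phase U t x) > 0"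
proof -
  have "Mob P (phase U t x) \<in> closed_segment (M1 P) (M2 P)" "eta P (phase U t x) \<in> closed_segment (eta1 P) (eta2 P)"
    "sigma P (phase U t x) \<in> closed_segment (sigma1 P) (sigma2 P)"
    using between assms by (auto simp: between_constants_def Let_def)
  then show "Mob P (phase U t x) > 0" "eta P (phase U t x) > 0" "sigma P (phase U t x) > 0"
    using pos by (auto simp: positive_params_def intro: closed_segment_pos)
qed

section \<open>The flux and its boundary values\<close>

text \<open>The counterpart of \<open>energy_flux\<close> made from derivatives within
  \<open>S\<close>: equal to it in \<Omega>, but meaningful and C^1 up to the boundary. Divisions
  are written with \<open>inverse\<close> or constant factors to suit
  \<open>C1_intros\<close>.\<close>

definition flux where
  "flux z = (gam P * eps P * dt \<phi>f z) *\<^sub>R \<phi>x z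
     - ((1/2) * (uf z \<bullet> uf z)) *\<^sub>R (rho P (\<phi>f z) *\<^sub>R uf z - (rho' P * Mob P (\<phi>f z)) *\<^sub>R \<omega>x z)
     + (\<Sum>i\<in>UNIV. (uf z $ i) *\<^sub>R ((2 * eta P (\<phi>f z)) *\<^sub>R Df z) $ i)
     - pf z *\<^sub>R uf z - \<omega>f z *\<^sub>R \<phi>f z *\<^sub>R uf z + \<omega>f z *\<^sub>R Mob P (\<phi>f z) *\<^sub>R \<omega>x z
     + (1 / mu P) *\<^sub>R cross' ops (cross ops (uf z) (Bf z) - (1 / mu P) *\<^sub>R inverse (sigma P (\<phi>f z)) *\<^sub>R cf z) (Bf z)"

lemma flux_C1: "C_on 1 S flux"
  using sigma_neq_0
  unfolding flux_def[abs_def] rho_def Mob_def eta_def sigma_def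
  by (intro C1_intros C_on_1_bilinear[OF cross_bilinear] C_on_1_bilinear[OF cross'_bilinear]
      dt_C1 fields_C1 fields_C2 derived_C1)

lemma energy_flux_eq:
  assumes "x \<in> \<Omega>" "t \<in> {0<..<T}"
  shows "energy_flux ops P U t x = flux (x, t)"
  by (simp add: energy_flux_def Let_def flux_def grad_phase[OF assms] grad_chem[OF assms] sym_grad_vel[OF assms]
      curl_mag[OF assms] time_deriv_fields[OF assms] uf_def Bf_def \<phi>f_def \<omega>f_def pf_def inverse_eq_divide)

text \<open>\<open>normal_deriv\<close> picks a derivative within the closure of \<Omega>;
  uniqueness identifies it with \<open>der\<close> restricted to space directions.\<close>

lemma inner_normal:
  fixes f :: "(real^'d) \<times> real \<Rightarrow> real"
  assumes f: "C_on 1 S f" and "x \<in> closure \<Omega>" "t \<in> {0<..<T}"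
  shows "(\<chi> i. dx f i (x, t)) \<bullet> n = normal_deriv \<Omega> n (\<lambda>y. f (y, t)) x"
proof -
  have fat: "fat_convex (closure \<Omega>)" using fat_convex_closure domD by blast
  note d = space_derivative_within[OF assms]
  interpret bounded_linear "\<lambda>v. der f (x, t) (v, 0)" using d by (rule has_derivative_bounded_linear)
  have "normal_deriv \<Omega> n (\<lambda>y. f (y, t)) x = der f (x, t) (n, 0)"
    unfolding normal_deriv_def by (simp add: fat_convex_frechet[OF fat assms(2) d])
  also have "\<dots> = der f (x, t) ((\<Sum>i\<in>UNIV. (n $ i) *\<^sub>R axis i 1), 0)"
    by (simp add: basis_expansion scalar_mult_eq_scaleR[symmetric])
  also have "\<dots> = (\<Sum>i\<in>UNIV. (n $ i) * der f (x, t) (axis i 1, 0))"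
    by (simp add: sum scaleR)
  finally show ?thesis by (simp add: dx_def inner_vec_def mult.commute)
qed

text \<open>Every term containing u vanishes by no-slip. The interface and diffusion terms vanish by
  the Neumann conditions, and the remaining magnetic term is a triple product that can be cycled to
  contain B \<times> n.\<close>

lemma flux_normal:
  assumes n: "unit_outer_normal \<Omega> x n" and t: "t \<in> {0<..<T}"
  shows "flux (x, t) \<bullet> n = 0"
proof -
  interpret b: bounded_bilinear "cross ops" by (rule cross_bilinear)
  have fr: "x \<in> frontier \<Omega>" and cl: "x \<in> closure \<Omega>" using n by (auto simp: unit_outer_normal_def frontier_def)
  note bd = boundary[OF t, unfolded CH_MHD_boundary_def]
  have u0: "uf (x, t) = 0" using bd fr by (simp add: uf_def)
  have B0: "cross ops (Bf (x, t)) n = 0" using bd n by (simp add: Bf_def)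
  have p0: "\<phi>x (x, t) \<bullet> n = 0"
    using inner_normal[OF fields_C1(3) cl t, of n] bd n by (simp add: \<phi>x_def \<phi>f_def)
  have w0: "Mob P (\<phi>f (x, t)) * (\<omega>x (x, t) \<bullet> n) = 0"
    using inner_normal[OF fields_C1(4) cl t, of n] bd n by (simp add: \<omega>x_def \<phi>f_def \<omega>f_def)
  show ?thesis
    by (simp only: flux_def u0) (use B0 p0 w0 in \<open>simp add: inner_add_left inner_diff_left cross'_inner\<close>)
qed

section \<open>Energy and dissipation as integrals of densities\<close>

definition edens where
  "edens z = gam P * (eps P / 2 * (\<phi>x z \<bullet> \<phi>x z) + 1 / eps P * F_pot (\<phi>f z))
     + 1/2 * (rho P (\<phi>f z) * (uf z \<bullet> uf z)) + 1/2 * (1 / mu P * (Bf z \<bullet> Bf z))"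

definition ddens where
  "ddens z = Mob P (\<phi>f z) * (\<omega>x z \<bullet> \<omega>x z) + 2 * (eta P (\<phi>f z) * (Df z \<bullet> Df z))
     + 1 / (mu P)\<^sup>2 * (inverse (sigma P (\<phi>f z)) * (cf z \<bullet> cf z))"

lemma F_pot_C1 [C1_intros]: "C_on 1 A f \<Longrightarrow> C_on 1 A (\<lambda>z. F_pot (f z))"
  unfolding F_pot_def power2_eq_square by (intro C1_intros)

lemma edens_C1: "C_on 1 S edens"
  unfolding edens_def[abs_def] rho_def by (intro C1_intros fields_C1 derived_C1)

lemma ddens_C1: "C_on 1 S ddens"
  using sigma_neq_0
  unfolding ddens_def[abs_def] Mob_def eta_def sigma_def by (intro C1_intros fields_C1 derived_C1)

lemma dissipation_density_eq:
  assumes "x \<in> \<Omega>" "t \<in> {0<..<T}"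
  shows "dissipation_density ops P U t x = ddens (x, t)"
  by (simp add: dissipation_density_def ddens_def grad_chem[OF assms] sym_grad_vel[OF assms] curl_mag[OF assms]
      \<phi>f_def power2_norm_eq_inner inverse_eq_divide)

lemma slice_integrable:
  fixes f :: "(real^'d) \<times> real \<Rightarrow> real"
  assumes "continuous_on S f" "t \<in> {0<..<T}"
  shows "set_integrable lborel \<Omega> (\<lambda>x. f (x, t))"
  by (rule continuous_on_closure_set_integrable[OF domD(1,3) continuous_on_compose2[OF assms(1)]])
     (use assms(2) in \<open>auto simp: S_def intro!: continuous_intros\<close>)

lemma slice_integrable_C1:
  fixes f :: "(real^'d) \<times> real \<Rightarrow> real"
  shows "C_on 1 S f \<Longrightarrow> t \<in> {0<..<T} \<Longrightarrow> set_integrable lborel \<Omega> (\<lambda>x. f (x, t))"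
  by (rule slice_integrable[OF C_on_continuous_on])

lemma set_integral_cong:
  fixes f g :: "real^'d \<Rightarrow> real"
  shows "(\<And>x. x \<in> \<Omega> \<Longrightarrow> f x = g x) \<Longrightarrow> (LINT x:\<Omega>|lborel. f x) = (LINT x:\<Omega>|lborel. g x)"
  using domD(1) by (intro set_lebesgue_integral_cong) auto

lemma energy_eq:
  assumes t: "t \<in> {0<..<T}"
  shows "energy P \<Omega> U t = (LINT x:\<Omega>|lborel. edens (x, t))"
proof -
  let ?a = "\<lambda>z. eps P / 2 * (\<phi>x z \<bullet> \<phi>x z) + 1 / eps P * F_pot (\<phi>f z)"
  let ?b = "\<lambda>z. rho P (\<phi>f z) * (uf z \<bullet> uf z)" and ?c = "\<lambda>z. 1 / mu P * (Bf z \<bullet> Bf z)"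
  have "C_on 1 S ?a" "C_on 1 S ?b" "C_on 1 S ?c"
    unfolding rho_def by (intro C1_intros fields_C1 derived_C1)+
  then have i: "set_integrable lborel \<Omega> (\<lambda>x. ?a (x, t))" "set_integrable lborel \<Omega> (\<lambda>x. ?b (x, t))"
    "set_integrable lborel \<Omega> (\<lambda>x. ?c (x, t))"
    using slice_integrable_C1 t by (blast+)
  have "(LINT x:\<Omega>|lborel. edens (x, t)) = gam P * (LINT x:\<Omega>|lborel. ?a (x, t))
     + 1/2 * (LINT x:\<Omega>|lborel. ?b (x, t)) + 1/2 * (LINT x:\<Omega>|lborel. ?c (x, t))"
    unfolding edens_def by (rule set_integral_combination[OF i])
  moreover have "(LINT x:\<Omega>|lborel. eps P / 2 * (norm (grad (phase U t) x))\<^sup>2 + 1 / eps P * F_pot (phase U t x))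
     = (LINT x:\<Omega>|lborel. ?a (x, t))"
    by (rule set_integral_cong) (simp add: grad_phase[OF _ t] \<phi>f_def power2_norm_eq_inner)
  moreover have "(LINT x:\<Omega>|lborel. rho P (phase U t x) * (norm (vel U t x))\<^sup>2) = (LINT x:\<Omega>|lborel. ?b (x, t))"
    by (rule set_integral_cong) (simp add: \<phi>f_def uf_def power2_norm_eq_inner)
  moreover have "(LINT x:\<Omega>|lborel. (norm (mag U t x))\<^sup>2 / mu P) = (LINT x:\<Omega>|lborel. ?c (x, t))"
    by (rule set_integral_cong) (simp add: Bf_def power2_norm_eq_inner)
  ultimately show ?thesis by (simp add: energy_def)
qed

lemma dissipation_eq:
  assumes t: "t \<in> {0<..<T}"
  shows "dissipation ops P \<Omega> U t = (LINT x:\<Omega>|lborel. ddens (x, t))"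
proof -
  let ?a = "\<lambda>z. Mob P (\<phi>f z) * (\<omega>x z \<bullet> \<omega>x z)" and ?b = "\<lambda>z. eta P (\<phi>f z) * (Df z \<bullet> Df z)"
    and ?c = "\<lambda>z. inverse (sigma P (\<phi>f z)) * (cf z \<bullet> cf z)"
  have "C_on 1 S ?a" "C_on 1 S ?b" "C_on 1 S ?c"
    using sigma_neq_0 unfolding Mob_def eta_def sigma_def by (intro C1_intros fields_C1 derived_C1; assumption)+
  then have i: "set_integrable lborel \<Omega> (\<lambda>x. ?a (x, t))" "set_integrable lborel \<Omega> (\<lambda>x. ?b (x, t))"
    "set_integrable lborel \<Omega> (\<lambda>x. ?c (x, t))"
    using slice_integrable_C1 t by (blast+)
  have "(LINT x:\<Omega>|lborel. ddens (x, t)) = (LINT x:\<Omega>|lborel. ?a (x, t))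
     + 2 * (LINT x:\<Omega>|lborel. ?b (x, t)) + 1 / (mu P)\<^sup>2 * (LINT x:\<Omega>|lborel. ?c (x, t))"
    using set_integral_combination[OF i, of 1 2 "1 / (mu P)\<^sup>2"] by (simp only: ddens_def mult_1)
  moreover have "(LINT x:\<Omega>|lborel. (norm (sqrt (Mob P (phase U t x)) *\<^sub>R grad (chem U t) x))\<^sup>2) = (LINT x:\<Omega>|lborel. ?a (x, t))"
    by (rule set_integral_cong)
       (use t coefficients_pos in \<open>simp add: grad_chem power_mult_distrib \<phi>f_def power2_norm_eq_inner less_imp_le\<close>)
  moreover have "(LINT x:\<Omega>|lborel. (norm (sqrt (eta P (phase U t x)) *\<^sub>R sym_grad (vel U t) x))\<^sup>2) = (LINT x:\<Omega>|lborel. ?b (x, t))"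
    by (rule set_integral_cong)
       (use t coefficients_pos in \<open>simp add: sym_grad_vel power_mult_distrib \<phi>f_def power2_norm_eq_inner less_imp_le\<close>)
  moreover have "(LINT x:\<Omega>|lborel. (norm ((1 / sqrt (sigma P (phase U t x))) *\<^sub>R curl ops (mag U t) x))\<^sup>2) = (LINT x:\<Omega>|lborel. ?c (x, t))"
    by (rule set_integral_cong)
       (use t coefficients_pos in \<open>simp add: curl_mag power_mult_distrib power_divide \<phi>f_def power2_norm_eq_inner less_imp_le inverse_eq_divide\<close>)
  ultimately show ?thesis by (simp add: dissipation_def L2_norm_power2)
qed

text \<open>Second derivatives of the phase commute in the open cylinder. Taken in the directions
  \<open>(axis i 1, 0)\<close> and \<open>(0, 1)\<close>, this exchanges the time derivative with
  the gradient.\<close>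

lemma time_derivative_grad_phase:
  assumes x: "x \<in> \<Omega>" and t: "t \<in> {0<..<T}"
  shows "((\<lambda>s. \<phi>x (x, s) \<bullet> \<phi>x (x, s)) has_real_derivative
    2 * (grad (phase U t) x \<bullet> grad (\<lambda>y. time_deriv (phase U) t y) x)) (at t)"
proof -
  let ?W = "\<Omega> \<times> {0<..<T}"
  have C1: "C_on 1 S (\<lambda>z. der \<phi>f z v)" for v
    using C_on_der[of 1 \<phi>f v] fields_C2(3) by (simp add: numeral_2_eq_2)
  have "C_on 0 S (\<lambda>z. der (\<lambda>z. der \<phi>f z v) z w)" for v w
    using C_on_der[of 0 "\<lambda>z. der \<phi>f z v" w] C1[of v] by (simp only: One_nat_def)
  then have cS: "continuous_on S (\<lambda>z. der (\<lambda>z. der \<phi>f z v) z w)" for v w by simp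
  have "?W \<subseteq> S" using closure_subset by (auto simp: S_def)
  then have cont: "continuous_on ?W (\<lambda>z. der (\<lambda>z. der \<phi>f z v) z w)" for v w
    by (rule continuous_on_subset[OF cS])
  have sym: "der (\<lambda>z. der \<phi>f z v) (x, t) w = der (\<lambda>z. der \<phi>f z w) (x, t) v" for v w
    by (rule mixed_partials_symmetric[where W="?W" and f=\<phi>f and f'="der \<phi>f" and f''="\<lambda>v. der (\<lambda>z. der \<phi>f z v)"])
       (use x t domD(1) cont der_at[OF fields_C1(3)] der_at[OF C1] in \<open>auto intro: open_Times\<close>)
  have "dt (dx \<phi>f i) (x, t) = grad (\<lambda>y. time_deriv (phase U) t y) x $ i" for i
  proof -
    have "((\<lambda>y. time_deriv (phase U) t y) has_derivative (\<lambda>v. der (dt \<phi>f) (x, t) (v, 0))) (at x)"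
      by (rule has_derivative_transform_within_open[OF space_derivative[OF dt_C1[OF fields_C2(3)] x t] domD(1) x])
         (simp add: time_deriv_fields[OF _ t])
    then have "grad (\<lambda>y. time_deriv (phase U) t y) x $ i = der (dt \<phi>f) (x, t) (axis i 1, 0)"
      by (simp add: grad_def partial_eq)
    then show ?thesis
      using sym[of "(axis i 1, 0)" "(0, 1)"] by (simp add: dt_def[abs_def] dx_def[abs_def])
  qed
  moreover have "((\<lambda>s. dx \<phi>f i (x, s)) has_real_derivative dt (dx \<phi>f i) (x, t)) (at t)" for i
    using time_derivative[OF dx_C1[OF fields_C2(3)] x t]
    by (simp add: has_real_derivative_iff_has_vector_derivative)
  ultimately have d: "((\<lambda>s. dx \<phi>f i (x, s)) has_real_derivative grad (\<lambda>y. time_deriv (phase U) t y) x $ i) (at t)" for i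
    by simp
  have "((\<lambda>s. \<Sum>i\<in>UNIV. dx \<phi>f i (x, s) * dx \<phi>f i (x, s)) has_real_derivative
      (\<Sum>i\<in>UNIV. 2 * (dx \<phi>f i (x, t) * grad (\<lambda>y. time_deriv (phase U) t y) x $ i))) (at t)"
    by (intro DERIV_sum) (auto intro!: derivative_eq_intros d)
  then show ?thesis
    by (simp add: grad_phase[OF x t] \<phi>x_def inner_vec_def sum_distrib_left)
qed

lemma local_energy_rate:
  assumes x: "x \<in> \<Omega>" and t: "t \<in> {0<..<T}"
  shows "dt edens (x, t) = divergence (\<lambda>y. flux (y, t)) x - ddens (x, t)"
proof -
  let ?\<phi>t = "time_deriv (phase U) t x"
  have v: "((\<lambda>s. uf (x, s)) has_vector_derivative time_deriv (vel U) t x) (at t)"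
    "((\<lambda>s. Bf (x, s)) has_vector_derivative time_deriv (mag U) t x) (at t)"
    and p: "((\<lambda>s. \<phi>f (x, s)) has_real_derivative ?\<phi>t) (at t)"
    using time_derivative[OF fields_C1(1) x t] time_derivative[OF fields_C1(2) x t] time_derivative[OF fields_C1(3) x t]
    by (simp_all add: time_deriv_fields[OF x t] has_real_derivative_iff_has_vector_derivative)
  have sq: "((\<lambda>s. f s \<bullet> f s) has_real_derivative 2 * (f t \<bullet> f')) (at t)"
    if "(f has_vector_derivative f') (at t)" for f :: "real \<Rightarrow> real^'d" and f'
    using that unfolding has_vector_derivative_def has_field_derivative_def
    by (auto intro!: derivative_eq_intros simp: inner_commute fun_eq_iff algebra_simps)
  have F: "((\<lambda>s. F_pot (\<phi>f (x, s))) has_real_derivative f_pot (phase U t x) * ?\<phi>t) (at t)"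
    by (rule DERIV_cong[OF DERIV_chain2[OF F_pot_deriv p]]) (simp add: \<phi>f_def)
  have r: "((\<lambda>s. rho P (\<phi>f (x, s))) has_real_derivative rho' P * ?\<phi>t) (at t)"
    unfolding rho_def affine_mix_def rho'_def by (auto intro!: derivative_eq_intros p)
  have "((\<lambda>s. edens (x, s)) has_real_derivative
      gam P * (eps P / 2 * (2 * (grad (phase U t) x \<bullet> grad (\<lambda>y. time_deriv (phase U) t y) x))
        + 1 / eps P * (f_pot (phase U t x) * ?\<phi>t))
      + 1/2 * (rho' P * ?\<phi>t * (vel U t x \<bullet> vel U t x)
        + rho P (phase U t x) * (2 * (vel U t x \<bullet> time_deriv (vel U) t x)))
      + 1/2 * (1 / mu P * (2 * (mag U t x \<bullet> time_deriv (mag U) t x)))) (at t)"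
    unfolding edens_def
    by (rule DERIV_cong[OF DERIV_add[OF DERIV_add[OF
          DERIV_cmult[OF DERIV_add[OF DERIV_cmult[OF time_derivative_grad_phase[OF x t]] DERIV_cmult[OF F]]]
          DERIV_cmult[OF DERIV_mult[OF r sq[OF v(1)]]]]
          DERIV_cmult[OF DERIV_cmult[OF sq[OF v(2)]]]]])
       (simp add: uf_def Bf_def \<phi>f_def)
  moreover have "((\<lambda>s. edens (x, s)) has_real_derivative dt edens (x, t)) (at t)"
    using time_derivative[OF edens_C1 x t] by (simp add: has_real_derivative_iff_has_vector_derivative)
  ultimately have rate: "dt edens (x, t) =
      gam P * (eps P / 2 * (2 * (grad (phase U t) x \<bullet> grad (\<lambda>y. time_deriv (phase U) t y) x))
        + 1 / eps P * (f_pot (phase U t x) * ?\<phi>t))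
      + 1/2 * (rho' P * ?\<phi>t * (vel U t x \<bullet> vel U t x)
        + rho P (phase U t x) * (2 * (vel U t x \<bullet> time_deriv (vel U) t x)))
      + 1/2 * (1 / mu P * (2 * (mag U t x \<bullet> time_deriv (mag U) t x)))"
    by (metis DERIV_unique)
  have "gam P * eps P * (grad (phase U t) x \<bullet> grad (\<lambda>y. time_deriv (phase U) t y) x)
      + gam P / eps P * f_pot (phase U t x) * ?\<phi>t
      + 1/2 * rho' P * ?\<phi>t * (norm (vel U t x))\<^sup>2
      + rho P (phase U t x) * (vel U t x \<bullet> time_deriv (vel U) t x)
      + 1 / mu P * (mag U t x \<bullet> time_deriv (mag U) t x)
    = divergence (energy_flux ops P U t) x - dissipation_density ops P U t x"
  proof (rule local_energy_balance)
    show "CH_MHD_equations ops P x t U" by (rule equations[OF t x])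
    show "mu P \<noteq> 0" "eps P \<noteq> 0" using pos by (auto simp: positive_params_def)
    show "sigma P (phase U t x) \<noteq> 0" using coefficients_pos[OF x t] by simp
    show "(\<lambda>y. time_deriv (phase U) t y) differentiable (at x)"
      by (rule space_differentiable[OF dt_C1[OF fields_C2(3)] x t]) (simp add: time_deriv_fields[OF _ t])
    show "grad (phase U t) differentiable (at x)"
      by (rule space_differentiable[OF derived_C1(1) x t]) (simp add: grad_phase[OF _ t])
    show "grad (chem U t) differentiable (at x)"
      by (rule space_differentiable[OF derived_C1(2) x t]) (simp add: grad_chem[OF _ t])
    show "sym_grad (vel U t) differentiable (at x)"
      by (rule space_differentiable[OF derived_C1(3) x t]) (simp add: sym_grad_vel[OF _ t])
    show "curl ops (mag U t) differentiable (at x)"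
      by (rule space_differentiable[OF derived_C1(4) x t]) (simp add: curl_mag[OF _ t])
  qed (rule differentiable_fields[OF x t])+
  moreover have "divergence (energy_flux ops P U t) x = divergence (\<lambda>y. flux (y, t)) x"
  proof -
    have "(energy_flux ops P U t has_derivative (\<lambda>v. der flux (x, t) (v, 0))) (at x)"
      by (rule has_derivative_transform_within_open[OF space_derivative[OF flux_C1 x t] domD(1) x])
         (simp add: energy_flux_eq[OF _ t])
    then show ?thesis using space_derivative[OF flux_C1 x t] by (simp add: divergence_eq)
  qed
  ultimately show ?thesis
    unfolding rate dissipation_density_eq[OF x t] by (simp add: power2_norm_eq_inner algebra_simps)
qed

text \<open>Differentiating under the integral and integrating the local rate over \<Omega> leaves
  only the dissipation, since the flux has no normal component.\<close>

theorem energy_law: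
  assumes t: "t \<in> {0<..<T}"
  shows "(energy P \<Omega> U has_real_derivative - dissipation ops P \<Omega> U t) (at t)"
proof -
  have ct: "continuous_on S (dt edens)"
    using C_on_der[of 0 edens "(0, 1)"] edens_C1 by (simp add: dt_def[abs_def])
  have "((\<lambda>s. LINT x:\<Omega>|lborel. edens (x, s)) has_real_derivative (LINT x:\<Omega>|lborel. dt edens (x, t))) (at t)"
  proof (rule has_real_derivative_integral[where I="{0<..<T}"])
    show "continuous_on (closure \<Omega> \<times> {0<..<T}) edens" "continuous_on (closure \<Omega> \<times> {0<..<T}) (dt edens)"
      using C_on_continuous_on[OF edens_C1] ct by (simp_all add: S_def)
    show "((\<lambda>s. edens (x, s)) has_real_derivative dt edens (x, s)) (at s)" if "x \<in> \<Omega>" "s \<in> {0<..<T}" for x s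
      using time_derivative[OF edens_C1 that] by (simp add: has_real_derivative_iff_has_vector_derivative)
  qed (use domD t in auto)
  moreover have "(LINT x:\<Omega>|lborel. dt edens (x, t)) = - dissipation ops P \<Omega> U t"
  proof -
    have "0 = (LINT x:\<Omega>|lborel. divergence (\<lambda>y. flux (y, t)) x)"
    proof (rule integral_divergence_bounded_convex[OF dom, symmetric])
      show "C_on 1 (closure \<Omega>) (\<lambda>y. flux (y, t))"
        by (rule C_on_1_slice[OF flux_C1[unfolded S_def] t])
    qed (rule flux_normal[OF _ t])
    also have "\<dots> = (LINT x:\<Omega>|lborel. dt edens (x, t) + ddens (x, t))"
      by (rule set_integral_cong) (simp add: local_energy_rate[OF _ t])
    also have "\<dots> = (LINT x:\<Omega>|lborel. dt edens (x, t)) + (LINT x:\<Omega>|lborel. ddens (x, t))"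
      by (rule set_integral_add(2)[OF slice_integrable[OF ct t] slice_integrable_C1[OF ddens_C1 t]])
    finally show ?thesis by (simp add: dissipation_eq[OF t])
  qed
  ultimately have d: "((\<lambda>s. LINT x:\<Omega>|lborel. edens (x, s)) has_real_derivative - dissipation ops P \<Omega> U t) (at t)"
    by simp
  show ?thesis
    \<comment> \<open>The energy is the integral of \<open>edens\<close> only for times in (0,T), an
      open neighbourhood of t.\<close>
    by (rule has_field_derivative_transform_within_open[OF d open_greaterThanLessThan t]) (simp add: energy_eq)
qed

end

lemma dissipation_nonneg: "dissipation ops P \<Omega> U t \<ge> 0"
  by (simp add: dissipation_def)

theorem theorem2p1:
  fixes P :: params and T :: real
  assumes "positive_params P" and "T > 0"
  shows
    "(\<forall>(\<Omega> :: (real^2) set) u0 B0 \<phi>0 U.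
        bounded_convex_domain \<Omega> \<and> CH_MHD_solution ops_2D P \<Omega> T u0 B0 \<phi>0 U \<longrightarrow>
        (\<forall>t\<in>{0<..<T}.
           (energy P \<Omega> U has_real_derivative - dissipation ops_2D P \<Omega> U t) (at t) \<and>
           - dissipation ops_2D P \<Omega> U t \<le> 0))
     \<and>
     (\<forall>(\<Omega> :: (real^3) set) u0 B0 \<phi>0 U.
        bounded_convex_domain \<Omega> \<and> CH_MHD_solution ops_3D P \<Omega> T u0 B0 \<phi>0 U \<longrightarrow>
        (\<forall>t\<in>{0<..<T}.
           (energy P \<Omega> U has_real_derivative - dissipation ops_3D P \<Omega> U t) (at t) \<and>
           - dissipation ops_3D P \<Omega> U t \<le> 0))"
proof (intro conjI allI impI ballI)
  fix \<Omega> :: "(real^2) set" and u0 B0 \<phi>0 U and t :: real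
  assume a: "bounded_convex_domain \<Omega> \<and> CH_MHD_solution ops_2D P \<Omega> T u0 B0 \<phi>0 U" and t: "t \<in> {0<..<T}"
  interpret CH_MHD ops_2D P T \<Omega> U
    by (intro CH_MHD.intro vector_ops_2D CH_MHD_axioms.intro) (use a assms(1) in \<open>simp_all add: CH_MHD_solution_def\<close>)
  show "(energy P \<Omega> U has_real_derivative - dissipation ops_2D P \<Omega> U t) (at t)" by (rule energy_law[OF t])
next
  fix \<Omega> :: "(real^3) set" and u0 B0 \<phi>0 U and t :: real
  assume a: "bounded_convex_domain \<Omega> \<and> CH_MHD_solution ops_3D P \<Omega> T u0 B0 \<phi>0 U" and t: "t \<in> {0<..<T}"
  interpret CH_MHD ops_3D P T \<Omega> U
    by (intro CH_MHD.intro vector_ops_3D CH_MHD_axioms.intro) (use a assms(1) in \<open>simp_all add: CH_MHD_solution_def\<close>)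
  show "(energy P \<Omega> U has_real_derivative - dissipation ops_3D P \<Omega> U t) (at t)" by (rule energy_law[OF t])
qed (use dissipation_nonneg in auto)

end
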